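(* Let $p\in[2,\infty)$, let $p'=p/(p-1)$, let $\sigma,\omega$ be non-negative locally finite Borel measures on $\mathbb{R}^n$, let $\mu\colon\mathbb{R}^{n+1}_+\to[0,\infty)$ be a $\sigma\times\eta$-measurable function such that $\|1_{\widehat Q}\,\mu\|_{L^{p'}(\sigma;\ell^2)}<\infty$ for every $Q\in\mathscr{D}$, and let $\{\lambda_Q\}_{Q\in\mathscr{D}}$ be non-negative real numbers. For every $Q\in\mathscr{D}$ define $$\varphi_Q:=|1_{\widehat Q}\,\mu|_{\ell^2}^{p'-2}\,1_{\widehat Q}\,\mu ,$$ which satisfies $\|\varphi_Q\|_{L^p(\sigma;\ell^2)}<\infty$. Let $\mathcal{T}$ and $\mathcal{T}^*$ denote the smallest possible constants, with the understanding that they may be $\infty$, such that $$\Lambda_Q(\varphi_Q,g)\le\mathcal{T}\,\|\varphi_Q\|_{L^p(\sigma;\ell^2)}\|g\|_{L^{p'}(\omega)}\qquad\text{and}\qquad \Lambda_Q(f,1_Q)\le\mathcal{T}^*\,\|f\|_{L^p(\sigma;\ell^2)}\|1_Q\|_{L^{p'}(\omega)}$$ hold for every $Q\in\mathscr{D}$, every non-negative $\sigma\times\eta$-measurable function $f$ on $\mathbb{R}^{n+1}_+$ and every non-negative Borel function $g$ on $\mathbb{R}^n$. Then there exists a constant $C<\infty$ such that $$\Lambda(f,g)\le C\,\|f\|_{L^p(\sigma;\ell^2)}\|g\|_{L^{p'}(\omega)}$$ holds for all non-negative $\sigma\times\eta$-measurable $f$ on $\mathbb{R}^{n+1}_+$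 and all non-negative Borel functions $g$ on $\mathbb{R}^n$ if and only if $\mathcal{T}+\mathcal{T}^*<\infty$. Moreover, if $\mathcal{T}+\mathcal{T}^*<\infty$, then the smallest possible such constant $C$, denoted $\|\Lambda\|$, satisfies $$\|\Lambda\|\simeq\mathcal{T}+\mathcal{T}^*.$$
   Context: Notation: for $\alpha,\beta\ge0$, $\alpha\lesssim\beta$ means that there exists an absolute constant $C$ such that $\alpha\le C\beta$, and $\alpha\simeq\beta$ means $\alpha\lesssim\beta\lesssim\alpha$. Fix a dimension $n\ge1$. Let $\eta:=\sum_{k\in\mathbb{Z}}\delta_{2^k}$, a measure on $(0,\infty)$ ($\delta_a$ is the Dirac mass at $a$), and equip $\mathbb{R}^{n+1}_+:=\mathbb{R}^n\times(0,\infty)$ with the product measure $\sigma\times\eta$. A $\sigma\times\eta$-measurable function $f$ on $\mathbb{R}^{n+1}_+$ is identified with the sequence $\{f_k\}_{k\in\mathbb{Z}}$ of Borel functions on $\mathbb{R}^n$ given by $f_k(x):=f(x,2^{-k})$ (only the values at $t\in\{2^k:k\in\mathbb{Z}\}$ matter). Write $$|f|_{\ell^2}(x):=\Big(\sum_{k\in\mathbb{Z}}|f_k(x)|^2\Big)^{1/2},\qquad \|f\|_{L^q(\sigma;\ell^2)}:=\Big(\int_{\mathbb{R}^n}|f|_{\ell^2}(x)^q\,\mathrm{d}\sigma(x)\Big)^{1/q},\qquad \|g\|_{L^q(\omega)}:=\Big(\int_{\mathbb{R}^n}|g|^q\,\mathrm{d}\omega\Big)^{1/q},$$ which may equal $\infty$.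 Non-negative functions take values in $[0,\infty)$. $\mathscr{D}:=\{2^{-k}([0,1)^n+m):k\in\mathbb{Z},\,m\in\mathbb{Z}^n\}$ is the dyadic lattice; for $Q\in\mathscr{D}$ with side length $\ell(Q)$, the Carleson box is $\widehat Q:=Q\times(0,\ell(Q)]$. $1_A$ is the characteristic function of $A$. For non-negative $\sigma\times\eta$-measurable $f$, non-negative Borel $g$ and $Q_0\in\mathscr{D}$ define, with values in $[0,\infty]$, $$\Lambda(f,g):=\sum_{Q\in\mathscr{D}}\lambda_Q\iint_{\widehat Q}f\mu\,\mathrm{d}\eta\,\mathrm{d}\sigma\int_Q g\,\mathrm{d}\omega,\qquad \Lambda_{Q_0}(f,g):=\sum_{Q\in\mathscr{D},\,Q\subset Q_0}\lambda_Q\iint_{\widehat Q}f\mu\,\mathrm{d}\eta\,\mathrm{d}\sigma\int_Q g\,\mathrm{d}\omega .$$ Conventions: $0\cdot\infty=0$. In the formula $\varphi_Q(x,t)=|1_{\widehat Q}\mu|_{\ell^2}(x)^{p'-2}\,1_{\widehat Q}(x,t)\mu(x,t)$, the function $\varphi_Q(x,t)$ is understood to be $0$ when $|1_{\widehat Q}\mu|_{\ell^2}(x)\in\{0,\infty\}$ (the value $\infty$ occurs only on a $\sigma$-null set).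
   Formalization: The constant in ‖Λ‖ ≲ T + T* is allowed to depend on p (not on n, σ, ω, μ, λ), since a constant independent of p fails as p → ∞; the constant in T + T* ≲ ‖Λ‖ is absolute. *)

theory Defs
  imports "HOL-Analysis.Analysis"
begin

text \<open>
  The dimension \<open>n\<close> has to be a quantified natural number, since the constants in the theorem do not
  depend on it. Points of Euclidean \<open>n\<close>-space are therefore the functions in
  \<open>{..<n} \<rightarrow>\<^sub>E UNIV\<close> (equal to \<open>undefined\<close> outside of \<open>{..<n}\<close>), and the \<open>n\<close>-fold product of
  the Borel sigma-algebra of the real line is the Borel sigma-algebra.
  Only the space and the measurable sets of \<open>Rn n\<close> are used.
\<close>

type_synonym point = "nat \<Rightarrow> real"

definition Rn :: "nat \<Rightarrow> point measure" where
  "Rn n = (\<Pi>\<^sub>M i\<in>{..<n}. borel)"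

definition locally_finite_borel :: "nat \<Rightarrow> point measure \<Rightarrow> bool" where
  "locally_finite_borel n M \<longleftrightarrow>
     sets M = sets (Rn n) \<and>
     (\<forall>x\<in>space M. \<exists>r>0. emeasure M {y \<in> space M. \<forall>i<n. \<bar>y i - x i\<bar> < r} < \<infinity>)"

text \<open>The push-forward of the counting measure is the sum of the Dirac masses at \<open>2 powi k\<close>;
  see \<open>emeasure_eta\<close> below.\<close>

definition eta :: "real measure" where
  "eta = distr (count_space (UNIV :: int set)) (restrict_space borel {0<..}) (\<lambda>k. 2 powi k)"

text \<open>The measurable functions with values in \<open>[0,\<infinity>)\<close>; values outside of the space are irrelevant.\<close>

definition nonneg_meas :: "'a measure \<Rightarrow> ('a \<Rightarrow> real) \<Rightarrow> bool" where
  "nonneg_meas M f \<longleftrightarrow> f \<in> borel_measurable M \<and> (\<forall>z\<in>space M. 0 \<le> f z)"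

definition dyadic_cube :: "nat \<Rightarrow> int \<Rightarrow> (nat \<Rightarrow> int) \<Rightarrow> point set" where
  "dyadic_cube n k m =
     (\<Pi>\<^sub>E i\<in>{..<n}. {2 powi (- k) * real_of_int (m i) ..< 2 powi (- k) * (real_of_int (m i) + 1)})"

definition dyadic :: "nat \<Rightarrow> point set set" where
  "dyadic n = {dyadic_cube n k m |k m. True}"

text \<open>For \<open>n \<ge> 1\<close> the scale of a cube is determined by the cube as a set;
  see \<open>side_length_dyadic_cube\<close> below.\<close>

definition side_length :: "nat \<Rightarrow> point set \<Rightarrow> real" where
  "side_length n Q = (THE l. \<exists>k m. Q = dyadic_cube n k m \<and> l = 2 powi (- k))"

definition carleson_box :: "nat \<Rightarrow> point set \<Rightarrow> (point \<times> real) set" where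
  "carleson_box n Q = Q \<times> {0<..side_length n Q}"

definition on_box :: "nat \<Rightarrow> point set \<Rightarrow> (point \<times> real \<Rightarrow> real) \<Rightarrow> point \<times> real \<Rightarrow> real" where
  "on_box n Q h = (\<lambda>z. indicator (carleson_box n Q) z * h z)"

text \<open>Powers of extended non-negative numbers, used for exponents \<open>a > 0\<close> only.\<close>

definition ennreal_powr :: "ennreal \<Rightarrow> real \<Rightarrow> ennreal" (infixr "epowr" 80) where
  "x epowr a = (if x = \<infinity> then \<infinity> else ennreal (enn2real x powr a))"

definition l2 :: "(point \<times> real \<Rightarrow> real) \<Rightarrow> point \<Rightarrow> ennreal" where
  "l2 f x = (\<Sum>\<^sub>\<infinity>k\<in>(UNIV :: int set). ennreal (\<bar>f (x, 2 powi (- k))\<bar> ^ 2)) epowr (1/2)"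

definition Lq_l2_norm :: "real \<Rightarrow> point measure \<Rightarrow> (point \<times> real \<Rightarrow> real) \<Rightarrow> ennreal" where
  "Lq_l2_norm q \<sigma> f = (\<integral>\<^sup>+x. l2 f x epowr q \<partial>\<sigma>) epowr (1/q)"

definition Lq_norm :: "real \<Rightarrow> point measure \<Rightarrow> (point \<Rightarrow> real) \<Rightarrow> ennreal" where
  "Lq_norm q \<omega> g = (\<integral>\<^sup>+x. ennreal (\<bar>g x\<bar> powr q) \<partial>\<omega>) epowr (1/q)"

definition conj_exp :: "real \<Rightarrow> real" where
  "conj_exp p = p / (p - 1)"

text \<open>\<open>Lambda_over n S\<close> is the sum over the cubes in \<open>S\<close>.\<close>

definition Lambda_over :: "nat \<Rightarrow> point set set \<Rightarrow> point measure \<Rightarrow> point measure \<Rightarrow>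
    (point \<times> real \<Rightarrow> real) \<Rightarrow> (point set \<Rightarrow> real) \<Rightarrow>
    (point \<times> real \<Rightarrow> real) \<Rightarrow> (point \<Rightarrow> real) \<Rightarrow> ennreal" where
  "Lambda_over n S \<sigma> \<omega> \<mu> lam f g =
     (\<Sum>\<^sub>\<infinity>Q\<in>S. ennreal (lam Q)
        * (\<integral>\<^sup>+x. (\<integral>\<^sup>+t. ennreal (f (x, t) * \<mu> (x, t)) * indicator (carleson_box n Q) (x, t) \<partial>eta) \<partial>\<sigma>)
        * (\<integral>\<^sup>+x\<in>Q. ennreal (g x) \<partial>\<omega>))"

definition Lambda where
  "Lambda n = Lambda_over n (dyadic n)"

definition Lambda_loc where
  "Lambda_loc n Q\<^sub>0 = Lambda_over n {Q \<in> dyadic n. Q \<subseteq> Q\<^sub>0}"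

definition phi :: "nat \<Rightarrow> real \<Rightarrow> (point \<times> real \<Rightarrow> real) \<Rightarrow> point set \<Rightarrow> point \<times> real \<Rightarrow> real" where
  "phi n p \<mu> Q = (\<lambda>(x, t).
     if l2 (on_box n Q \<mu>) x \<in> {0, \<infinity>} then 0
     else enn2real (l2 (on_box n Q \<mu>) x) powr (conj_exp p - 2) * on_box n Q \<mu> (x, t))"

text \<open>The smallest constants are infima in \<open>[0,\<infinity>]\<close>, so they are \<open>\<infinity>\<close> if no finite constant is admissible.\<close>

definition T_const :: "nat \<Rightarrow> real \<Rightarrow> point measure \<Rightarrow> point measure \<Rightarrow>
    (point \<times> real \<Rightarrow> real) \<Rightarrow> (point set \<Rightarrow> real) \<Rightarrow> ennreal" where
  "T_const n p \<sigma> \<omega> \<mu> lam = Inf {C. \<forall>Q\<in>dyadic n. \<forall>g. nonneg_meas \<omega> g \<longrightarrow>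
     Lambda_loc n Q \<sigma> \<omega> \<mu> lam (phi n p \<mu> Q) g
       \<le> C * Lq_l2_norm p \<sigma> (phi n p \<mu> Q) * Lq_norm (conj_exp p) \<omega> g}"

definition T_star_const :: "nat \<Rightarrow> real \<Rightarrow> point measure \<Rightarrow> point measure \<Rightarrow>
    (point \<times> real \<Rightarrow> real) \<Rightarrow> (point set \<Rightarrow> real) \<Rightarrow> ennreal" where
  "T_star_const n p \<sigma> \<omega> \<mu> lam = Inf {C. \<forall>Q\<in>dyadic n. \<forall>f. nonneg_meas (\<sigma> \<Otimes>\<^sub>M eta) f \<longrightarrow>
     Lambda_loc n Q \<sigma> \<omega> \<mu> lam f (indicator Q)
       \<le> C * Lq_l2_norm p \<sigma> f * Lq_norm (conj_exp p) \<omega> (indicator Q)}"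

definition Lambda_bound :: "nat \<Rightarrow> real \<Rightarrow> point measure \<Rightarrow> point measure \<Rightarrow>
    (point \<times> real \<Rightarrow> real) \<Rightarrow> (point set \<Rightarrow> real) \<Rightarrow> ennreal \<Rightarrow> bool" where
  "Lambda_bound n p \<sigma> \<omega> \<mu> lam C \<longleftrightarrow>
     (\<forall>f g. nonneg_meas (\<sigma> \<Otimes>\<^sub>M eta) f \<longrightarrow> nonneg_meas \<omega> g \<longrightarrow>
        Lambda n \<sigma> \<omega> \<mu> lam f g \<le> C * Lq_l2_norm p \<sigma> f * Lq_norm (conj_exp p) \<omega> g)"

definition Lambda_norm :: "nat \<Rightarrow> real \<Rightarrow> point measure \<Rightarrow> point measure \<Rightarrow>
    (point \<times> real \<Rightarrow> real) \<Rightarrow> (point set \<Rightarrow> real) \<Rightarrow> ennreal" where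
  "Lambda_norm n p \<sigma> \<omega> \<mu> lam = Inf {C. Lambda_bound n p \<sigma> \<omega> \<mu> lam C}"

lemma emeasure_eta:
  assumes "A \<in> sets borel" "A \<subseteq> {0<..}"
  shows "emeasure eta A = (\<integral>\<^sup>+k. indicator A (2 powi k) \<partial>count_space (UNIV :: int set))"
proof -
  have A: "A \<in> sets (restrict_space borel {0<..})"
    using assms by (auto simp: sets_restrict_space_iff)
  have meas: "(\<lambda>k. (2::real) powi k) \<in> measurable (count_space (UNIV :: int set)) (restrict_space borel {0<..})"
    by (auto simp: space_restrict_space)
  have "emeasure eta A = emeasure (count_space UNIV) {k :: int. 2 powi k \<in> A}"
    unfolding eta_def by (subst emeasure_distr[OF meas A]) (simp add: vimage_def)
  also have "\<dots> = (\<integral>\<^sup>+k. indicator {k. 2 powi k \<in> A} k \<partial>count_space (UNIV :: int set))"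
    by simp
  also have "\<dots> = (\<integral>\<^sup>+k. indicator A (2 powi k) \<partial>count_space (UNIV :: int set))"
    by (intro nn_integral_cong) (auto simp: indicator_def)
  finally show ?thesis .
qed

lemma side_length_dyadic_cube:
  assumes "n \<ge> 1"
  shows "side_length n (dyadic_cube n k m) = 2 powi (- k)"
  unfolding side_length_def
proof (rule the_equality)
  show "\<exists>k' m'. dyadic_cube n k m = dyadic_cube n k' m' \<and> (2 :: real) powi (- k) = 2 powi (- k')"
    by blast
next
  fix l :: real
  assume "\<exists>k' m'. dyadic_cube n k m = dyadic_cube n k' m' \<and> l = 2 powi (- k')"
  then obtain k' m' where eq: "dyadic_cube n k m = dyadic_cube n k' m'" and l: "l = 2 powi (- k')"
    by blast
  let ?I = "\<lambda>k m i. {(2::real) powi (- k) * real_of_int (m i) ..< 2 powi (- k) * (real_of_int (m i) + 1)}"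
  have less: "(2::real) powi (- k) * real_of_int (m i) < 2 powi (- k) * (real_of_int (m i) + 1)" for k m and i :: nat
    by (intro mult_strict_left_mono) auto
  have ne: "?I k m i \<noteq> {}" for k m and i :: nat
    using less[of k m i] by (metis atLeastLessThan_empty_iff)
  have "?I k m 0 = ?I k' m' 0"
    using eq assms ne unfolding dyadic_cube_def by (subst (asm) PiE_eq_iff_not_empty) auto
  then have "(2::real) powi (- k) * real_of_int (m 0) = 2 powi (- k') * real_of_int (m' 0) \<and>
      (2::real) powi (- k) * (real_of_int (m 0) + 1) = 2 powi (- k') * (real_of_int (m' 0) + 1)"
    using less[of k m 0] less[of k' m' 0] by (metis atLeastLessThan_eq_iff)
  then show "l = 2 powi (- k)"
    unfolding l by (simp add: algebra_simps)
qed

end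

theory Submission
  imports Defs
begin

text \<open>
  Only the sufficiency of testing is at issue; it is proved with parallel stopping cubes. Let
  \<open>\<nu>(Q)\<close> be the integral of \<open>\<bar>1 \<mu>\<bar>\<close> to the power \<open>p'\<close>, with the indicator of the Carleson box of \<open>Q\<close>, and
  let \<open>m\<^sub>P(Q)\<close> be the integral of \<open>\<phi>\<^sub>P \<mu>\<close> over the box of \<open>Q\<close>, so that \<open>m\<^sub>P(P) = \<nu>(P)\<close>. The stopping
  children of \<open>P\<close> for \<open>f\<close> are the maximal cubes \<open>Q\<close> where the integral of \<open>f \<mu>\<close> over the box exceeds
  \<open>4 \<alpha>\<^sub>P m\<^sub>P(Q)\<close>, with \<open>\<alpha>\<^sub>P\<close> the ratio of the integral of \<open>f \<mu>\<close> over the box of \<open>P\<close> to \<open>\<nu>(P)\<close>.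
  By construction their masses \<open>m\<^sub>P\<close> add up to at most \<open>\<nu>(P)/4\<close>. As \<open>p' \<le> 2\<close>, the Cauchy-Schwarz
  inequality turns this into the bound \<open>\<nu>(P)/2\<close> for the sum of their masses \<open>\<nu>\<close>, although \<open>\<nu>\<close> is not
  a measure. Since \<open>p \<ge> 2\<close>, the \<open>p\<close>-th powers of the norms of the restrictions of \<open>f\<close> to disjoint
  sets of the upper half-space add up to at most that of \<open>f\<close>; the two facts give the Carleson
  embedding for the sum of \<open>\<alpha>\<^sub>P\<^sup>p \<nu>(P)\<close>. The function \<open>g\<close> has the same properties, with test functions
  \<open>1\<^sub>Q\<close>. In the part of the form where the stopping cube of \<open>g\<close> lies in that of \<open>f\<close>, one may replace \<open>f\<close>
  by \<open>4 \<alpha>\<^sub>P \<phi>\<^sub>P\<close> and \<open>g\<close> by a localized function, and apply the first testing condition; the other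
  part is symmetric.
\<close>

section \<open>Hoelder's inequality for finite sums of reals\<close>

lemma powr_holder_add:
  fixes a b c d :: real
  assumes "0 \<le> a" "0 \<le> b" "0 \<le> c" "0 \<le> d" "0 < r" "r < 1"
  shows "a powr r * b powr (1 - r) + c powr r * d powr (1 - r) \<le> (a + c) powr r * (b + d) powr (1 - r)"
proof (cases "a + c = 0 \<or> b + d = 0")
  case True
  then have "(a = 0 \<and> c = 0) \<or> (b = 0 \<and> d = 0)" using assms by auto
  then show ?thesis by auto
next
  case False
  then have pos: "a + c > 0" "b + d > 0" using assms by auto
  \<comment> \<open>Young's inequality for \<open>u\<close> and \<open>v\<close> normalized by the
    two sums. When the two instances are added, the coefficients total
    \<open>r + (1 - r) = 1\<close>.\<close>
  have Y: "u powr r * v powr (1 - r) \<le> (r * (u / (a + c)) + (1 - r) * (v / (b + d))) * ((a + c) powr r * (b + d) powr (1 - r))"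
    if "0 \<le> u" "0 \<le> v" for u v
  proof -
    have "(u / (a + c)) powr r * (v / (b + d)) powr (1 - r) \<le> r * (u / (a + c)) + (1 - r) * (v / (b + d))"
    proof (cases "u = 0 \<or> v = 0")
      case True
      then show ?thesis using that pos assms by auto
    next
      case False
      then show ?thesis
        using that pos assms by (intro Youngs_inequality_0) auto
    qed
    then show ?thesis
      using pos that by (simp add: powr_divide field_simps)
  qed
  have "a powr r * b powr (1 - r) + c powr r * d powr (1 - r) \<le>
    (r * (a / (a + c)) + (1 - r) * (b / (b + d)) + (r * (c / (a + c)) + (1 - r) * (d / (b + d)))) * ((a + c) powr r * (b + d) powr (1 - r))"
    using add_mono[OF Y[of a b] Y[of c d]] assms by (simp add: algebra_simps)
  also have "r * (a / (a + c)) + (1 - r) * (b / (b + d)) + (r * (c / (a + c)) + (1 - r) * (d / (b + d))) =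
     r * ((a + c) / (a + c)) + (1 - r) * ((b + d) / (b + d))"
    by (simp only: add_divide_distrib distrib_left)
  also have "\<dots> = 1" using pos by simp
  finally show ?thesis by simp
qed

lemma sum_powr_holder:
  fixes u v :: "'a \<Rightarrow> real"
  assumes "\<And>i. i \<in> A \<Longrightarrow> 0 \<le> u i" "\<And>i. i \<in> A \<Longrightarrow> 0 \<le> v i" "0 < r" "r < 1"
  shows "(\<Sum>i\<in>A. u i powr r * v i powr (1 - r)) \<le> (\<Sum>i\<in>A. u i) powr r * (\<Sum>i\<in>A. v i) powr (1 - r)"
  using assms(1,2)
proof (induction A rule: infinite_finite_induct)
  case (insert x A)
  have "(\<Sum>i\<in>insert x A. u i powr r * v i powr (1 - r)) \<le>
     u x powr r * v x powr (1 - r) + (\<Sum>i\<in>A. u i) powr r * (\<Sum>i\<in>A. v i) powr (1 - r)"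
    using insert by simp
  also have "\<dots> \<le> (u x + (\<Sum>i\<in>A. u i)) powr r * (v x + (\<Sum>i\<in>A. v i)) powr (1 - r)"
    using insert.prems assms(3,4) by (intro powr_holder_add sum_nonneg) auto
  finally show ?case using insert by simp
qed auto

section \<open>Stopping families\<close>

text \<open>Empty sets are excluded so that two members containing a common member share a point and
  are therefore comparable.\<close>

definition laminar :: "'x set set \<Rightarrow> bool" where
  "laminar D \<longleftrightarrow> {} \<notin> D \<and> (\<forall>Q\<in>D. \<forall>R\<in>D. Q \<subseteq> R \<or> R \<subseteq> Q \<or> Q \<inter> R = {})"

text \<open>For a finite subfamily of a laminar family the members above a nonempty \<open>Q\<close>
  form a chain, so the intersection is the smallest of them, if there is any.\<close>

definition ancestor :: "'x set set \<Rightarrow> 'x set \<Rightarrow> 'x set" where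
  "ancestor F Q = \<Inter>{P \<in> F. Q \<subseteq> P}"

text \<open>The last condition makes \<open>P\<close> the least member of \<open>F\<close> strictly
  above \<open>Q\<close>. In a laminar family this agrees with maximality of \<open>Q\<close> among
  the members strictly inside \<open>P\<close>.\<close>

definition children :: "'x set set \<Rightarrow> 'x set \<Rightarrow> 'x set set" where
  "children F P = {Q \<in> F. Q \<subset> P \<and> (\<forall>R\<in>F. Q \<subset> R \<longrightarrow> P \<subseteq> R)}"

lemma ancestor_eqI:
  assumes "P \<in> F" "Q \<subseteq> P" "\<And>R. R \<in> F \<Longrightarrow> Q \<subseteq> R \<Longrightarrow> P \<subseteq> R"
  shows "ancestor F Q = P"
  unfolding ancestor_def using assms by blast

lemma ancestor_least: "R \<in> F \<Longrightarrow> Q \<subseteq> R \<Longrightarrow> ancestor F Q \<subseteq> R"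
  unfolding ancestor_def by blast

lemma ancestor_mono: "Q \<subseteq> R \<Longrightarrow> ancestor F Q \<subseteq> ancestor F R"
  unfolding ancestor_def by blast

lemma children_sub: "children F P \<subseteq> F"
  unfolding children_def by blast

lemma children_psubset: "R \<in> children F P \<Longrightarrow> R \<subset> P"
  unfolding children_def by blast

lemma children_within: "F \<subseteq> D \<Longrightarrow> children F P \<subseteq> {R \<in> D. R \<subseteq> P}"
  unfolding children_def by blast

text \<open>Laminarity leaves only strict nesting to exclude: the larger of two nested children
  would be a member strictly above the smaller one, hence would contain \<open>P\<close>.\<close>

lemma children_disjoint:
  assumes "laminar D" "F \<subseteq> D" "Q \<in> children F P" "R \<in> children F P" "Q \<noteq> R"
  shows "Q \<inter> R = {}"
proof -
  have "Q \<in> F" "R \<in> F" "Q \<subset> P" "R \<subset> P" "Q \<subset> R \<Longrightarrow> P \<subseteq> R" "R \<subset> Q \<Longrightarrow> P \<subseteq> Q"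
    using assms(3,4) unfolding children_def by blast+
  moreover have "Q \<subseteq> R \<or> R \<subseteq> Q \<or> Q \<inter> R = {}"
    using assms(1,2) calculation(1,2) unfolding laminar_def by blast
  ultimately show ?thesis using assms(5) by blast
qed

lemma disjoint_children:
  assumes "laminar D" "F \<subseteq> D" shows "disjoint (children F P)"
  unfolding disjoint_def by (intro ballI impI) (rule children_disjoint[OF assms])

text \<open>A set is a child of at most one \<open>P\<close>, namely of the least member strictly
  above it, so no weight is counted twice.\<close>

lemma sum_children_le:
  fixes w :: "'x set \<Rightarrow> real"
  assumes "finite F" "\<And>Q. Q \<in> F \<Longrightarrow> 0 \<le> w Q"
  shows "(\<Sum>P\<in>F. \<Sum>Q\<in>children F P. w Q) \<le> (\<Sum>Q\<in>F. w Q)"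
proof -
  have fin: "finite (children F P)" for P
    using assms(1) by (simp add: children_def)
  have "(\<Sum>P\<in>F. \<Sum>Q\<in>children F P. w Q) = sum w (\<Union>P\<in>F. children F P)"
    using assms(1) fin by (intro sum.UNION_disjoint[symmetric]) (auto simp: children_def)
  also have "\<dots> \<le> sum w F"
    using assms by (intro sum_mono2) (auto simp: children_def)
  finally show ?thesis .
qed

text \<open>The selection runs from large cubes to small ones: a cube is chosen if nothing chosen
  lies strictly above it or if the least chosen cube strictly above it stops there. As an induction
  this removes a minimal cube, decides the others first, and then decides that cube.\<close>

lemma stopping_family_exists:
  assumes "finite \<Q>"
  shows "\<exists>F\<subseteq>\<Q>. \<forall>Q\<in>\<Q>. Q \<in> F \<longleftrightarrow> (\<forall>P\<in>F. Q \<subset> P \<longrightarrow> (\<forall>R\<in>F. Q \<subset> R \<longrightarrow> P \<subseteq> R) \<longrightarrow> stops P Q)"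
  using assms
proof (induction \<Q> rule: finite_psubset_induct)
  case (psubset \<Q>)
  show ?case
  proof (cases "\<Q> = {}")
    case False
    then obtain Q0 where Q0: "Q0 \<in> \<Q>" "\<And>Q. Q \<in> \<Q> \<Longrightarrow> \<not> Q \<subset> Q0"
      using finite_has_minimal[OF psubset.hyps] by (metis order_less_le)
    then have "\<Q> - {Q0} \<subset> \<Q>" by blast
    then obtain F where F: "F \<subseteq> \<Q> - {Q0}" and
      *: "\<And>Q. Q \<in> \<Q> - {Q0} \<Longrightarrow> Q \<in> F \<longleftrightarrow> (\<forall>P\<in>F. Q \<subset> P \<longrightarrow> (\<forall>R\<in>F. Q \<subset> R \<longrightarrow> P \<subseteq> R) \<longrightarrow> stops P Q)"
      using psubset.IH by (metis (lifting))
    let ?new = "\<forall>P\<in>F. Q0 \<subset> P \<longrightarrow> (\<forall>R\<in>F. Q0 \<subset> R \<longrightarrow> P \<subseteq> R) \<longrightarrow> stops P Q0"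
    define F' where "F' = (if ?new then insert Q0 F else F)"
    \<comment> \<open>No cube lies strictly inside the minimal cube \<open>Q0\<close>, so the rule
      for any cube is unaffected by whether \<open>Q0\<close> is chosen.\<close>
    have eq: "(\<forall>P\<in>F'. Q \<subset> P \<longrightarrow> (\<forall>R\<in>F'. Q \<subset> R \<longrightarrow> P \<subseteq> R) \<longrightarrow> stops P Q) \<longleftrightarrow>
        (\<forall>P\<in>F. Q \<subset> P \<longrightarrow> (\<forall>R\<in>F. Q \<subset> R \<longrightarrow> P \<subseteq> R) \<longrightarrow> stops P Q)" if "Q \<in> \<Q>" for Q
      using Q0(2)[OF that] unfolding F'_def by auto
    have sub: "F' \<subseteq> \<Q>" using F Q0 unfolding F'_def by auto
    have mem: "Q \<in> F' \<longleftrightarrow> (\<forall>P\<in>F'. Q \<subset> P \<longrightarrow> (\<forall>R\<in>F'. Q \<subset> R \<longrightarrow> P \<subseteq> R) \<longrightarrow> stops P Q)"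
      if "Q \<in> \<Q>" for Q
    proof (cases "Q = Q0")
      case True
      have "Q0 \<notin> F" using F by blast
      then have "Q \<in> F' \<longleftrightarrow> ?new" unfolding F'_def True by (simp split: if_split)
      then show ?thesis unfolding eq[OF that] unfolding True .
    next
      case False
      then have "Q \<in> F' \<longleftrightarrow> Q \<in> F" unfolding F'_def by simp
      then show ?thesis unfolding eq[OF that] using *[of Q] that False by blast
    qed
    show ?thesis
      by (rule exI[of _ F'], rule conjI, rule sub, rule ballI, rule mem)
  next
    case True
    show ?thesis unfolding True by simp
  qed
qed

definition stopping_family :: "('x set \<Rightarrow> 'x set \<Rightarrow> bool) \<Rightarrow> 'x set set \<Rightarrow> 'x set set \<Rightarrow> bool" where
  "stopping_family stops \<Q> F \<longleftrightarrow> F \<subseteq> \<Q> \<and>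
     (\<forall>Q\<in>\<Q>. ancestor F Q \<in> F \<and> Q \<subseteq> ancestor F Q \<and> (ancestor F Q = Q \<or> \<not> stops (ancestor F Q) Q)) \<and>
     (\<forall>P\<in>F. \<forall>Q\<in>children F P. stops P Q)"

lemma stopping_familyD:
  assumes "stopping_family stops \<Q> F"
  shows "F \<subseteq> \<Q>" "Q \<in> \<Q> \<Longrightarrow> ancestor F Q \<in> F" "Q \<in> \<Q> \<Longrightarrow> Q \<subseteq> ancestor F Q"
    "Q \<in> \<Q> \<Longrightarrow> ancestor F Q = Q \<or> \<not> stops (ancestor F Q) Q"
    "P \<in> F \<Longrightarrow> Q \<in> children F P \<Longrightarrow> stops P Q"
  using assms unfolding stopping_family_def by - (blast+)

text \<open>A cube that is not chosen violates the selection rule, and the violation supplies the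
  least chosen cube strictly above it, at which stopping did not occur. For a child the rule applies
  directly.\<close>

lemma stopping_family_obtain:
  assumes "finite \<Q>"
  obtains F where "stopping_family stops \<Q> F"
proof -
  obtain F where F: "F \<subseteq> \<Q>" and
    *: "\<forall>Q\<in>\<Q>. Q \<in> F \<longleftrightarrow> (\<forall>P\<in>F. Q \<subset> P \<longrightarrow> (\<forall>R\<in>F. Q \<subset> R \<longrightarrow> P \<subseteq> R) \<longrightarrow> stops P Q)"
    using stopping_family_exists[OF assms, of stops] by (elim exE conjE)
  note * = bspec[OF this(2)]
  have "ancestor F Q \<in> F \<and> Q \<subseteq> ancestor F Q \<and> (ancestor F Q = Q \<or> \<not> stops (ancestor F Q) Q)" if Q: "Q \<in> \<Q>" for Q
  proof (cases "Q \<in> F")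
    case True
    then have "ancestor F Q = Q" by (intro ancestor_eqI) auto
    then show ?thesis using True by simp
  next
    case False
    then obtain P where P: "P \<in> F" "Q \<subset> P" "\<forall>R\<in>F. Q \<subset> R \<longrightarrow> P \<subseteq> R" "\<not> stops P Q"
      using *[OF Q] by blast
    then have "ancestor F Q = P" using False by (intro ancestor_eqI) auto
    then show ?thesis using P by auto
  qed
  moreover have "stops P Q" if "P \<in> F" "Q \<in> children F P" for P Q
    using * F that unfolding children_def by blast
  ultimately have "stopping_family stops \<Q> F"
    unfolding stopping_family_def using F by blast
  then show thesis by (rule that)
qed

section \<open>One side of the bilinear form\<close>

text \<open>The constant left after the recursion of \<open>avg_powr_le\<close> is summed and its
  second term, with factor \<open>(3/4) powr (p - 1) < 1\<close>, is absorbed on the left.\<close>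

definition carleson_const :: "real \<Rightarrow> real" where
  "carleson_const p = 3 powr (p - 1) / (1 - (3/4) powr (p - 1))"

text \<open>
  \<open>I h Q\<close> is the integral of \<open>h\<close> over the box of \<open>Q\<close> with the weight of that side, and \<open>N h\<close> is the
  power of the norm of \<open>h\<close> with the exponent \<open>p\<close>. Both functions of the bilinear form are instances,
  with the exponents \<open>p\<close> and \<open>p'\<close>.
\<close>

locale stopping_side =
  fixes p :: real and D :: "'x set set" and box :: "'x set \<Rightarrow> 'z set" and M :: "'z measure"
    and H :: "('z \<Rightarrow> real) set" and I :: "('z \<Rightarrow> real) \<Rightarrow> 'x set \<Rightarrow> real" and N :: "('z \<Rightarrow> real) \<Rightarrow> real"
    and test :: "'x set \<Rightarrow> 'z \<Rightarrow> real"
  assumes p: "1 < p"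
    and laminar: "laminar D"
    and box_sets: "Q \<in> D \<Longrightarrow> box Q \<in> sets M"
    and box_mono: "Q \<in> D \<Longrightarrow> R \<in> D \<Longrightarrow> Q \<subseteq> R \<Longrightarrow> box Q \<subseteq> box R"
    and box_disj: "Q \<in> D \<Longrightarrow> R \<in> D \<Longrightarrow> Q \<inter> R = {} \<Longrightarrow> box Q \<inter> box R = {}"
    and H_nonneg: "h \<in> H \<Longrightarrow> Q \<in> D \<Longrightarrow> z \<in> box Q \<Longrightarrow> 0 \<le> h z"
    and H_add: "u \<in> H \<Longrightarrow> v \<in> H \<Longrightarrow> (\<lambda>z. u z + v z) \<in> H"
    and H_scale: "u \<in> H \<Longrightarrow> 0 \<le> c \<Longrightarrow> (\<lambda>z. c * u z) \<in> H"
    and H_indicator: "u \<in> H \<Longrightarrow> E \<in> sets M \<Longrightarrow> (\<lambda>z. indicator E z * u z) \<in> H"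
    and I_add: "u \<in> H \<Longrightarrow> v \<in> H \<Longrightarrow> Q \<in> D \<Longrightarrow> I (\<lambda>z. u z + v z) Q = I u Q + I v Q"
    and I_scale: "u \<in> H \<Longrightarrow> 0 \<le> c \<Longrightarrow> Q \<in> D \<Longrightarrow> I (\<lambda>z. c * u z) Q = c * I u Q"
    and I_mono: "u \<in> H \<Longrightarrow> v \<in> H \<Longrightarrow> Q \<in> D \<Longrightarrow> (\<And>z. z \<in> box Q \<Longrightarrow> u z \<le> v z) \<Longrightarrow> I u Q \<le> I v Q"
    and I_box: "u \<in> H \<Longrightarrow> Q \<in> D \<Longrightarrow> R \<in> D \<Longrightarrow> R \<subseteq> Q \<Longrightarrow> I (\<lambda>z. indicator (box R) z * u z) Q = I u R"
    and N_nonneg: "u \<in> H \<Longrightarrow> 0 \<le> N u"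
    and N_add: "u \<in> H \<Longrightarrow> v \<in> H \<Longrightarrow> N (\<lambda>z. u z + v z) \<le> 2 powr p * (N u + N v)"
    and N_scale: "u \<in> H \<Longrightarrow> 0 \<le> c \<Longrightarrow> N (\<lambda>z. c * u z) = c powr p * N u"
    and N_split: "u \<in> H \<Longrightarrow> finite \<R> \<Longrightarrow> (\<And>R. R \<in> \<R> \<Longrightarrow> Es R \<in> sets M) \<Longrightarrow> disjoint_family_on Es \<R> \<Longrightarrow>
      (\<Sum>R\<in>\<R>. N (\<lambda>z. indicator (Es R) z * u z)) \<le> N u"
    and N_disjoint: "finite \<R> \<Longrightarrow> \<R> \<subseteq> D \<Longrightarrow> disjoint \<R> \<Longrightarrow> (\<And>R. R \<in> \<R> \<Longrightarrow> w R \<in> H) \<Longrightarrow>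
      N (\<lambda>z. \<Sum>R\<in>\<R>. indicator (box R) z * w R z) \<le> (\<Sum>R\<in>\<R>. N (\<lambda>z. indicator (box R) z * w R z))"
    and holder: "u \<in> H \<Longrightarrow> Q \<in> D \<Longrightarrow> I u Q \<le> N u powr (1/p) * I (test Q) Q powr (1 - 1/p)"
    and test_H: "Q \<in> D \<Longrightarrow> test Q \<in> H"
    and N_test: "Q \<in> D \<Longrightarrow> N (test Q) = I (test Q) Q"
    and packing: "Q \<in> D \<Longrightarrow> finite \<R> \<Longrightarrow> \<R> \<subseteq> {R \<in> D. R \<subseteq> Q} \<Longrightarrow> disjoint \<R> \<Longrightarrow>
      (\<Sum>R\<in>\<R>. I (test Q) R) \<le> I (test Q) Q / 4 \<Longrightarrow> (\<Sum>R\<in>\<R>. I (test R) R) \<le> I (test Q) Q / 2"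
begin

section \<open>Consequences of additivity and monotonicity\<close>

lemma I_nonneg:
  assumes "u \<in> H" "Q \<in> D" shows "0 \<le> I u Q"
proof -
  have "I (\<lambda>z. 0 * u z) Q \<le> I u Q"
    using assms H_nonneg by (intro I_mono H_scale) auto
  then show ?thesis using I_scale[of u 0 Q] assms by simp
qed

lemma H_zero: "u \<in> H \<Longrightarrow> (\<lambda>z. 0) \<in> H"
  using H_scale[of u 0] by simp

lemma H_sum:
  assumes "h \<in> H" "\<And>i. i \<in> A \<Longrightarrow> u i \<in> H"
  shows "(\<lambda>z. \<Sum>i\<in>A. u i z) \<in> H"
  using assms(2)
  by (induction A rule: infinite_finite_induct) (auto intro!: H_add H_zero[OF assms(1)])

lemma I_sum:
  assumes "h \<in> H" "Q \<in> D" "\<And>i. i \<in> A \<Longrightarrow> u i \<in> H"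
  shows "I (\<lambda>z. \<Sum>i\<in>A. u i z) Q = (\<Sum>i\<in>A. I (u i) Q)"
proof -
  have 0: "I (\<lambda>z. 0) Q = 0" using I_scale[of h 0 Q] assms by simp
  show ?thesis using assms(3)
    by (induction A rule: infinite_finite_induct) (auto simp: 0 I_add assms(2) H_sum[OF assms(1)])
qed

text \<open>On the box, \<open>h\<close> is at most the sum of its restrictions to the covering
  sets; overlaps do no harm because \<open>h\<close> is non-negative there.\<close>

lemma I_cover_le:
  assumes "h \<in> H" "Q \<in> D" "finite \<R>" "\<R> \<subseteq> {R \<in> D. R \<subseteq> Q}" "E \<in> sets M" "box Q \<subseteq> E \<union> \<Union>(box ` \<R>)"
  shows "I h Q \<le> I (\<lambda>z. indicator E z * h z) Q + (\<Sum>R\<in>\<R>. I h R)"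
proof -
  have H: "(\<lambda>z. indicator (box R) z * h z) \<in> H" if "R \<in> \<R>" for R
    using that assms box_sets by (intro H_indicator) auto
  have "I h Q \<le> I (\<lambda>z. indicator E z * h z + (\<Sum>R\<in>\<R>. indicator (box R) z * h z)) Q"
  proof (intro I_mono H_add H_indicator H_sum[OF assms(1)] assms H)
    show "box R \<in> sets M" if "R \<in> \<R>" for R using that assms(4) box_sets by auto
    fix z assume z: "z \<in> box Q"
    then have h: "0 \<le> h z" using H_nonneg assms by blast
    have nn: "0 \<le> (\<Sum>R\<in>\<R>. indicator (box R) z * h z)" using h by (intro sum_nonneg) auto
    show "h z \<le> indicator E z * h z + (\<Sum>R\<in>\<R>. indicator (box R) z * h z)"
    proof (cases "z \<in> E")
      case False
      then obtain R where R: "R \<in> \<R>" "z \<in> box R" using z assms(6) by blast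
      have "indicator (box R) z * h z \<le> (\<Sum>R\<in>\<R>. indicator (box R) z * h z)"
        using R h assms(3) by (intro member_le_sum) auto
      then show ?thesis using R False by simp
    qed (use nn in auto)
  qed
  also have "\<dots> = I (\<lambda>z. indicator E z * h z) Q + (\<Sum>R\<in>\<R>. I (\<lambda>z. indicator (box R) z * h z) Q)"
    using I_add[OF H_indicator[OF assms(1,5)] H_sum[OF assms(1), of \<R>, OF H] assms(2)]
      I_sum[OF assms(1,2), of \<R>, OF H] by simp
  also have "(\<Sum>R\<in>\<R>. I (\<lambda>z. indicator (box R) z * h z) Q) = (\<Sum>R\<in>\<R>. I h R)"
    using assms by (intro sum.cong) (auto intro!: I_box)
  finally show ?thesis .
qed

section \<open>The stopping rule and the parts outside the children\<close>

definition avg :: "('z \<Rightarrow> real) \<Rightarrow> 'x set \<Rightarrow> real" where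
  "avg h Q = I h Q / I (test Q) Q"

text \<open>The comparison inside \<open>Q\<close> uses the test function of \<open>P\<close>, not
  that of \<open>Q\<close>. As long as there is no stopping, \<open>h\<close> can then be replaced
  by a multiple of one function, to which the testing condition on \<open>P\<close> applies.\<close>

definition stops :: "('z \<Rightarrow> real) \<Rightarrow> 'x set \<Rightarrow> 'x set \<Rightarrow> bool" where
  "stops h P Q \<longleftrightarrow> 4 * avg h P * I (test P) Q < I h Q"

text \<open>For Carleson boxes this is a set in the half-space: it keeps the points above a child at
  heights larger than the side length of that child.\<close>

definition rest :: "'x set set \<Rightarrow> 'x set \<Rightarrow> 'z set" where
  "rest F P = box P - \<Union>(box ` children F P)"

lemma powr_34: "(3/4) powr (p - 1) < 1"
  using p powr_less_mono2[of "p - 1" "3/4" 1] by simp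

lemma carleson_const_pos: "0 < carleson_const p"
  unfolding carleson_const_def using powr_34 by simp

text \<open>If the test mass were zero, the right side of \<open>holder\<close> would
  vanish.\<close>

lemma test_pos:
  assumes "h \<in> H" "Q \<in> D" "0 < I h Q"
  shows "0 < I (test Q) Q"
proof (rule ccontr)
  assume "\<not> ?thesis"
  then have "I (test Q) Q = 0" using I_nonneg[of "test Q" Q] test_H assms by force
  then show False using holder[OF assms(1,2)] assms(3) by simp
qed

lemma rest_sets:
  assumes "finite F" "F \<subseteq> D" "P \<in> F"
  shows "rest F P \<in> sets M"
proof -
  have "finite (children F P)" "children F P \<subseteq> D"
    using children_sub[of F P] assms finite_subset by blast+
  then show ?thesis
    unfolding rest_def using assms by (intro sets.Diff sets.finite_UN box_sets) auto
qed

text \<open>If \<open>P'\<close> is strictly inside \<open>P\<close>, a maximal member between them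
  is a child of \<open>P\<close>, and its box, which contains that of \<open>P'\<close>, has been
  removed from the box of \<open>P\<close>. Disjoint cubes have disjoint boxes.\<close>

lemma rest_disjoint:
  assumes finF: "finite F" and F_D: "F \<subseteq> D"
  shows "disjoint_family_on (rest F) F"
proof -
  have sub: "rest F P \<inter> rest F P' = {}" if PP: "P \<in> F" "P' \<in> F" "P' \<subset> P" for P P'
  proof -
    let ?C = "{R \<in> F. P' \<subseteq> R \<and> R \<subset> P}"
    have "finite ?C" "P' \<in> ?C" using finF PP by auto
    then obtain R where R: "R \<in> ?C" "P' \<subseteq> R" "\<And>R'. R' \<in> ?C \<Longrightarrow> R \<subseteq> R' \<Longrightarrow> R = R'"
      using finite_has_maximal2[of ?C P'] by (metis (no_types, lifting))
    have ne: "P' \<noteq> {}" using PP F_D laminar unfolding laminar_def by blast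
    have "R \<in> children F P"
      unfolding children_def
    proof (intro CollectI conjI ballI impI subsetI)
      fix S x assume S: "S \<in> F" "R \<subset> S" and x: "x \<in> P"
      \<comment> \<open>Both sets contain the nonempty \<open>P'\<close>, so laminarity makes them
        comparable. The case \<open>S \<subset> P\<close> contradicts the maximality of
        \<open>R\<close>.\<close>
      have "S \<inter> P \<noteq> {}" using S R PP ne by blast
      then consider "S \<subset> P" | "P \<subseteq> S" using laminar PP S F_D unfolding laminar_def by blast
      then show "x \<in> S"
      proof cases
        case 1
        then have "R = S" using R(3)[of S] S R(1) by blast
        then show ?thesis using S by blast
      qed (use x in auto)
    qed (use R in auto)
    moreover have "box P' \<subseteq> box R" using R PP F_D by (intro box_mono) auto
    ultimately show ?thesis unfolding rest_def by blast
  qed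
  show ?thesis
    unfolding disjoint_family_on_def
  proof (intro ballI impI)
    fix P P' assume P: "P \<in> F" "P' \<in> F" "P \<noteq> P'"
    then consider "P \<subset> P'" | "P' \<subset> P" | "P \<inter> P' = {}" using laminar F_D unfolding laminar_def by blast
    then show "rest F P \<inter> rest F P' = {}"
    proof cases
      case 3
      then have "box P \<inter> box P' = {}" using P F_D by (intro box_disj) auto
      then show ?thesis unfolding rest_def by blast
    qed (use sub P in blast)+
  qed
qed

lemma sum_rest_le: "finite F \<Longrightarrow> F \<subseteq> D \<Longrightarrow> u \<in> H \<Longrightarrow> (\<Sum>P\<in>F. N (\<lambda>z. indicator (rest F P) z * u z)) \<le> N u"
  using rest_sets rest_disjoint by (intro N_split) auto

end

section \<open>The Carleson embedding for a stopped function\<close>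

locale stopped_side = stopping_side +
  fixes \<Q> F h
  assumes h: "h \<in> H" and fin: "finite \<Q>" and \<Q>: "\<Q> \<subseteq> D" and pos: "\<And>Q. Q \<in> \<Q> \<Longrightarrow> 0 < I h Q"
    and stopping: "stopping_family (stops h) \<Q> F"
begin

lemmas F_sub = stopping_familyD(1)[OF stopping]
lemmas F_D = subset_trans[OF F_sub \<Q>]
lemmas finF = finite_subset[OF F_sub fin]
lemmas ancestor_in = stopping_familyD(2,3)[OF stopping]

lemma avg_test: "Q \<in> \<Q> \<Longrightarrow> avg h Q * I (test Q) Q = I h Q"
  unfolding avg_def using test_pos[OF h _ pos] \<Q> by fastforce

lemma avg_nonneg: "Q \<in> \<Q> \<Longrightarrow> 0 \<le> avg h Q"
  unfolding avg_def using I_nonneg h test_H \<Q> by auto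

text \<open>For a stopping cube \<open>avg_test\<close> gives equality already without the factor 4;
  otherwise the failure of stopping is the claim.\<close>

lemma I_le_ancestor:
  assumes "Q \<in> \<Q>" shows "I h Q \<le> 4 * avg h (ancestor F Q) * I (test (ancestor F Q)) Q"
proof -
  consider "ancestor F Q = Q" | "\<not> stops h (ancestor F Q) Q"
    using stopping_familyD(4)[OF stopping assms] by blast
  then show ?thesis
  proof cases
    case 1
    then show ?thesis using avg_test[OF assms] pos[OF assms] by simp
  qed (simp add: stops_def)
qed

lemmas children_D = subset_trans[OF children_sub F_D]
lemmas finite_children = finite_subset[OF children_sub finF]
lemmas children_within = children_within[OF F_D]
lemmas disjoint_children = disjoint_children[OF laminar F_D]

text \<open>Over each child the integral of \<open>h\<close> exceeds \<open>4 * avg h P\<close>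
  times the mass of \<open>test P\<close>, while the boxes of the children are disjoint, so these
  integrals total at most \<open>avg h P * I (test P) P\<close>. The masses of \<open>test P\<close>
  hence add up to at most a quarter, and \<open>packing\<close> passes to the children's own test
  functions.\<close>

lemma sum_children:
  assumes P: "P \<in> F"
  shows "(\<Sum>R\<in>children F P. I (test R) R) \<le> I (test P) P / 2"
proof -
  have PQ: "P \<in> \<Q>" "P \<in> D" using P F_sub F_D by auto
  have pos': "0 < avg h P"
    unfolding avg_def using PQ pos test_pos[OF h] by auto
  have 1: "4 * avg h P * I (test P) R \<le> I h R" if "R \<in> children F P" for R
    using stopping_familyD(5)[OF stopping P that] unfolding stops_def by simp
  have "(\<Sum>R\<in>children F P. I h R) = (\<Sum>R\<in>children F P. I (\<lambda>z. indicator (box R) z * h z) P)"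
    using children_within[of P] PQ h by (intro sum.cong) (auto intro!: I_box[symmetric])
  also have "\<dots> = I (\<lambda>z. \<Sum>R\<in>children F P. indicator (box R) z * h z) P"
    using children_D[of P] PQ h box_sets by (intro I_sum[symmetric]) (auto intro!: H_indicator)
  also have "\<dots> \<le> I h P"
  proof (intro I_mono H_sum[OF h] H_indicator h)
    show "box R \<in> sets M" if "R \<in> children F P" for R using that children_D[of P] box_sets by auto
    fix z assume z: "z \<in> box P"
    then have hz: "0 \<le> h z" using H_nonneg h PQ by blast
    have "disjoint_family_on box (children F P)"
      unfolding disjoint_family_on_def
      by (intro ballI impI box_disj children_disjoint[OF laminar F_D] subsetD[OF children_D])
    then have "(\<Sum>R\<in>children F P. indicator (box R) z) = (indicator (\<Union>(box ` children F P)) z :: real)"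
      using finite_children by (simp add: indicator_UN_disjoint)
    then show "(\<Sum>R\<in>children F P. indicator (box R) z * h z) \<le> h z"
      using hz by (simp add: sum_distrib_right[symmetric] indicator_def)
  qed (use PQ in auto)
  also have "\<dots> = avg h P * I (test P) P" using avg_test PQ by simp
  finally have "(\<Sum>R\<in>children F P. I h R) \<le> avg h P * I (test P) P" .
  with sum_mono[OF 1] have "(\<Sum>R\<in>children F P. 4 * avg h P * I (test P) R) \<le> avg h P * I (test P) P"
    by (rule order_trans)
  then have "avg h P * (\<Sum>R\<in>children F P. I (test P) R) \<le> avg h P * (I (test P) P / 4)"
    by (simp add: sum_distrib_left[symmetric] mult.assoc)
  then have "(\<Sum>R\<in>children F P. I (test P) R) \<le> I (test P) P / 4"
    using pos' by simp
  then show ?thesis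
    using PQ by (intro packing children_within finite_children disjoint_children)
qed

text \<open>
  The constant 4 next to the first term compensates the factor 1/4 of its weight, which leaves
  \<open>1/4 + 1/2 < 1\<close> for the total weight in Hoelder's inequality.
\<close>

lemma avg_powr_le:
  assumes P: "P \<in> F"
  shows "avg h P powr p * I (test P) P \<le> 3 powr (p - 1) * N (\<lambda>z. indicator (rest F P) z * h z)
     + (3/4) powr (p - 1) * (\<Sum>R\<in>children F P. avg h R powr p * I (test R) R)"
proof -
  have PQ: "P \<in> \<Q>" "P \<in> D" using P F_sub F_D by auto
  define r where "r = 1 / p"
  have r: "0 < r" "r < 1" "r * p = 1" using p unfolding r_def by auto
  define \<nu> where "\<nu> = I (test P) P"
  define a where "a = N (\<lambda>z. indicator (rest F P) z * h z)"
  define S where "S = (\<Sum>R\<in>children F P. avg h R powr p * I (test R) R)"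
  have Hr: "(\<lambda>z. indicator (rest F P) z * h z) \<in> H"
    using h rest_sets[OF finF F_D P] by (intro H_indicator)
  have \<nu>: "\<nu> > 0" unfolding \<nu>_def using test_pos[OF h] PQ pos by auto
  have a: "a \<ge> 0" unfolding a_def by (rule N_nonneg[OF Hr])
  have nn: "0 \<le> I (test R) R" if "R \<in> children F P" for R
    using that I_nonneg test_H children_D[of P] by auto
  have S: "S \<ge> 0" unfolding S_def using nn by (intro sum_nonneg) auto
  have "I h P \<le> I (\<lambda>z. indicator (rest F P) z * h z) P + (\<Sum>R\<in>children F P. I h R)"
    using children_within[of P] finite_children[of P] h PQ rest_sets[OF finF F_D P]
    by (intro I_cover_le) (auto simp: rest_def)
  also have "I (\<lambda>z. indicator (rest F P) z * h z) P \<le> a powr r * \<nu> powr (1 - r)"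
    using holder[OF Hr PQ(2)] by (simp add: a_def r_def \<nu>_def)
  also have "a powr r * \<nu> powr (1 - r) = (4 powr (p - 1) * a) powr r * (\<nu> / 4) powr (1 - r)"
  proof -
    have "(p - 1) * r = 1 - r" using r by (simp add: algebra_simps)
    then show ?thesis using a \<nu> by (simp add: powr_mult powr_divide powr_powr)
  qed
  \<comment> \<open>Each integral is written as a product of its weight in the embedding to the
    power \<open>1/p\<close> and its test mass to the power \<open>1 - 1/p\<close>, ready for
    Hoelder's inequality over the children.\<close>
  also have "(\<Sum>R\<in>children F P. I h R) =
    (\<Sum>R\<in>children F P. (avg h R powr p * I (test R) R) powr r * (I (test R) R) powr (1 - r))"
  proof (intro sum.cong refl)
    fix R assume R: "R \<in> children F P"
    then have RQ: "R \<in> \<Q>" using children_sub[of F P] F_sub by auto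
    have "(avg h R powr p * I (test R) R) powr r * (I (test R) R) powr (1 - r) =
       avg h R powr (p * r) * (I (test R) R powr r * I (test R) R powr (1 - r))"
      using nn[OF R] by (simp add: powr_mult powr_powr)
    also have "\<dots> = avg h R * I (test R) R"
      using r nn[OF R] avg_nonneg[OF RQ] by (simp add: powr_add[symmetric] mult.commute)
    finally show "I h R = (avg h R powr p * I (test R) R) powr r * (I (test R) R) powr (1 - r)"
      using avg_test[OF RQ] by simp
  qed
  also have "\<dots> \<le> S powr r * (\<Sum>R\<in>children F P. I (test R) R) powr (1 - r)"
    unfolding S_def using nn r by (intro sum_powr_holder) auto
  also have "\<dots> \<le> S powr r * (\<nu> / 2) powr (1 - r)"
    using sum_children[OF P] r nn by (intro mult_left_mono powr_mono2 sum_nonneg) (auto simp: \<nu>_def)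
  also have "(4 powr (p - 1) * a) powr r * (\<nu> / 4) powr (1 - r) + S powr r * (\<nu> / 2) powr (1 - r) \<le>
     (4 powr (p - 1) * a + S) powr r * (\<nu> / 4 + \<nu> / 2) powr (1 - r)"
    using a S \<nu> r by (intro powr_holder_add) auto
  finally have le: "I h P \<le> (4 powr (p - 1) * a + S) powr r * (3 / 4 * \<nu>) powr (1 - r)"
    by simp
  \<comment> \<open>The power \<open>p\<close> of the bound for \<open>I h P\<close> contains
    \<open>\<nu> powr (p - 1)\<close>, which cancels against the denominator of the average.\<close>
  have "avg h P powr p * \<nu> = I h P powr p * \<nu> powr (1 - p)"
    using \<nu> pos[OF PQ(1)] by (simp add: avg_def \<nu>_def[symmetric] powr_divide powr_diff)
  also have "I h P powr p \<le> ((4 powr (p - 1) * a + S) powr r * (3 / 4 * \<nu>) powr (1 - r)) powr p"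
    using le pos[OF PQ(1)] p by (intro powr_mono2) auto
  also have "\<dots> = (4 powr (p - 1) * a + S) * (3 / 4 * \<nu>) powr (p - 1)"
  proof -
    have "(1 - r) * p = p - 1" using r by (simp add: algebra_simps)
    then show ?thesis using r a S \<nu> by (simp add: powr_mult powr_powr del: powr_mult_base)
  qed
  also have "(4 powr (p - 1) * a + S) * (3 / 4 * \<nu>) powr (p - 1) * \<nu> powr (1 - p) =
     (4 powr (p - 1) * a + S) * (3 / 4) powr (p - 1) * (\<nu> powr (p - 1) * \<nu> powr (1 - p))"
    using \<nu> by (simp add: powr_mult powr_divide)
  also have "\<nu> powr (p - 1) * \<nu> powr (1 - p) = 1"
    using \<nu> by (simp add: powr_add[symmetric])
  finally have "avg h P powr p * \<nu> \<le> (4 powr (p - 1) * a + S) * (3 / 4) powr (p - 1)"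
    by (simp add: mult_right_mono)
  also have "(4 powr (p - 1) * a + S) * (3 / 4) powr (p - 1) =
      (4 powr (p - 1) * (3 / 4) powr (p - 1)) * a + (3 / 4) powr (p - 1) * S"
    by (simp only: algebra_simps)
  \<comment> \<open>The compensating 4 and the total weight 3/4 combine to the 3 of
    \<open>carleson_const\<close>.\<close>
  also have "4 powr (p - 1) * (3 / 4) powr (p - 1) = (3 powr (p - 1) :: real)"
    by (simp add: powr_mult[symmetric])
  finally show ?thesis
    unfolding \<nu>_def a_def S_def .
qed

lemma weight_nonneg: "P \<in> F \<Longrightarrow> 0 \<le> avg h P powr p * I (test P) P"
  using F_D I_nonneg test_H by auto

text \<open>The recursion \<open>avg_powr_le\<close> is summed over \<open>F\<close>. The sets
  \<open>rest F P\<close> are disjoint and contribute at most \<open>N h\<close>; the sums over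
  children reproduce at most the left side with a factor below 1, and this finite quantity is
  absorbed.\<close>

lemma carleson_embedding: "(\<Sum>P\<in>F. avg h P powr p * I (test P) P) \<le> carleson_const p * N h"
proof -
  let ?y = "\<lambda>P. avg h P powr p * I (test P) P"
  have y: "0 \<le> ?y P" if "P \<in> F" for P using that F_D I_nonneg test_H by auto
  have "(\<Sum>P\<in>F. ?y P) \<le> 3 powr (p - 1) * (\<Sum>P\<in>F. N (\<lambda>z. indicator (rest F P) z * h z)) +
      (3/4) powr (p - 1) * (\<Sum>P\<in>F. \<Sum>R\<in>children F P. ?y R)"
    using sum_mono[OF avg_powr_le, of F] by (simp add: sum.distrib sum_distrib_left)
  also have "\<dots> \<le> 3 powr (p - 1) * N h + (3/4) powr (p - 1) * (\<Sum>P\<in>F. ?y P)"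
    using y by (intro add_mono mult_left_mono sum_rest_le h sum_children_le finF F_D) auto
  finally have "(1 - (3/4) powr (p - 1)) * (\<Sum>P\<in>F. ?y P) \<le> 3 powr (p - 1) * N h"
    by (simp add: algebra_simps)
  then have "(\<Sum>P\<in>F. ?y P) \<le> 3 powr (p - 1) * N h / (1 - (3/4) powr (p - 1))"
    using powr_34 by (subst pos_le_divide_eq) (simp_all only: mult.commute diff_gt_0_iff_gt)
  then show ?thesis
    unfolding carleson_const_def by simp
qed

end

section \<open>Two stopped functions and the two halves of the form\<close>

locale two_sides = s1: stopping_side p D box1 M1 H1 I1 N1 test1 + s2: stopping_side q D box2 M2 H2 I2 N2 test2
  for p q :: real and D :: "'x set set"
  and box1 :: "'x set \<Rightarrow> 'y set" and M1 H1 I1 N1 test1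
  and box2 :: "'x set \<Rightarrow> 'z set" and M2 H2 I2 N2 test2 +
  assumes conj: "1/p + 1/q = 1"
begin

context
  fixes \<Q> F G :: "'x set set" and f g
  assumes f_stopped: "stopped_side p D box1 M1 H1 I1 N1 test1 \<Q> F f"
    and g_stopped: "stopped_side q D box2 M2 H2 I2 N2 test2 \<Q> G g"
begin

interpretation f: stopped_side p D box1 M1 H1 I1 N1 test1 \<Q> F f by (rule f_stopped)
interpretation g: stopped_side q D box2 M2 H2 I2 N2 test2 \<Q> G g by (rule g_stopped)

text \<open>The condition is met by each child inside a cube \<open>Q\<close> with stopping cube
  \<open>P\<close> for \<open>f\<close> whose stopping cube for \<open>g\<close> lies in
  \<open>P\<close>, because \<open>ancestor G\<close> is monotone.\<close>

definition replaced :: "'x set \<Rightarrow> 'x set set" where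
  "replaced P = {R \<in> children F P. ancestor G R \<subseteq> P}"

text \<open>By \<open>I_le_ancestor\<close> its integral over the box of \<open>R\<close> is at
  least that of \<open>g\<close>, and its norm is governed by the Carleson embedding for
  \<open>g\<close>.\<close>

definition replacement :: "'x set \<Rightarrow> 'z \<Rightarrow> real" where
  "replacement R = (\<lambda>z. 4 * s2.avg g (ancestor G R) * test2 (ancestor G R) z)"

text \<open>The boxes are those of \<open>g\<close>, the stopping cubes those of \<open>f\<close>.
  Restricting \<open>g\<close> to whole boxes would count it in many nested cubes \<open>P\<close>;
  keeping it only off the children and substituting \<open>replacement\<close> on them makes the
  norms summable over \<open>P\<close>.\<close>

definition localized :: "'x set \<Rightarrow> 'z \<Rightarrow> real" where
  "localized P = (\<lambda>z. indicator (s2.rest F P) z * g z + (\<Sum>R\<in>replaced P. indicator (box2 R) z * replacement R z))"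

lemma replaced_sub: "replaced P \<subseteq> children F P" "replaced P \<subseteq> \<Q>" "replaced P \<subseteq> D" "finite (replaced P)"
  "disjoint (replaced P)"
proof -
  show 1: "replaced P \<subseteq> children F P" unfolding replaced_def by blast
  show "replaced P \<subseteq> \<Q>" by (intro subset_trans[OF 1] subset_trans[OF children_sub] f.F_sub)
  show "replaced P \<subseteq> D" by (intro subset_trans[OF 1] f.children_D)
  show "finite (replaced P)" by (intro finite_subset[OF 1] f.finite_children)
  show "disjoint (replaced P)"
    using f.disjoint_children[of P] 1 by (rule pairwise_subset)
qed

lemma ancestor_G: "R \<in> \<Q> \<Longrightarrow> ancestor G R \<in> G" "R \<in> \<Q> \<Longrightarrow> ancestor G R \<in> \<Q>" "R \<in> \<Q> \<Longrightarrow> ancestor G R \<in> D"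
  "R \<in> \<Q> \<Longrightarrow> R \<subseteq> ancestor G R"
  using g.ancestor_in[of R] g.F_sub g.F_D by auto

lemma replacement_H: "R \<in> \<Q> \<Longrightarrow> replacement R \<in> H2"
  unfolding replacement_def using ancestor_G[of R] g.avg_nonneg[of "ancestor G R"]
  by (intro s2.H_scale s2.test_H) auto

lemma box_replacement_H: "R \<in> \<Q> \<Longrightarrow> (\<lambda>z. indicator (box2 R) z * replacement R z) \<in> H2"
  using g.\<Q> by (intro s2.H_indicator replacement_H s2.box_sets) auto

lemma localized_H:
  assumes "P \<in> F" shows "localized P \<in> H2"
  unfolding localized_def using assms replaced_sub(2)
  by (intro s2.H_add s2.H_indicator s2.H_sum[OF g.h] g.h s2.rest_sets f.finF f.F_D box_replacement_H) auto

text \<open>With \<open>P\<close> the stopping cube of \<open>Q\<close> for \<open>f\<close>, no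
  child of \<open>P\<close> contains \<open>Q\<close>. So the children whose boxes meet that of
  \<open>Q\<close> lie inside \<open>Q\<close>, are replaced, and together with
  \<open>rest F P\<close> cover the box. On each of them the replacement has the larger
  integral.\<close>

lemma I_le_localized:
  assumes Q: "Q \<in> \<Q>" and le: "ancestor G Q \<subseteq> ancestor F Q"
  shows "I2 g Q \<le> I2 (localized (ancestor F Q)) Q"
proof -
  define P where "P = ancestor F Q"
  have P: "P \<in> F" "P \<in> D" "Q \<subseteq> P" "Q \<in> D"
    using f.ancestor_in[OF Q] f.F_D Q f.\<Q> unfolding P_def by auto
  define \<R> where "\<R> = {R \<in> children F P. R \<subseteq> Q}"
  have "ancestor G R \<subseteq> P" if "R \<in> \<R>" for R
    using ancestor_mono[of R Q G] le that unfolding \<R>_def P_def by blast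
  then have \<R>0: "\<R> \<subseteq> replaced P" unfolding \<R>_def replaced_def by auto
  note \<R> = \<R>0 finite_subset[OF \<R>0 replaced_sub(4)] subset_trans[OF \<R>0 replaced_sub(2)]
  have cover: "box2 Q \<subseteq> s2.rest F P \<union> \<Union>(box2 ` \<R>)"
  proof
    fix z assume z: "z \<in> box2 Q"
    then have zP: "z \<in> box2 P" using s2.box_mono[of Q P] P by blast
    show "z \<in> s2.rest F P \<union> \<Union>(box2 ` \<R>)"
    proof (cases "z \<in> s2.rest F P")
      case False
      then obtain R where R: "R \<in> children F P" "z \<in> box2 R" using zP unfolding s2.rest_def by blast
      have RD: "R \<in> D" "R \<in> F" using R f.children_D children_sub[of F P] by auto
      have "Q \<inter> R \<noteq> {}" using s2.box_disj[of Q R] RD P z R by blast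
      moreover have "\<not> Q \<subseteq> R"
      proof
        assume "Q \<subseteq> R"
        \<comment> \<open>\<open>P\<close> is the least member of \<open>F\<close> above
          \<open>Q\<close>, so a child containing \<open>Q\<close> would contain its own
          parent.\<close>
        then have "P \<subseteq> R" unfolding P_def using RD by (intro ancestor_least)
        then show False using children_psubset[OF R(1)] by blast
      qed
      ultimately have "R \<subseteq> Q" using s2.laminar RD P unfolding laminar_def by blast
      then show ?thesis using R unfolding \<R>_def by blast
    qed auto
  qed
  have "I2 g Q \<le> I2 (\<lambda>z. indicator (s2.rest F P) z * g z) Q + (\<Sum>R\<in>\<R>. I2 g R)"
    using \<R> g.\<Q> P cover
    by (intro s2.I_cover_le g.h s2.rest_sets f.finF f.F_D) (auto simp: \<R>_def)
  also have "(\<Sum>R\<in>\<R>. I2 g R) \<le> (\<Sum>R\<in>\<R>. I2 (\<lambda>z. indicator (box2 R) z * replacement R z) Q)"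
  proof (intro sum_mono)
    fix R assume R: "R \<in> \<R>"
    then have RQ: "R \<in> \<Q>" "R \<in> D" "R \<subseteq> Q" using \<R> g.\<Q> unfolding \<R>_def by auto
    have "I2 g R \<le> 4 * s2.avg g (ancestor G R) * I2 (test2 (ancestor G R)) R"
      by (rule g.I_le_ancestor[OF RQ(1)])
    also have "\<dots> = I2 (replacement R) R"
      unfolding replacement_def using ancestor_G[OF RQ(1)] g.avg_nonneg RQ
      by (intro s2.I_scale[symmetric] s2.test_H) auto
    also have "\<dots> = I2 (\<lambda>z. indicator (box2 R) z * replacement R z) Q"
      using RQ P by (intro s2.I_box[symmetric] replacement_H) auto
    finally show "I2 g R \<le> \<dots>" .
  qed
  \<comment> \<open>The replaced children outside \<open>Q\<close> only add non-negative terms;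
    including them makes the function independent of \<open>Q\<close>.\<close>
  also have "\<dots> \<le> (\<Sum>R\<in>replaced P. I2 (\<lambda>z. indicator (box2 R) z * replacement R z) Q)"
    using \<R> replaced_sub[of P] P by (intro sum_mono2 s2.I_nonneg box_replacement_H) auto
  also have "\<dots> = I2 (\<lambda>z. \<Sum>R\<in>replaced P. indicator (box2 R) z * replacement R z) Q"
    using replaced_sub[of P] P by (intro s2.I_sum[OF g.h, symmetric] box_replacement_H) auto
  also have "I2 (\<lambda>z. indicator (s2.rest F P) z * g z) Q + \<dots> = I2 (localized P) Q"
    unfolding localized_def using P replaced_sub(2)[of P]
    by (intro s2.I_add[symmetric] s2.H_indicator s2.H_sum[OF g.h] g.h s2.rest_sets f.finF f.F_D box_replacement_H) auto
  finally show ?thesis unfolding P_def by simp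
qed

text \<open>The children are disjoint, so the norm power of the replaced part splits over them.
  Among children with the same stopping cube \<open>S\<close> for \<open>g\<close>, the pieces of
  the one function \<open>test2 S\<close> add up to at most \<open>N2 (test2 S)\<close>, which is
  the test mass of \<open>S\<close>.\<close>

lemma N_localized_le:
  assumes P: "P \<in> F"
  shows "N2 (localized P) \<le> 2 powr q * (N2 (\<lambda>z. indicator (s2.rest F P) z * g z)
     + (\<Sum>S\<in>ancestor G ` replaced P. 4 powr q * (s2.avg g S powr q * I2 (test2 S) S)))"
proof -
  have le: "N2 (localized P) \<le> 2 powr q * (N2 (\<lambda>z. indicator (s2.rest F P) z * g z)
     + N2 (\<lambda>z. \<Sum>R\<in>replaced P. indicator (box2 R) z * replacement R z))"
    unfolding localized_def using P replaced_sub(2)[of P]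
    by (intro s2.N_add s2.H_indicator s2.H_sum[OF g.h] g.h s2.rest_sets f.finF f.F_D box_replacement_H) auto
  have "N2 (\<lambda>z. \<Sum>R\<in>replaced P. indicator (box2 R) z * replacement R z) \<le>
      (\<Sum>R\<in>replaced P. N2 (\<lambda>z. indicator (box2 R) z * replacement R z))"
    using replaced_sub[of P] by (intro s2.N_disjoint replacement_H) auto
  moreover have "(\<Sum>R\<in>replaced P. N2 (\<lambda>z. indicator (box2 R) z * replacement R z)) =
      (\<Sum>S\<in>ancestor G ` replaced P. \<Sum>R\<in>{R \<in> replaced P. ancestor G R = S}. N2 (\<lambda>z. indicator (box2 R) z * replacement R z))"
    by (rule sum.image_gen[OF replaced_sub(4)])
  moreover have "(\<Sum>R\<in>{R \<in> replaced P. ancestor G R = S}. N2 (\<lambda>z. indicator (box2 R) z * replacement R z)) \<le>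
      4 powr q * (s2.avg g S powr q * I2 (test2 S) S)" if S: "S \<in> ancestor G ` replaced P" for S
  proof -
    let ?A = "{R \<in> replaced P. ancestor G R = S}"
    have SQ: "S \<in> \<Q>" "S \<in> D" using S ancestor_G replaced_sub(2)[of P] by auto
    have avg: "0 \<le> s2.avg g S" by (rule g.avg_nonneg[OF SQ(1)])
    have "(\<Sum>R\<in>?A. N2 (\<lambda>z. indicator (box2 R) z * replacement R z)) =
       (\<Sum>R\<in>?A. N2 (\<lambda>z. (4 * s2.avg g S) * (indicator (box2 R) z * test2 S z)))"
      by (intro sum.cong refl arg_cong[where f = N2]) (auto simp: replacement_def)
    also have "\<dots> = (\<Sum>R\<in>?A. (4 * s2.avg g S) powr q * N2 (\<lambda>z. indicator (box2 R) z * test2 S z))"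
      using avg SQ replaced_sub(3)[of P]
      by (intro sum.cong refl s2.N_scale s2.H_indicator s2.test_H s2.box_sets) auto
    also have "\<dots> = (4 * s2.avg g S) powr q * (\<Sum>R\<in>?A. N2 (\<lambda>z. indicator (box2 R) z * test2 S z))"
      by (simp add: sum_distrib_left)
    also have "(\<Sum>R\<in>?A. N2 (\<lambda>z. indicator (box2 R) z * test2 S z)) \<le> N2 (test2 S)"
    proof (intro s2.N_split s2.test_H SQ)
      show "finite ?A" using replaced_sub(4)[of P] by simp
      show "box2 R \<in> sets M2" if "R \<in> ?A" for R using that replaced_sub(3)[of P] by (intro s2.box_sets) auto
      show "disjoint_family_on box2 ?A"
        unfolding disjoint_family_on_def
      proof (intro ballI impI s2.box_disj)
        fix R R' assume "R \<in> ?A" "R' \<in> ?A" "R \<noteq> R'"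
        then show "R \<in> D" "R' \<in> D" "R \<inter> R' = {}"
          using replaced_sub(3,5)[of P] by (auto dest: disjointD)
      qed
    qed
    also have "N2 (test2 S) = I2 (test2 S) S" by (rule s2.N_test[OF SQ(2)])
    finally show ?thesis using avg by (simp add: powr_mult mult_left_mono)
  qed
  ultimately have "N2 (\<lambda>z. \<Sum>R\<in>replaced P. indicator (box2 R) z * replacement R z) \<le>
      (\<Sum>S\<in>ancestor G ` replaced P. 4 powr q * (s2.avg g S powr q * I2 (test2 S) S))"
    by (simp only:) (rule order_trans, assumption, intro sum_mono)
  with le show ?thesis
    by (rule order_trans[OF _ mult_left_mono[OF add_left_mono]]) simp
qed

text \<open>
  A stopping cube \<open>S\<close> of \<open>g\<close> occurs for at most two stopping cubes \<open>P\<close> of \<open>f\<close>: either \<open>P\<close> is the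
  smallest one that contains \<open>S\<close>, or \<open>S\<close> is itself a stopping child of \<open>P\<close>.
\<close>

lemma sum_occurrences_le:
  fixes w :: "'x set \<Rightarrow> real"
  assumes w: "\<And>S. S \<in> G \<Longrightarrow> 0 \<le> w S"
  shows "(\<Sum>P\<in>F. \<Sum>S\<in>ancestor G ` replaced P. w S) \<le> 2 * (\<Sum>S\<in>G. w S)"
proof -
  \<comment> \<open>Extension by zero off \<open>G\<close>, so that \<open>sum_children_le\<close>
    can be applied to \<open>F\<close>, whose children need not belong to \<open>G\<close>.\<close>
  let ?v = "\<lambda>S. if S \<in> G then w S else 0"
  have "(\<Sum>S\<in>ancestor G ` replaced P. w S) \<le> (\<Sum>S\<in>{S \<in> G. ancestor F S = P}. w S) + (\<Sum>S\<in>children F P. ?v S)"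
    if P: "P \<in> F" for P
  proof -
    have sub: "ancestor G ` replaced P \<subseteq> {S \<in> G. ancestor F S = P} \<union> (G \<inter> children F P)"
    proof
      fix S assume "S \<in> ancestor G ` replaced P"
      then obtain R where R: "R \<in> replaced P" "S = ancestor G R" by blast
      have RQ: "R \<in> \<Q>" "R \<in> children F P" "S \<subseteq> P" using R replaced_sub(1,2)[of P] unfolding replaced_def by auto
      have S: "S \<in> G" "R \<subseteq> S" using ancestor_G[OF RQ(1)] R by auto
      show "S \<in> {S \<in> G. ancestor F S = P} \<union> (G \<inter> children F P)"
      proof (cases "R = S")
        case False
        then have "R \<subset> S" using S by blast
        \<comment> \<open>Every member of \<open>F\<close> containing \<open>S\<close> is strictly
          above the child \<open>R\<close> and therefore contains \<open>P\<close>.\<close>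
        then have "ancestor F S = P"
          using RQ P unfolding children_def by (intro ancestor_eqI) auto
        then show ?thesis using S by blast
      qed (use RQ S in blast)
    qed
    have "(\<Sum>S\<in>ancestor G ` replaced P. w S) \<le> (\<Sum>S\<in>{S \<in> G. ancestor F S = P} \<union> (G \<inter> children F P). w S)"
      using sub w g.finF f.finite_children[of P] by (intro sum_mono2) auto
    also have "\<dots> \<le> (\<Sum>S\<in>{S \<in> G. ancestor F S = P}. w S) + (\<Sum>S\<in>G \<inter> children F P. w S)"
      using w g.finF by (subst sum_Un) (auto intro!: sum_nonneg)
    also have "(\<Sum>S\<in>G \<inter> children F P. w S) = (\<Sum>S\<in>children F P. ?v S)"
      using f.finite_children[of P] by (subst sum.inter_restrict[symmetric]) (auto simp: Int_commute)
    finally show ?thesis .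
  qed
  then have "(\<Sum>P\<in>F. \<Sum>S\<in>ancestor G ` replaced P. w S) \<le>
     (\<Sum>P\<in>F. \<Sum>S\<in>{S \<in> G. ancestor F S = P}. w S) + (\<Sum>P\<in>F. \<Sum>S\<in>children F P. ?v S)"
    by (simp add: sum.distrib[symmetric] sum_mono)
  also have "(\<Sum>P\<in>F. \<Sum>S\<in>{S \<in> G. ancestor F S = P}. w S) = (\<Sum>S\<in>G. w S)"
    using f.finF g.finF g.F_sub f.ancestor_in by (intro sum.group) auto
  also have "(\<Sum>P\<in>F. \<Sum>S\<in>children F P. ?v S) \<le> (\<Sum>S\<in>F. ?v S)"
    using w f.finF by (intro sum_children_le) auto
  also have "\<dots> \<le> (\<Sum>S\<in>G. w S)"
    using w f.finF g.finF by (subst sum.inter_restrict[symmetric]) (auto intro!: sum_mono2)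
  finally show ?thesis by simp
qed

text \<open>The terms with \<open>rest F P\<close> total at most \<open>N2 g\<close>; the other
  weights occur at most twice each and are summed by the Carleson embedding for
  \<open>g\<close>.\<close>

lemma sum_N_localized_le:
  "(\<Sum>P\<in>F. N2 (localized P)) \<le> 2 powr q * (1 + 2 * 4 powr q * carleson_const q) * N2 g"
proof -
  let ?w = "\<lambda>S. 4 powr q * (s2.avg g S powr q * I2 (test2 S) S)"
  have "(\<Sum>P\<in>F. N2 (localized P)) \<le> (\<Sum>P\<in>F. 2 powr q * (N2 (\<lambda>z. indicator (s2.rest F P) z * g z)
     + (\<Sum>S\<in>ancestor G ` replaced P. ?w S)))"
    by (intro sum_mono N_localized_le)
  also have "\<dots> = 2 powr q * ((\<Sum>P\<in>F. N2 (\<lambda>z. indicator (s2.rest F P) z * g z))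
     + (\<Sum>P\<in>F. \<Sum>S\<in>ancestor G ` replaced P. ?w S))"
    by (simp only: sum_distrib_left[symmetric] sum.distrib)
  also have "\<dots> \<le> 2 powr q * (N2 g + 2 * (\<Sum>S\<in>G. ?w S))"
    using g.weight_nonneg
    by (intro mult_left_mono add_mono s2.sum_rest_le f.finF f.F_D g.h sum_occurrences_le) auto
  also have "(\<Sum>S\<in>G. ?w S) \<le> 4 powr q * (carleson_const q * N2 g)"
    using g.carleson_embedding by (simp add: sum_distrib_left[symmetric])
  finally show ?thesis by (simp add: algebra_simps)
qed

text \<open>The cubes are grouped by their stopping cube \<open>P\<close> for \<open>f\<close>. In
  each group \<open>f\<close> is replaced by \<open>4 * avg f P\<close> times \<open>test1 P\<close>
  and \<open>g\<close> by \<open>localized P\<close>, after which testing on \<open>P\<close>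
  applies. Hoelder's inequality over \<open>P\<close> separates the two sums, one bounded by the
  Carleson embedding, the other by \<open>sum_N_localized_le\<close>.\<close>

lemma half_bound:
  assumes c: "\<And>Q. Q \<in> \<Q> \<Longrightarrow> 0 \<le> c Q" and T: "0 \<le> T"
    and testing: "\<And>P \<R> h. P \<in> \<Q> \<Longrightarrow> \<R> \<subseteq> {R \<in> \<Q>. R \<subseteq> P} \<Longrightarrow> h \<in> H2 \<Longrightarrow>
      (\<Sum>R\<in>\<R>. c R * I1 (test1 P) R * I2 h R) \<le> T * I1 (test1 P) P powr (1/p) * N2 h powr (1/q)"
  shows "(\<Sum>Q\<in>{Q \<in> \<Q>. ancestor G Q \<subseteq> ancestor F Q}. c Q * I1 f Q * I2 g Q) \<le>
    4 * T * (carleson_const p * N1 f) powr (1/p) * (2 powr q * (1 + 2 * 4 powr q * carleson_const q) * N2 g) powr (1/q)"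
proof -
  let ?\<R> = "{Q \<in> \<Q>. ancestor G Q \<subseteq> ancestor F Q}"
  let ?w = "\<lambda>P. s1.avg f P powr p * I1 (test1 P) P"
  have qp: "1 / q = 1 - 1 / p" using conj by simp
  have p01: "0 < 1 / p" "1 / p < 1" using s1.p by auto
  have fin: "finite ?\<R>" using f.fin by simp
  have "(\<Sum>Q\<in>?\<R>. c Q * I1 f Q * I2 g Q) = (\<Sum>P\<in>F. \<Sum>Q\<in>{Q \<in> ?\<R>. ancestor F Q = P}. c Q * I1 f Q * I2 g Q)"
    using f.ancestor_in fin f.finF by (intro sum.group[symmetric]) auto
  also have "\<dots> \<le> (\<Sum>P\<in>F. 4 * T * (?w P powr (1/p) * N2 (localized P) powr (1 - 1/p)))"
  proof (intro sum_mono)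
    fix P assume P: "P \<in> F"
    then have PQ: "P \<in> \<Q>" "P \<in> D" using f.F_sub f.F_D by auto
    have avg: "0 \<le> s1.avg f P" by (rule f.avg_nonneg[OF PQ(1)])
    let ?S = "{Q \<in> ?\<R>. ancestor F Q = P}"
    have "(\<Sum>Q\<in>?S. c Q * I1 f Q * I2 g Q) \<le>
       (\<Sum>Q\<in>?S. c Q * (4 * s1.avg f P * I1 (test1 P) Q) * I2 (localized P) Q)"
    proof (intro sum_mono)
      fix Q assume Q: "Q \<in> ?S"
      then have QQ: "Q \<in> \<Q>" "Q \<in> D" using f.\<Q> by auto
      have "I1 f Q \<le> 4 * s1.avg f P * I1 (test1 P) Q" using f.I_le_ancestor[OF QQ(1)] Q by auto
      moreover have "I2 g Q \<le> I2 (localized P) Q" using I_le_localized[OF QQ(1)] Q by auto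
      moreover have "0 \<le> s1.avg f P" "0 \<le> I1 (test1 P) Q"
        using avg s1.I_nonneg[OF s1.test_H] PQ QQ by auto
      moreover have "0 \<le> I2 g Q" "0 \<le> I1 f Q" using f.pos g.pos QQ by (auto intro: less_imp_le)
      ultimately show "c Q * I1 f Q * I2 g Q \<le> c Q * (4 * s1.avg f P * I1 (test1 P) Q) * I2 (localized P) Q"
        using c[OF QQ(1)] by (intro mult_mono mult_left_mono mult_nonneg_nonneg) auto
    qed
    also have "\<dots> = 4 * s1.avg f P * (\<Sum>Q\<in>?S. c Q * I1 (test1 P) Q * I2 (localized P) Q)"
      by (simp add: sum_distrib_left algebra_simps)
    also have "\<dots> \<le> 4 * s1.avg f P * (T * I1 (test1 P) P powr (1/p) * N2 (localized P) powr (1/q))"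
      using avg PQ P f.ancestor_in by (intro mult_left_mono testing localized_H) auto
    also have "\<dots> = 4 * T * ((s1.avg f P * I1 (test1 P) P powr (1/p)) * N2 (localized P) powr (1/q))"
      by (simp add: algebra_simps)
    \<comment> \<open>The average is moved under the power \<open>1/p\<close>, which produces
      exactly the weight of the Carleson embedding.\<close>
    also have "s1.avg f P * I1 (test1 P) P powr (1/p) = ?w P powr (1/p)"
      using avg s1.p s1.I_nonneg s1.test_H PQ by (simp add: powr_mult powr_powr)
    finally show "(\<Sum>Q\<in>?S. c Q * I1 f Q * I2 g Q) \<le> 4 * T * (?w P powr (1/p) * N2 (localized P) powr (1 - 1/p))"
      by (simp only: qp)
  qed
  also have "\<dots> = 4 * T * (\<Sum>P\<in>F. ?w P powr (1/p) * N2 (localized P) powr (1 - 1/p))"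
    by (simp add: sum_distrib_left)
  also have "\<dots> \<le> 4 * T * ((\<Sum>P\<in>F. ?w P) powr (1/p) * (\<Sum>P\<in>F. N2 (localized P)) powr (1 - 1/p))"
    using T f.weight_nonneg s2.N_nonneg localized_H p01 by (intro mult_left_mono sum_powr_holder) auto
  also have "\<dots> \<le> 4 * T * ((carleson_const p * N1 f) powr (1/p) *
      (2 powr q * (1 + 2 * 4 powr q * carleson_const q) * N2 g) powr (1 - 1/p))"
    using T f.weight_nonneg s2.N_nonneg localized_H p01
    by (intro mult_left_mono mult_mono powr_mono2 f.carleson_embedding sum_N_localized_le sum_nonneg) auto
  finally show ?thesis by (simp only: qp mult.assoc)
qed

end

end

definition half_const :: "real \<Rightarrow> real \<Rightarrow> real" where
  "half_const p q = 4 * carleson_const p powr (1/p) * (2 powr q * (1 + 2 * 4 powr q * carleson_const q)) powr (1/q)"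

text \<open>Both stopping families are built from the same finite set of cubes. The two stopping
  cubes above a given \<open>Q\<close> share the points of \<open>Q\<close>, hence are nested, and
  \<open>half_bound\<close> treats either order; cubes counted in both halves only increase the
  upper bound.\<close>

lemma (in two_sides) bilinear_bound:
  assumes f: "f \<in> H1" and g: "g \<in> H2" and fin: "finite \<Q>" and \<Q>: "\<Q> \<subseteq> D"
    and c: "\<And>Q. Q \<in> \<Q> \<Longrightarrow> 0 \<le> c Q" and T: "0 \<le> T" and T': "0 \<le> T'"
    and testing: "\<And>P \<R> h. P \<in> \<Q> \<Longrightarrow> \<R> \<subseteq> {R \<in> \<Q>. R \<subseteq> P} \<Longrightarrow> h \<in> H2 \<Longrightarrow>
      (\<Sum>R\<in>\<R>. c R * I1 (test1 P) R * I2 h R) \<le> T * I1 (test1 P) P powr (1/p) * N2 h powr (1/q)"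
    and testing': "\<And>P \<R> h. P \<in> \<Q> \<Longrightarrow> \<R> \<subseteq> {R \<in> \<Q>. R \<subseteq> P} \<Longrightarrow> h \<in> H1 \<Longrightarrow>
      (\<Sum>R\<in>\<R>. c R * I1 h R * I2 (test2 P) R) \<le> T' * N1 h powr (1/p) * I2 (test2 P) P powr (1/q)"
  shows "(\<Sum>Q\<in>\<Q>. c Q * I1 f Q * I2 g Q) \<le>
    (half_const p q * T + half_const q p * T') * N1 f powr (1/p) * N2 g powr (1/q)"
proof -
  \<comment> \<open>With the roles of the two functions exchanged, \<open>half_bound\<close> covers
    the cubes whose stopping cube for \<open>f\<close> lies in that for \<open>g\<close>.\<close>
  interpret swapped: two_sides q p D box2 M2 H2 I2 N2 test2 box1 M1 H1 I1 N1 test1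
    using conj by unfold_locales simp
  \<comment> \<open>Cubes with a vanishing integral contribute nothing to the form. Leaving them out
    gives the positivity that \<open>stopped_side\<close> demands.\<close>
  define \<P> where "\<P> = {Q \<in> \<Q>. 0 < I1 f Q \<and> 0 < I2 g Q}"
  have \<P>: "finite \<P>" "\<P> \<subseteq> \<Q>" "\<P> \<subseteq> D" using fin \<Q> unfolding \<P>_def by auto
  obtain F where F: "stopping_family (s1.stops f) \<P> F" using stopping_family_obtain[OF \<P>(1)] .
  obtain G where G: "stopping_family (s2.stops g) \<P> G" using stopping_family_obtain[OF \<P>(1)] .
  interpret f: stopped_side p D box1 M1 H1 I1 N1 test1 \<P> F f
    using f \<P> F by unfold_locales (auto simp: \<P>_def)
  interpret g: stopped_side q D box2 M2 H2 I2 N2 test2 \<P> G g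
    using g \<P> G by unfold_locales (auto simp: \<P>_def)
  let ?t = "\<lambda>Q. c Q * I1 f Q * I2 g Q"
  have nn: "0 \<le> N1 f" "0 \<le> N2 g" "0 \<le> carleson_const p" "0 \<le> carleson_const q"
    using s1.N_nonneg[OF f] s2.N_nonneg[OF g] s1.carleson_const_pos s2.carleson_const_pos by auto
  have t: "0 \<le> ?t Q" if "Q \<in> \<Q>" for Q
    using c[OF that] that \<Q> s1.I_nonneg[OF f] s2.I_nonneg[OF g] by auto
  have "(\<Sum>Q\<in>{Q \<in> \<P>. ancestor G Q \<subseteq> ancestor F Q}. ?t Q) \<le>
    4 * T * (carleson_const p * N1 f) powr (1/p) * (2 powr q * (1 + 2 * 4 powr q * carleson_const q) * N2 g) powr (1/q)"
    using \<P> c T by (intro half_bound f.stopped_side_axioms g.stopped_side_axioms testing) auto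
  also have "\<dots> = half_const p q * T * N1 f powr (1/p) * N2 g powr (1/q)"
    using nn by (simp add: half_const_def powr_mult)
  finally have 1: "(\<Sum>Q\<in>{Q \<in> \<P>. ancestor G Q \<subseteq> ancestor F Q}. ?t Q) \<le> \<dots>" .
  have "(\<Sum>Q\<in>{Q \<in> \<P>. ancestor F Q \<subseteq> ancestor G Q}. ?t Q) =
    (\<Sum>Q\<in>{Q \<in> \<P>. ancestor F Q \<subseteq> ancestor G Q}. c Q * I2 g Q * I1 f Q)"
    by (intro sum.cong) (auto simp: algebra_simps)
  also have "\<dots> \<le>
    4 * T' * (carleson_const q * N2 g) powr (1/q) * (2 powr p * (1 + 2 * 4 powr p * carleson_const p) * N1 f) powr (1/p)"
  proof (intro swapped.half_bound f.stopped_side_axioms g.stopped_side_axioms T')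
    fix P \<R> h assume "P \<in> \<P>" "\<R> \<subseteq> {R \<in> \<P>. R \<subseteq> P}" "h \<in> H1"
    then have "(\<Sum>R\<in>\<R>. c R * I1 h R * I2 (test2 P) R) \<le> T' * N1 h powr (1/p) * I2 (test2 P) P powr (1/q)"
      using \<P> by (intro testing') auto
    then show "(\<Sum>R\<in>\<R>. c R * I2 (test2 P) R * I1 h R) \<le> T' * I2 (test2 P) P powr (1/q) * N1 h powr (1/p)"
      by (simp add: mult_ac)
  qed (use c \<P> in auto)
  also have "\<dots> = half_const q p * T' * N1 f powr (1/p) * N2 g powr (1/q)"
    using nn by (simp add: half_const_def powr_mult)
  finally have 2: "(\<Sum>Q\<in>{Q \<in> \<P>. ancestor F Q \<subseteq> ancestor G Q}. ?t Q) \<le> \<dots>" .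
  have split: "\<P> \<subseteq> {Q \<in> \<P>. ancestor G Q \<subseteq> ancestor F Q} \<union> {Q \<in> \<P>. ancestor F Q \<subseteq> ancestor G Q}"
  proof
    fix Q assume Q: "Q \<in> \<P>"
    have "ancestor F Q \<in> D" "ancestor G Q \<in> D" "Q \<subseteq> ancestor F Q \<inter> ancestor G Q"
      using f.ancestor_in[OF Q] g.ancestor_in[OF Q] f.F_D g.F_D by auto
    moreover have "Q \<noteq> {}" using Q \<P>(3) s1.laminar unfolding laminar_def by auto
    ultimately have "ancestor F Q \<subseteq> ancestor G Q \<or> ancestor G Q \<subseteq> ancestor F Q"
      using s1.laminar unfolding laminar_def by (metis subset_empty)
    then show "Q \<in> {Q \<in> \<P>. ancestor G Q \<subseteq> ancestor F Q} \<union> {Q \<in> \<P>. ancestor F Q \<subseteq> ancestor G Q}"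
      using Q by blast
  qed
  have "(\<Sum>Q\<in>\<Q>. ?t Q) = (\<Sum>Q\<in>\<P>. ?t Q)"
  proof (intro sum.mono_neutral_right fin \<P>(2) ballI)
    fix Q assume Q: "Q \<in> \<Q> - \<P>"
    then have "Q \<in> D" using \<Q> by auto
    then show "?t Q = 0"
      using Q s1.I_nonneg[OF f] s2.I_nonneg[OF g] unfolding \<P>_def by (force simp: less_le)
  qed
  also have "\<dots> \<le> (\<Sum>Q\<in>{Q \<in> \<P>. ancestor G Q \<subseteq> ancestor F Q} \<union> {Q \<in> \<P>. ancestor F Q \<subseteq> ancestor G Q}. ?t Q)"
    using split \<P> t by (intro sum_mono2) auto
  also have "\<dots> \<le> (\<Sum>Q\<in>{Q \<in> \<P>. ancestor G Q \<subseteq> ancestor F Q}. ?t Q) + (\<Sum>Q\<in>{Q \<in> \<P>. ancestor F Q \<subseteq> ancestor G Q}. ?t Q)"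
    using \<P> t by (subst sum_Un) (auto intro!: sum_nonneg)
  finally show ?thesis using 1 2 by (simp add: algebra_simps)
qed

section \<open>Powers and integrals of extended non-negative functions\<close>

lemma epowr_ennreal [simp]: "0 \<le> r \<Longrightarrow> ennreal r epowr a = ennreal (r powr a)"
  unfolding ennreal_powr_def by simp

lemma epowr_zero [simp]: "0 epowr a = 0"
  using epowr_ennreal[of 0 a] by simp

lemma epowr_top [simp]: "top epowr a = top"
  unfolding ennreal_powr_def by simp

lemma epowr_one [simp]: "x epowr 1 = x"
  by (cases x) auto

lemma epowr_epowr: "0 < a \<Longrightarrow> 0 < b \<Longrightarrow> (x epowr a) epowr b = x epowr (a * b)"
  by (cases x) (auto simp: powr_powr)

lemma epowr_mono: "0 < a \<Longrightarrow> x \<le> y \<Longrightarrow> x epowr a \<le> y epowr a"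
  by (cases x; cases y) (auto intro!: ennreal_leI powr_mono2 simp: top_unique)

lemma epowr_mult: "0 < a \<Longrightarrow> (x * y) epowr a = x epowr a * y epowr a"
  by (cases x; cases y)
    (auto simp: ennreal_mult[symmetric] powr_mult ennreal_mult_top ennreal_top_mult)

lemma epowr_add: "0 < a \<Longrightarrow> 0 < b \<Longrightarrow> x epowr a * x epowr b = x epowr (a + b)"
  by (cases x) (auto simp: ennreal_mult[symmetric] powr_add ennreal_top_mult)

lemma epowr_eq_0_iff [simp]: "x epowr a = 0 \<longleftrightarrow> x = 0"
  by (cases x) auto

lemma epowr_less_top_iff [simp]: "x epowr a < top \<longleftrightarrow> x < top"
  by (cases x) auto

lemma epowr_eq_top_iff [simp]: "x epowr a = top \<longleftrightarrow> x = top"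
  by (cases x) auto

lemma enn2real_epowr: "x < top \<Longrightarrow> enn2real (x epowr a) = enn2real x powr a"
  by (cases x) auto

lemma measurable_epowr [measurable (raw)]:
  assumes [measurable]: "f \<in> borel_measurable M"
  shows "(\<lambda>x. f x epowr a) \<in> borel_measurable M"
  unfolding ennreal_powr_def by measurable

text \<open>Each of the two powers \<open>t powr a\<close> is at most
  \<open>t * (r + s) powr (a - 1)\<close>. The exponent used later is \<open>p/2\<close>, which is
  at least 1 because \<open>p\<close> is at least 2.\<close>

lemma epowr_superadditive:
  assumes "1 \<le> a" shows "x epowr a + y epowr a \<le> (x + y) epowr a"
proof (cases x; cases y)
  fix r s assume rs: "0 \<le> r" "x = ennreal r" "0 \<le> s" "y = ennreal s"
  have "r powr a + s powr a \<le> (r + s) powr a"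
  proof -
    have "t powr a \<le> t * (r + s) powr (a - 1)" if "0 \<le> t" "t \<le> r + s" for t
    proof -
      have "t powr a = t powr (1 + (a - 1))" by simp
      also have "\<dots> = t powr 1 * t powr (a - 1)" by (rule powr_add)
      also have "\<dots> \<le> t * (r + s) powr (a - 1)"
        using that assms by (auto intro!: mult_left_mono powr_mono2)
      finally show ?thesis .
    qed
    from add_mono[OF this[of r] this[of s]] rs
    have "r powr a + s powr a \<le> (r + s) powr 1 * (r + s) powr (a - 1)" by (simp add: algebra_simps)
    also have "\<dots> = (r + s) powr a" by (simp only: powr_add[symmetric]) simp
    finally show ?thesis .
  qed
  then show ?thesis using rs by (simp flip: ennreal_plus)
qed (use assms in auto)

lemma sum_epowr_le:
  assumes "1 \<le> a" shows "(\<Sum>i\<in>A. x i epowr a) \<le> (\<Sum>i\<in>A. x i) epowr a"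
proof (induction A rule: infinite_finite_induct)
  case (insert i A)
  then have "(\<Sum>i\<in>insert i A. x i epowr a) \<le> x i epowr a + (\<Sum>i\<in>A. x i) epowr a"
    by (simp add: add_left_mono)
  also have "\<dots> \<le> (x i + (\<Sum>i\<in>A. x i)) epowr a" by (rule epowr_superadditive[OF assms])
  finally show ?case using insert by simp
qed auto

text \<open>Young's inequality for \<open>x / U\<close> and \<open>y / V\<close>, multiplied out. In
  Hoelder's inequality \<open>U\<close> and \<open>V\<close> are the two integrals.\<close>

lemma epowr_young:
  assumes "0 < s" "s < 1" "0 < U" "0 < V"
  shows "x epowr s * y epowr (1 - s) \<le>
    ennreal (U powr s * V powr (1 - s)) * (ennreal (s / U) * x + ennreal ((1 - s) / V) * y)"
proof (cases x; cases y)
  fix a b assume ab: "0 \<le> a" "x = ennreal a" "0 \<le> b" "y = ennreal b"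
  have "a powr s * b powr (1 - s) \<le> U powr s * V powr (1 - s) * (s / U * a + (1 - s) / V * b)"
  proof (cases "a = 0 \<or> b = 0")
    case False
    then have "(a / U) powr s * (b / V) powr (1 - s) \<le> s * (a / U) + (1 - s) * (b / V)"
      using assms ab by (intro Youngs_inequality_0) auto
    then have "U powr s * V powr (1 - s) * ((a / U) powr s * (b / V) powr (1 - s)) \<le>
        U powr s * V powr (1 - s) * (s * (a / U) + (1 - s) * (b / V))"
      by (intro mult_left_mono) auto
    then show ?thesis using assms ab by (simp add: powr_divide)
  qed (use assms ab in auto)
  then show ?thesis using assms ab by (simp flip: ennreal_mult ennreal_plus)
qed (use assms in \<open>auto simp: ennreal_mult_eq_top_iff ennreal_top_mult ennreal_mult_top top_unique\<close>)

text \<open>For positive finite integrals the normalized Young inequality is integrated. If one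
  integral is zero, the integrand on the left vanishes almost everywhere; if none is zero but one is
  infinite, so is the right side.\<close>

lemma nn_integral_holder:
  assumes [measurable]: "u \<in> borel_measurable M" "v \<in> borel_measurable M" and s: "0 < s" "s < 1"
  shows "(\<integral>\<^sup>+x. u x epowr s * v x epowr (1 - s) \<partial>M) \<le> (\<integral>\<^sup>+x. u x \<partial>M) epowr s * (\<integral>\<^sup>+x. v x \<partial>M) epowr (1 - s)"
proof -
  let ?L = "\<integral>\<^sup>+x. u x epowr s * v x epowr (1 - s) \<partial>M"
  show ?thesis
  proof (cases "(\<integral>\<^sup>+x. u x \<partial>M) = 0 \<or> (\<integral>\<^sup>+x. v x \<partial>M) = 0")
    case True
    then have "AE x in M. u x epowr s * v x epowr (1 - s) = 0"
      by (auto simp: nn_integral_0_iff_AE)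
    then have "?L = 0" by (subst nn_integral_0_iff_AE) auto
    then show ?thesis by simp
  next
    case nz: False
    show ?thesis
    proof (cases "(\<integral>\<^sup>+x. u x \<partial>M) = top \<or> (\<integral>\<^sup>+x. v x \<partial>M) = top")
      case True
      then show ?thesis using nz by (auto simp: ennreal_mult_top ennreal_top_mult)
    next
      case False
      then obtain U V where UV: "0 \<le> U" "0 \<le> V" "(\<integral>\<^sup>+x. u x \<partial>M) = ennreal U" "(\<integral>\<^sup>+x. v x \<partial>M) = ennreal V"
        by (metis ennreal_cases)
      then have pos: "0 < U" "0 < V" using nz by (auto simp: less_le)
      have "?L \<le> (\<integral>\<^sup>+x. ennreal (U powr s * V powr (1 - s)) * (ennreal (s / U) * u x + ennreal ((1 - s) / V) * v x) \<partial>M)"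
        using s pos by (intro nn_integral_mono epowr_young)
      also have "\<dots> = ennreal (U powr s * V powr (1 - s)) * (ennreal (s / U) * ennreal U + ennreal ((1 - s) / V) * ennreal V)"
        by (simp add: nn_integral_cmult nn_integral_add UV)
      also have "ennreal (s / U) * ennreal U + ennreal ((1 - s) / V) * ennreal V = 1"
        using s pos by (simp flip: ennreal_mult ennreal_plus)
      finally show ?thesis using UV by (simp add: ennreal_mult)
    qed
  qed
qed

section \<open>Sums over the integers as integrals\<close>

lemma nn_integral_count_space_int:
  "(\<integral>\<^sup>+k. f k \<partial>count_space (UNIV :: int set)) = (\<Sum>n. f (int_decode n))"
proof -
  have "(\<integral>\<^sup>+n. f (int_decode n) \<partial>count_space UNIV) = (\<integral>\<^sup>+k. f k \<partial>count_space UNIV)"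
    by (rule nn_integral_bij_count_space[OF bij_int_decode])
  then show ?thesis by (simp add: nn_integral_count_space_nat)
qed

lemma measurable_nn_integral_count_space_int [measurable (raw)]:
  assumes "\<And>k. (\<lambda>x. F x k) \<in> borel_measurable M"
  shows "(\<lambda>x. \<integral>\<^sup>+k. F x k \<partial>count_space (UNIV :: int set)) \<in> borel_measurable M"
  unfolding nn_integral_count_space_int using assms by measurable

text \<open>Both sides are suprema of finite partial sums, over all finite sets and over the initial
  segments of an enumeration; each kind is dominated by the other side.\<close>

lemma infsum_int_eq_nn_integral:
  fixes f :: "int \<Rightarrow> ennreal"
  shows "(\<Sum>\<^sub>\<infinity>k. f k) = (\<integral>\<^sup>+k. f k \<partial>count_space UNIV)"
proof -
  have eq: "(\<Sum>\<^sub>\<infinity>k. f k) = (SUP A\<in>{A. finite A \<and> A \<subseteq> UNIV}. sum f A)"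
    by (intro nonneg_infsum_complete) auto
  show ?thesis
  proof (rule antisym)
    show "(\<Sum>\<^sub>\<infinity>k. f k) \<le> (\<integral>\<^sup>+k. f k \<partial>count_space UNIV)"
      unfolding eq
    proof (intro SUP_least)
      fix A :: "int set" assume "A \<in> {A. finite A \<and> A \<subseteq> UNIV}"
      then have "sum f A = (\<integral>\<^sup>+k. f k * indicator A k \<partial>count_space UNIV)"
        by (simp add: nn_integral_count_space_indicator[symmetric] nn_integral_count_space_finite)
      also have "\<dots> \<le> (\<integral>\<^sup>+k. f k \<partial>count_space UNIV)"
        by (intro nn_integral_mono) (auto simp: indicator_def)
      finally show "sum f A \<le> (\<integral>\<^sup>+k. f k \<partial>count_space UNIV)" .
    qed
    show "(\<integral>\<^sup>+k. f k \<partial>count_space UNIV) \<le> (\<Sum>\<^sub>\<infinity>k. f k)"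
      unfolding nn_integral_count_space_int suminf_eq_SUP
    proof (intro SUP_least)
      fix n
      have "(\<Sum>i<n. f (int_decode i)) = sum f (int_decode ` {..<n})"
        by (subst sum.reindex) (auto simp: inj_int_decode)
      also have "\<dots> \<le> (\<Sum>\<^sub>\<infinity>k. f k)" unfolding eq by (intro SUP_upper) auto
      finally show "(\<Sum>i<n. f (int_decode i)) \<le> (\<Sum>\<^sub>\<infinity>k. f k)" .
    qed
  qed
qed

section \<open>One side of the form, with extended values\<close>

text \<open>The counterpart of \<open>stopping_side\<close> in which integrals and norms may be
  infinite; only the test masses are assumed finite. Packing appears here as the Cauchy-Schwarz
  inequality behind it.\<close>

locale ennreal_side =
  fixes p :: real and D :: "'x set set" and box :: "'x set \<Rightarrow> 'z set" and M :: "'z measure"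
    and H\<^sub>0 :: "('z \<Rightarrow> real) set" and J :: "('z \<Rightarrow> real) \<Rightarrow> 'x set \<Rightarrow> ennreal" and K :: "('z \<Rightarrow> real) \<Rightarrow> ennreal"
    and test :: "'x set \<Rightarrow> 'z \<Rightarrow> real"
  assumes p: "1 < p"
    and laminar: "laminar D"
    and box_sets: "Q \<in> D \<Longrightarrow> box Q \<in> sets M"
    and box_mono: "Q \<in> D \<Longrightarrow> R \<in> D \<Longrightarrow> Q \<subseteq> R \<Longrightarrow> box Q \<subseteq> box R"
    and box_disj: "Q \<in> D \<Longrightarrow> R \<in> D \<Longrightarrow> Q \<inter> R = {} \<Longrightarrow> box Q \<inter> box R = {}"
    and nonneg: "h \<in> H\<^sub>0 \<Longrightarrow> Q \<in> D \<Longrightarrow> z \<in> box Q \<Longrightarrow> 0 \<le> h z"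
    and closed_add: "u \<in> H\<^sub>0 \<Longrightarrow> v \<in> H\<^sub>0 \<Longrightarrow> (\<lambda>z. u z + v z) \<in> H\<^sub>0"
    and closed_scale: "u \<in> H\<^sub>0 \<Longrightarrow> 0 \<le> c \<Longrightarrow> (\<lambda>z. c * u z) \<in> H\<^sub>0"
    and closed_indicator: "u \<in> H\<^sub>0 \<Longrightarrow> E \<in> sets M \<Longrightarrow> (\<lambda>z. indicator E z * u z) \<in> H\<^sub>0"
    and J_add: "u \<in> H\<^sub>0 \<Longrightarrow> v \<in> H\<^sub>0 \<Longrightarrow> Q \<in> D \<Longrightarrow> J (\<lambda>z. u z + v z) Q = J u Q + J v Q"
    and J_scale: "u \<in> H\<^sub>0 \<Longrightarrow> 0 \<le> c \<Longrightarrow> Q \<in> D \<Longrightarrow> J (\<lambda>z. c * u z) Q = ennreal c * J u Q"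
    and J_mono: "u \<in> H\<^sub>0 \<Longrightarrow> v \<in> H\<^sub>0 \<Longrightarrow> Q \<in> D \<Longrightarrow> (\<And>z. z \<in> box Q \<Longrightarrow> u z \<le> v z) \<Longrightarrow> J u Q \<le> J v Q"
    and J_box: "u \<in> H\<^sub>0 \<Longrightarrow> Q \<in> D \<Longrightarrow> R \<in> D \<Longrightarrow> R \<subseteq> Q \<Longrightarrow> J (\<lambda>z. indicator (box R) z * u z) Q = J u R"
    and K_add: "u \<in> H\<^sub>0 \<Longrightarrow> v \<in> H\<^sub>0 \<Longrightarrow> K (\<lambda>z. u z + v z) \<le> ennreal (2 powr p) * (K u + K v)"
    and K_scale: "u \<in> H\<^sub>0 \<Longrightarrow> 0 \<le> c \<Longrightarrow> K (\<lambda>z. c * u z) = ennreal (c powr p) * K u"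
    and K_split: "u \<in> H\<^sub>0 \<Longrightarrow> finite \<R> \<Longrightarrow> (\<And>R. R \<in> \<R> \<Longrightarrow> Es R \<in> sets M) \<Longrightarrow> disjoint_family_on Es \<R> \<Longrightarrow>
      (\<Sum>R\<in>\<R>. K (\<lambda>z. indicator (Es R) z * u z)) \<le> K u"
    and K_disjoint: "finite \<R> \<Longrightarrow> \<R> \<subseteq> D \<Longrightarrow> disjoint \<R> \<Longrightarrow> (\<And>R. R \<in> \<R> \<Longrightarrow> w R \<in> H\<^sub>0) \<Longrightarrow>
      K (\<lambda>z. \<Sum>R\<in>\<R>. indicator (box R) z * w R z) \<le> (\<Sum>R\<in>\<R>. K (\<lambda>z. indicator (box R) z * w R z))"
    and J_holder: "u \<in> H\<^sub>0 \<Longrightarrow> Q \<in> D \<Longrightarrow> J u Q \<le> K u epowr (1/p) * J (test Q) Q epowr (1 - 1/p)"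
    and test_closed: "Q \<in> D \<Longrightarrow> test Q \<in> H\<^sub>0"
    and J_test_finite: "Q \<in> D \<Longrightarrow> J (test Q) Q < top"
    and K_test: "Q \<in> D \<Longrightarrow> K (test Q) = J (test Q) Q"
    and J_packing: "Q \<in> D \<Longrightarrow> finite \<R> \<Longrightarrow> \<R> \<subseteq> {R \<in> D. R \<subseteq> Q} \<Longrightarrow> disjoint \<R> \<Longrightarrow>
      (\<Sum>R\<in>\<R>. J (test R) R) \<le> (\<Sum>R\<in>\<R>. J (test Q) R) epowr (1/2) * J (test Q) Q epowr (1/2)"
begin

text \<open>A finite norm forces finite integrals by \<open>J_holder\<close>, so on this class the
  passage to real values respects sums and inequalities.\<close>

definition H :: "('z \<Rightarrow> real) set" where
  "H = {h \<in> H\<^sub>0. K h < top}"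

lemma J_finite:
  assumes "u \<in> H" "Q \<in> D" shows "J u Q < top"
proof -
  have "J u Q \<le> K u epowr (1/p) * J (test Q) Q epowr (1 - 1/p)"
    using assms by (intro J_holder) (auto simp: H_def)
  also have "\<dots> < top"
    using assms J_test_finite by (auto simp: H_def ennreal_mult_less_top)
  finally show ?thesis .
qed

text \<open>\<open>K_split\<close> for a family with one member; the index \<open>{}\<close> is only
  a label.\<close>

lemma K_indicator_le:
  assumes "u \<in> H\<^sub>0" "E \<in> sets M" shows "K (\<lambda>z. indicator E z * u z) \<le> K u"
  using K_split[of u "{{}}" "\<lambda>_. E"] assms by (simp add: disjoint_family_on_def)

lemma sum_enn2real: "(\<And>i. i \<in> A \<Longrightarrow> x i < top) \<Longrightarrow> (\<Sum>i\<in>A. enn2real (x i)) = enn2real (\<Sum>i\<in>A. x i)"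
  by (induction A rule: infinite_finite_induct) (auto simp: enn2real_plus)

sublocale stopping_side p D box M H "\<lambda>h Q. enn2real (J h Q)" "\<lambda>h. enn2real (K h)" test
proof
  fix u v :: "'z \<Rightarrow> real" assume u: "u \<in> H" and v: "v \<in> H"
  then have u0: "u \<in> H\<^sub>0" "K u < top" and v0: "v \<in> H\<^sub>0" "K v < top" by (auto simp: H_def)
  have fin: "ennreal (2 powr p) * (K u + K v) < top" using u0 v0 by (simp add: ennreal_mult_less_top)
  show "(\<lambda>z. u z + v z) \<in> H"
    using K_add[OF u0(1) v0(1)] closed_add[OF u0(1) v0(1)] fin by (auto simp: H_def)
  show "enn2real (K (\<lambda>z. u z + v z)) \<le> 2 powr p * (enn2real (K u) + enn2real (K v))"
    using enn2real_mono[OF K_add[OF u0(1) v0(1)] fin] u0 v0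
    by (simp add: enn2real_mult enn2real_plus)
  fix Q assume Q: "Q \<in> D"
  show "enn2real (J (\<lambda>z. u z + v z) Q) = enn2real (J u Q) + enn2real (J v Q)"
    using J_add[OF u0(1) v0(1) Q] J_finite[OF u Q] J_finite[OF v Q] by (simp add: enn2real_plus)
  show "enn2real (J u Q) \<le> enn2real (J v Q)" if "\<And>z. z \<in> box Q \<Longrightarrow> u z \<le> v z"
    using J_mono[OF u0(1) v0(1) Q that] J_finite[OF v Q] by (intro enn2real_mono)
next
  fix u :: "'z \<Rightarrow> real" and c :: real assume u: "u \<in> H" and c: "0 \<le> c"
  then have u0: "u \<in> H\<^sub>0" "K u < top" by (auto simp: H_def)
  show "(\<lambda>z. c * u z) \<in> H"
    using K_scale[OF u0(1) c] closed_scale[OF u0(1) c] u0 by (auto simp: H_def ennreal_mult_less_top)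
  show "enn2real (K (\<lambda>z. c * u z)) = c powr p * enn2real (K u)"
    using K_scale[OF u0(1) c] by (simp add: enn2real_mult)
  show "enn2real (J (\<lambda>z. c * u z) Q) = c * enn2real (J u Q)" if "Q \<in> D" for Q
    using J_scale[OF u0(1) c that] c by (simp add: enn2real_mult)
next
  fix u :: "'z \<Rightarrow> real" and \<R> :: "'x set set" and Es :: "'x set \<Rightarrow> 'z set"
  assume u: "u \<in> H" and \<R>: "finite \<R>" "\<And>R. R \<in> \<R> \<Longrightarrow> Es R \<in> sets M" "disjoint_family_on Es \<R>"
  then have u0: "u \<in> H\<^sub>0" "K u < top" by (auto simp: H_def)
  have "K (\<lambda>z. indicator (Es R) z * u z) < top" if "R \<in> \<R>" for R
    using K_indicator_le[OF u0(1) \<R>(2)[OF that]] u0(2) by (rule le_less_trans)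
  then have "(\<Sum>R\<in>\<R>. enn2real (K (\<lambda>z. indicator (Es R) z * u z))) = enn2real (\<Sum>R\<in>\<R>. K (\<lambda>z. indicator (Es R) z * u z))"
    by (intro sum_enn2real)
  also have "\<dots> \<le> enn2real (K u)" using K_split[OF u0(1) \<R>] u0(2) by (intro enn2real_mono)
  finally show "(\<Sum>R\<in>\<R>. enn2real (K (\<lambda>z. indicator (Es R) z * u z))) \<le> enn2real (K u)" .
next
  fix \<R> :: "'x set set" and w :: "'x set \<Rightarrow> 'z \<Rightarrow> real"
  assume \<R>: "finite \<R>" "\<R> \<subseteq> D" "disjoint \<R>" and w: "\<And>R. R \<in> \<R> \<Longrightarrow> w R \<in> H"
  have w0: "w R \<in> H\<^sub>0" "K (w R) < top" if "R \<in> \<R>" for R using w[OF that] by (auto simp: H_def)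
  have fin: "K (\<lambda>z. indicator (box R) z * w R z) < top" if "R \<in> \<R>" for R
    using le_less_trans[OF K_indicator_le w0(2)] w0(1) box_sets that \<R>(2) by auto
  have "enn2real (K (\<lambda>z. \<Sum>R\<in>\<R>. indicator (box R) z * w R z)) \<le> enn2real (\<Sum>R\<in>\<R>. K (\<lambda>z. indicator (box R) z * w R z))"
    using fin by (intro enn2real_mono K_disjoint \<R> w0(1)) (auto simp: \<R>)
  also have "\<dots> = (\<Sum>R\<in>\<R>. enn2real (K (\<lambda>z. indicator (box R) z * w R z)))"
    using fin by (intro sum_enn2real[symmetric])
  finally show "enn2real (K (\<lambda>z. \<Sum>R\<in>\<R>. indicator (box R) z * w R z)) \<le> \<dots>" .
next
  fix u E assume u: "u \<in> H" and E: "E \<in> sets M"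
  then show "(\<lambda>z. indicator E z * u z) \<in> H"
    using le_less_trans[OF K_indicator_le] closed_indicator by (auto simp: H_def)
next
  fix u Q assume u: "u \<in> H" and Q: "Q \<in> D"
  then have u0: "u \<in> H\<^sub>0" "K u < top" by (auto simp: H_def)
  have "enn2real (J u Q) \<le> enn2real (K u epowr (1/p) * J (test Q) Q epowr (1 - 1/p))"
    using u0 J_test_finite[OF Q] by (intro enn2real_mono J_holder Q) (auto simp: ennreal_mult_less_top)
  then show "enn2real (J u Q) \<le> enn2real (K u) powr (1/p) * enn2real (J (test Q) Q) powr (1 - 1/p)"
    using u0 J_test_finite[OF Q] by (simp add: enn2real_mult enn2real_epowr)
next
  fix Q assume Q: "Q \<in> D"
  show test: "test Q \<in> H" using test_closed[OF Q] K_test[OF Q] J_test_finite[OF Q] by (simp add: H_def)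
  fix \<R> assume \<R>: "finite \<R>" "\<R> \<subseteq> {R \<in> D. R \<subseteq> Q}" "disjoint \<R>"
    and le: "(\<Sum>R\<in>\<R>. enn2real (J (test Q) R)) \<le> enn2real (J (test Q) Q) / 4"
  define \<nu> where "\<nu> = enn2real (J (test Q) Q)"
  have \<nu>: "J (test Q) Q = ennreal \<nu>" "0 \<le> \<nu>" unfolding \<nu>_def using J_test_finite[OF Q] by auto
  define m where "m = (\<Sum>R\<in>\<R>. enn2real (J (test Q) R))"
  have m0: "0 \<le> m" unfolding m_def by (intro sum_nonneg) simp
  have "m = enn2real (\<Sum>R\<in>\<R>. J (test Q) R)"
    unfolding m_def using J_finite[OF test] \<R>(2) by (intro sum_enn2real) auto
  moreover have "(\<Sum>R\<in>\<R>. J (test Q) R) < top" using J_finite[OF test] \<R>(1,2) by auto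
  ultimately have m: "(\<Sum>R\<in>\<R>. J (test Q) R) = ennreal m" by simp
  have "(\<Sum>R\<in>\<R>. enn2real (J (test R) R)) = enn2real (\<Sum>R\<in>\<R>. J (test R) R)"
    using J_test_finite \<R>(2) by (intro sum_enn2real) auto
  also have "\<dots> \<le> m powr (1/2) * \<nu> powr (1/2)"
    using J_packing[OF Q \<R>] m0 \<nu>(2) unfolding m \<nu>(1)
    by (intro enn2real_leI) (simp_all add: ennreal_mult)
  \<comment> \<open>The geometric mean of \<open>\<nu> / 4\<close> and \<open>\<nu>\<close> is
    \<open>\<nu> / 2\<close>, which is the gain required by \<open>packing\<close>.\<close>
  also have "\<dots> \<le> (\<nu> / 4) powr (1/2) * \<nu> powr (1/2)"
    using le m0 unfolding m_def[symmetric] \<nu>_def[symmetric] by (intro mult_right_mono powr_mono2) auto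
  also have "\<dots> = \<nu> / 2"
    using \<nu>(2) by (simp add: powr_half_sqrt real_sqrt_divide)
  finally show "(\<Sum>R\<in>\<R>. enn2real (J (test R) R)) \<le> enn2real (J (test Q) Q) / 2"
    unfolding \<nu>_def .
qed (use p laminar box_sets box_mono box_disj nonneg J_box K_test in \<open>auto simp: H_def\<close>)

end

section \<open>Dyadic cubes\<close>

lemma space_Rn: "space (Rn n) = (\<Pi>\<^sub>E i\<in>{..<n}. UNIV)"
  unfolding Rn_def by (simp add: space_PiM)

text \<open>Membership in terms of integer parts turns the nesting of cubes into arithmetic with
  integer division.\<close>

lemma mem_dyadic_cube:
  "x \<in> dyadic_cube n k m \<longleftrightarrow> x \<in> extensional {..<n} \<and> (\<forall>i<n. \<lfloor>2 powi k * x i\<rfloor> = m i)"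
proof -
  have "2 powi (- k) * real_of_int (m i) \<le> x i \<and> x i < 2 powi (- k) * (real_of_int (m i) + 1) \<longleftrightarrow>
      \<lfloor>2 powi k * x i\<rfloor> = m i" for i
    by (simp add: floor_eq_iff power_int_minus field_simps)
  then show ?thesis
    unfolding dyadic_cube_def PiE_iff by auto
qed

lemma dyadic_cube_nonempty: "dyadic_cube n k m \<noteq> {}"
proof -
  have "(\<lambda>i\<in>{..<n}. 2 powi (- k) * real_of_int (m i)) \<in> dyadic_cube n k m"
    by (simp add: mem_dyadic_cube mult.assoc[symmetric] power_int_add[symmetric])
  then show ?thesis by blast
qed

text \<open>The integer part at the coarser scale \<open>k\<close> is the one at the finer scale
  \<open>k'\<close> divided by a power of 2, so points of the same fine cube lie in the same coarse
  cube.\<close>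

lemma dyadic_cube_subset:
  assumes "k \<le> k'" "x \<in> dyadic_cube n k m" "x \<in> dyadic_cube n k' m'"
  shows "dyadic_cube n k' m' \<subseteq> dyadic_cube n k m"
proof
  fix y assume y: "y \<in> dyadic_cube n k' m'"
  have floor: "\<lfloor>2 powi k * a\<rfloor> = \<lfloor>2 powi k' * a\<rfloor> div 2 ^ nat (k' - k)" for a :: real
  proof -
    have "2 powi k' = 2 powi k * (2::real) powi (k' - k)"
      by (simp add: power_int_add[symmetric])
    also have "(2::real) powi (k' - k) = 2 ^ nat (k' - k)"
      using assms(1) by (simp add: power_int_def)
    finally have "2 powi k * a = (2 powi k' * a) / real_of_int (2 ^ nat (k' - k))"
      by simp
    then show ?thesis by (simp only: floor_divide_real_eq_div zero_le_power zero_le_numeral)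
  qed
  show "y \<in> dyadic_cube n k m"
    using y assms(2,3) unfolding mem_dyadic_cube floor by auto
qed

lemma laminar_dyadic: "laminar (dyadic n)"
  unfolding laminar_def
proof (intro conjI ballI)
  show "{} \<notin> dyadic n" unfolding dyadic_def using dyadic_cube_nonempty by fastforce
  fix Q R assume "Q \<in> dyadic n" "R \<in> dyadic n"
  then obtain k m k' m' where QR: "Q = dyadic_cube n k m" "R = dyadic_cube n k' m'"
    unfolding dyadic_def by blast
  show "Q \<subseteq> R \<or> R \<subseteq> Q \<or> Q \<inter> R = {}"
  proof (cases "Q \<inter> R = {}")
    case False
    then obtain x where "x \<in> Q" "x \<in> R" by blast
    then show ?thesis
      using dyadic_cube_subset[of k k' x n m m'] dyadic_cube_subset[of k' k x n m' m] QR by (cases "k \<le> k'") auto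
  qed simp
qed

text \<open>Nested nonempty products have nested factors, and coordinate 0 exists since
  \<open>n\<close> is at least 1; comparing the lengths of these intervals suffices.\<close>

lemma side_length_mono:
  assumes n: "n \<ge> 1" and "Q \<in> dyadic n" "R \<in> dyadic n" "Q \<subseteq> R"
  shows "side_length n Q \<le> side_length n R"
proof -
  obtain k m k' m' where QR: "Q = dyadic_cube n k m" "R = dyadic_cube n k' m'"
    using assms unfolding dyadic_def by blast
  let ?I = "\<lambda>k m. {(2::real) powi (- k) * real_of_int (m 0) ..< 2 powi (- k) * (real_of_int (m 0) + 1)}"
  have "?I k m \<subseteq> ?I k' m'"
    using assms(4) dyadic_cube_nonempty[of n k m] n
    unfolding QR dyadic_cube_def by (auto simp: subset_PiE)
  moreover have "2 powi (- k) * real_of_int (m 0) < 2 powi (- k) * (real_of_int (m 0) + 1)"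
    by (intro mult_strict_left_mono) auto
  ultimately have "2 powi (- k') * real_of_int (m' 0) \<le> 2 powi (- k) * real_of_int (m 0)"
    "2 powi (- k) * (real_of_int (m 0) + 1) \<le> 2 powi (- k') * (real_of_int (m' 0) + 1)"
    by (auto dest!: atLeastLessThan_subset_iff)
  then show ?thesis
    unfolding QR side_length_dyadic_cube[OF n] by (simp add: algebra_simps)
qed

lemma dyadic_sets: "Q \<in> dyadic n \<Longrightarrow> Q \<in> sets (Rn n)"
  unfolding dyadic_def dyadic_cube_def Rn_def by (auto intro!: sets_PiM_I_finite)

lemma carleson_box_mono:
  assumes "n \<ge> 1" "Q \<in> dyadic n" "R \<in> dyadic n" "Q \<subseteq> R"
  shows "carleson_box n Q \<subseteq> carleson_box n R"
  using side_length_mono[OF assms] assms(4) unfolding carleson_box_def by auto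

lemma sets_eta: "sets eta = sets (restrict_space borel {0<..})"
  unfolding eta_def by simp

lemma space_eta: "space eta = {0<..}"
  unfolding eta_def by (simp add: space_restrict_space)

lemma carleson_box_sets:
  assumes "sets \<sigma> = sets (Rn n)" "Q \<in> dyadic n"
  shows "carleson_box n Q \<in> sets (\<sigma> \<Otimes>\<^sub>M eta)"
  unfolding carleson_box_def
  using assms dyadic_sets by (intro pair_measureI) (auto simp: sets_eta sets_restrict_space_iff)

text \<open>The closed cube is compact in the product topology, so finitely many of the
  neighbourhoods of finite measure cover it.\<close>

lemma emeasure_dyadic_finite:
  assumes lf: "locally_finite_borel n M" and Q: "Q \<in> dyadic n"
  shows "emeasure M Q < \<infinity>"
proof -
  have sets: "sets M = sets (Rn n)" and
    loc: "\<And>x. x \<in> space M \<Longrightarrow> \<exists>r>0. emeasure M {y \<in> space M. \<forall>i<n. \<bar>y i - x i\<bar> < r} < \<infinity>"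
    using lf unfolding locally_finite_borel_def by auto
  have space: "space M = (\<Pi>\<^sub>E i\<in>{..<n}. UNIV)"
    using sets_eq_imp_space_eq[OF sets] space_Rn by simp
  define r where "r x = (SOME r. 0 < r \<and> emeasure M {y \<in> space M. \<forall>i<n. \<bar>y i - x i\<bar> < r} < \<infinity>)" for x
  have "0 < r x \<and> emeasure M {y \<in> space M. \<forall>i<n. \<bar>y i - x i\<bar> < r x} < \<infinity>" if "x \<in> space M" for x
    unfolding r_def using loc[OF that] by (intro someI_ex[where P = "\<lambda>r. 0 < r \<and> _ r"]) blast
  then have r: "0 < r x" "emeasure M {y \<in> space M. \<forall>i<n. \<bar>y i - x i\<bar> < r x} < \<infinity>" if "x \<in> space M" for x
    using that by blast+
  \<comment> \<open>Written as products of open intervals, the neighbourhoods are visibly open in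
    the product topology and measurable.\<close>
  define B where "B x = (\<Pi>\<^sub>E i\<in>{..<n}. {x i - r x <..< x i + r x})" for x
  have B: "B x = {y \<in> space M. \<forall>i<n. \<bar>y i - x i\<bar> < r x}" for x
  proof -
    have "y i \<in> {x i - r x <..< x i + r x} \<longleftrightarrow> \<bar>y i - x i\<bar> < r x" for y i
      by auto
    then show ?thesis
      unfolding B_def space by (auto simp: PiE_iff extensional_def simp del: greaterThanLessThan_iff)
  qed
  obtain k m where km: "Q = dyadic_cube n k m" using Q unfolding dyadic_def by blast
  define C where "C = (\<Pi>\<^sub>E i\<in>{..<n}. {2 powi (- k) * real_of_int (m i) .. 2 powi (- k) * (real_of_int (m i) + 1)})"
  have QC: "Q \<subseteq> C" unfolding km C_def dyadic_cube_def by (intro PiE_mono) auto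
  have CM: "C \<subseteq> space M" unfolding C_def space by (intro PiE_mono) auto
  have "compactin (product_topology (\<lambda>_. euclideanreal) {..<n}) C"
    unfolding C_def by (subst compactin_PiE) auto
  moreover have "openin (product_topology (\<lambda>_. euclideanreal) {..<n}) U" if "U \<in> B ` C" for U
    using that unfolding B_def by (auto simp: openin_PiE_gen)
  moreover have "C \<subseteq> \<Union>(B ` C)"
  proof
    fix x assume x: "x \<in> C"
    then have "x \<in> B x" unfolding B using CM r(1) by auto
    then show "x \<in> \<Union>(B ` C)" using x by blast
  qed
  ultimately obtain \<F> where \<F>: "finite \<F>" "\<F> \<subseteq> B ` C" "C \<subseteq> \<Union>\<F>"
    by (rule compactinD[where \<U> = "B ` C", THEN exE]) (auto simp only:)
  have meas: "U \<in> sets M" and fin: "emeasure M U < \<infinity>" if U: "U \<in> \<F>" for U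
  proof -
    obtain x where x: "x \<in> C" "U = B x" using U \<F>(2) by blast
    show "U \<in> sets M" unfolding x(2) B_def sets Rn_def by (intro sets_PiM_I_finite) auto
    show "emeasure M U < \<infinity>" unfolding x(2) B using r(2) x(1) CM by auto
  qed
  have "emeasure M Q \<le> emeasure M (\<Union>\<F>)"
    using QC \<F> meas by (intro emeasure_mono) auto
  also have "\<dots> \<le> (\<Sum>U\<in>\<F>. emeasure M U)"
    using emeasure_subadditive_finite[of \<F> "\<lambda>U. U" M] \<F>(1) meas by (auto simp: subset_iff)
  also have "\<dots> < \<infinity>"
    using fin \<F>(1) by auto
  finally show ?thesis .
qed

text \<open>Used pointwise: a sum of functions supported on disjoint cubes has at most one nonzero
  term at each \<open>x\<close>.\<close>

lemma disjoint_at_most_one: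
  assumes "disjoint \<R>"
  obtains "\<And>R. R \<in> \<R> \<Longrightarrow> x \<notin> R" | R\<^sub>0 where "R\<^sub>0 \<in> \<R>" "x \<in> R\<^sub>0" "\<And>R. R \<in> \<R> \<Longrightarrow> R \<noteq> R\<^sub>0 \<Longrightarrow> x \<notin> R"
  using assms unfolding disjoint_def by blast

section \<open>The side of the single function\<close>

lemma nonneg_measD: "nonneg_meas M f \<Longrightarrow> f \<in> borel_measurable M" "nonneg_meas M f \<Longrightarrow> z \<in> space M \<Longrightarrow> 0 \<le> f z"
  unfolding nonneg_meas_def by auto

lemma nonneg_meas_add: "nonneg_meas M u \<Longrightarrow> nonneg_meas M v \<Longrightarrow> nonneg_meas M (\<lambda>z. u z + v z)"
  unfolding nonneg_meas_def by auto

lemma nonneg_meas_scale: "nonneg_meas M u \<Longrightarrow> 0 \<le> c \<Longrightarrow> nonneg_meas M (\<lambda>z. c * u z)"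
  unfolding nonneg_meas_def by auto

lemma nonneg_meas_mult: "nonneg_meas M u \<Longrightarrow> nonneg_meas M v \<Longrightarrow> nonneg_meas M (\<lambda>z. u z * v z)"
  unfolding nonneg_meas_def by auto

lemma nonneg_meas_indicator: "E \<in> sets M \<Longrightarrow> nonneg_meas M (indicator E)"
  unfolding nonneg_meas_def by auto

lemma sum_eq_single:
  assumes "finite A" "a \<in> A" "\<And>i. i \<in> A \<Longrightarrow> i \<noteq> a \<Longrightarrow> f i = 0"
  shows "sum f A = f a"
  using assms by (subst sum.remove[of A a]) (auto intro: sum.neutral)

text \<open>The sum is at most twice the maximum, and a power of the maximum is at most the sum of
  the powers. With \<open>a = p/2\<close> the constant is \<open>2 powr p\<close>.\<close>

lemma epowr_quasi_triangle:
  assumes "0 < a" shows "(2 * (x + y)) epowr a \<le> ennreal (4 powr a) * (x epowr a + y epowr a)"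
proof -
  have "2 * (x + y) \<le> 4 * max x y"
  proof -
    have "2 * (x + y) \<le> 2 * (max x y + max x y)" by (intro mult_left_mono add_mono) auto
    also have "\<dots> = 2 * (2 * max x y)" by (simp only: mult_2)
    also have "\<dots> = 4 * max x y" by (simp only: mult.assoc[symmetric]) simp
    finally show ?thesis .
  qed
  then have "(2 * (x + y)) epowr a \<le> (4 * max x y) epowr a"
    by (rule epowr_mono[OF assms])
  also have "\<dots> = ennreal (4 powr a) * (max x y) epowr a"
    using epowr_ennreal[of 4 a] assms by (simp add: epowr_mult)
  also have "\<dots> \<le> ennreal (4 powr a) * (x epowr a + y epowr a)"
    by (intro mult_left_mono) (auto simp: max_def)
  finally show ?thesis .
qed

text \<open>The boxes are the cubes and the test functions their indicators, so the test mass is the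
  measure of the cube, finite by compactness. Here \<open>test Q\<close> and \<open>test R\<close>
  have the same mass on \<open>R\<close>, so packing amounts to additivity of the measure.\<close>

lemma scalar_side:
  assumes q: "1 < q" and lf: "locally_finite_borel n \<omega>"
  shows "ennreal_side q (dyadic n) (\<lambda>Q. Q) \<omega> {g. nonneg_meas \<omega> g}
    (\<lambda>g Q. \<integral>\<^sup>+x\<in>Q. ennreal (g x) \<partial>\<omega>) (\<lambda>g. \<integral>\<^sup>+x. ennreal (\<bar>g x\<bar> powr q) \<partial>\<omega>) indicator"
proof -
  have sets: "sets \<omega> = sets (Rn n)" using lf unfolding locally_finite_borel_def by simp
  have Q_sets: "Q \<in> sets \<omega>" if "Q \<in> dyadic n" for Q using dyadic_sets[OF that] sets by simp
  have Q_space: "x \<in> space \<omega>" if "x \<in> Q" "Q \<in> dyadic n" for x Q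
    using sets.sets_into_space[OF Q_sets] that by blast
  have test: "(\<integral>\<^sup>+x\<in>R. ennreal (indicator Q x) \<partial>\<omega>) = emeasure \<omega> R"
    if "R \<in> dyadic n" "R \<subseteq> Q" for R Q
  proof -
    have "(\<integral>\<^sup>+x\<in>R. ennreal (indicator Q x) \<partial>\<omega>) = (\<integral>\<^sup>+x. indicator R x \<partial>\<omega>)"
      using that by (intro nn_integral_cong) (auto simp: indicator_def)
    then show ?thesis using Q_sets[OF that(1)] by simp
  qed
  note [measurable] = Q_sets
  show ?thesis
  proof
    show "1 < q" by (rule q)
    show "laminar (dyadic n)" by (rule laminar_dyadic)
  next
    fix u v :: "point \<Rightarrow> real" assume "u \<in> {g. nonneg_meas \<omega> g}" "v \<in> {g. nonneg_meas \<omega> g}"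
    then have u: "nonneg_meas \<omega> u" and v: "nonneg_meas \<omega> v" by auto
    note [measurable] = nonneg_measD(1)[OF u] nonneg_measD(1)[OF v]
    show "(\<lambda>z. u z + v z) \<in> {g. nonneg_meas \<omega> g}" using u v by (simp add: nonneg_meas_add)
    have "(\<integral>\<^sup>+x. ennreal (\<bar>u x + v x\<bar> powr q) \<partial>\<omega>) \<le>
        (\<integral>\<^sup>+x. ennreal (2 powr q) * (ennreal (\<bar>u x\<bar> powr q) + ennreal (\<bar>v x\<bar> powr q)) \<partial>\<omega>)"
    proof (intro nn_integral_mono)
      fix x
      have "\<bar>u x + v x\<bar> \<le> 2 * max \<bar>u x\<bar> \<bar>v x\<bar>" by auto
      then have "\<bar>u x + v x\<bar> powr q \<le> (2 * max \<bar>u x\<bar> \<bar>v x\<bar>) powr q"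
        using q by (intro powr_mono2) auto
      also have "\<dots> = 2 powr q * (max \<bar>u x\<bar> \<bar>v x\<bar>) powr q"
        by (simp add: powr_mult)
      also have "\<dots> \<le> 2 powr q * (\<bar>u x\<bar> powr q + \<bar>v x\<bar> powr q)"
        by (intro mult_left_mono) (auto simp: max_def)
      finally show "ennreal (\<bar>u x + v x\<bar> powr q) \<le> ennreal (2 powr q) * (ennreal (\<bar>u x\<bar> powr q) + ennreal (\<bar>v x\<bar> powr q))"
        by (simp flip: ennreal_mult ennreal_plus)
    qed
    also have "\<dots> = ennreal (2 powr q) * ((\<integral>\<^sup>+x. ennreal (\<bar>u x\<bar> powr q) \<partial>\<omega>) + (\<integral>\<^sup>+x. ennreal (\<bar>v x\<bar> powr q) \<partial>\<omega>))"
      by (simp add: nn_integral_cmult nn_integral_add)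
    finally show "(\<integral>\<^sup>+x. ennreal (\<bar>u x + v x\<bar> powr q) \<partial>\<omega>) \<le> \<dots>" .
    fix Q assume Q: "Q \<in> dyadic n"
    show "(\<integral>\<^sup>+x\<in>Q. ennreal (u x + v x) \<partial>\<omega>) = (\<integral>\<^sup>+x\<in>Q. ennreal (u x) \<partial>\<omega>) + (\<integral>\<^sup>+x\<in>Q. ennreal (v x) \<partial>\<omega>)"
      using nonneg_measD(2)[OF u] nonneg_measD(2)[OF v] Q
      by (subst nn_integral_add[symmetric]) (auto intro!: nn_integral_cong simp: distrib_right)
    show "(\<integral>\<^sup>+x\<in>Q. ennreal (u x) \<partial>\<omega>) \<le> (\<integral>\<^sup>+x\<in>Q. ennreal (v x) \<partial>\<omega>)" if "\<And>z. z \<in> Q \<Longrightarrow> u z \<le> v z"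
      using that by (intro nn_integral_mono) (auto simp: indicator_def intro: ennreal_leI)
  next
    fix u :: "point \<Rightarrow> real" and c :: real assume "u \<in> {g. nonneg_meas \<omega> g}" and c: "0 \<le> c"
    then have u: "nonneg_meas \<omega> u" by auto
    note [measurable] = nonneg_measD(1)[OF u]
    show "(\<lambda>z. c * u z) \<in> {g. nonneg_meas \<omega> g}" using u c by (simp add: nonneg_meas_scale)
    show "(\<integral>\<^sup>+x. ennreal (\<bar>c * u x\<bar> powr q) \<partial>\<omega>) = ennreal (c powr q) * (\<integral>\<^sup>+x. ennreal (\<bar>u x\<bar> powr q) \<partial>\<omega>)"
      using c by (subst nn_integral_cmult[symmetric]) (auto simp: abs_mult powr_mult ennreal_mult)
    show "(\<integral>\<^sup>+x\<in>Q. ennreal (c * u x) \<partial>\<omega>) = ennreal c * (\<integral>\<^sup>+x\<in>Q. ennreal (u x) \<partial>\<omega>)" if "Q \<in> dyadic n" for Q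
      using c that by (subst nn_integral_cmult[symmetric])
        (auto intro!: nn_integral_cong simp: ennreal_mult' mult.assoc)
  next
    fix u Q R assume "u \<in> {g. nonneg_meas \<omega> g}" and "Q \<in> dyadic n" "R \<in> dyadic n" "R \<subseteq> Q"
    then show "(\<integral>\<^sup>+x\<in>Q. ennreal (indicator R x * u x) \<partial>\<omega>) = (\<integral>\<^sup>+x\<in>R. ennreal (u x) \<partial>\<omega>)"
      by (intro nn_integral_cong) (auto simp: indicator_def)
  next
    fix u :: "point \<Rightarrow> real" and \<R> :: "point set set" and Es :: "point set \<Rightarrow> point set"
    assume "u \<in> {g. nonneg_meas \<omega> g}" and \<R>: "finite \<R>" "\<And>R. R \<in> \<R> \<Longrightarrow> Es R \<in> sets \<omega>" "disjoint_family_on Es \<R>"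
    then have u: "nonneg_meas \<omega> u" by auto
    note [measurable] = nonneg_measD(1)[OF u] \<R>(2)
    have "(\<Sum>R\<in>\<R>. \<integral>\<^sup>+x. ennreal (\<bar>indicator (Es R) x * u x\<bar> powr q) \<partial>\<omega>) =
       (\<integral>\<^sup>+x. (\<Sum>R\<in>\<R>. ennreal (\<bar>indicator (Es R) x * u x\<bar> powr q)) \<partial>\<omega>)"
      by (intro nn_integral_sum[symmetric]) auto
    also have "\<dots> \<le> (\<integral>\<^sup>+x. ennreal (\<bar>u x\<bar> powr q) \<partial>\<omega>)"
    proof (intro nn_integral_mono)
      fix x
      have "(\<Sum>R\<in>\<R>. ennreal (\<bar>indicator (Es R) x * u x\<bar> powr q)) =
          (\<Sum>R\<in>\<R>. indicator (Es R) x * ennreal (\<bar>u x\<bar> powr q))"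
        by (intro sum.cong) (auto simp: indicator_def)
      also have "\<dots> = indicator (\<Union>(Es ` \<R>)) x * ennreal (\<bar>u x\<bar> powr q)"
        using \<R> by (simp add: sum_distrib_right[symmetric] indicator_UN_disjoint)
      also have "\<dots> \<le> ennreal (\<bar>u x\<bar> powr q)" by (auto simp: indicator_def)
      finally show "(\<Sum>R\<in>\<R>. ennreal (\<bar>indicator (Es R) x * u x\<bar> powr q)) \<le> ennreal (\<bar>u x\<bar> powr q)" .
    qed
    finally show "(\<Sum>R\<in>\<R>. \<integral>\<^sup>+x. ennreal (\<bar>indicator (Es R) x * u x\<bar> powr q) \<partial>\<omega>) \<le> \<dots>" .
  next
    fix \<R> :: "point set set" and w :: "point set \<Rightarrow> point \<Rightarrow> real"
    assume \<R>: "finite \<R>" "\<R> \<subseteq> dyadic n" "disjoint \<R>" and w: "\<And>R. R \<in> \<R> \<Longrightarrow> w R \<in> {g. nonneg_meas \<omega> g}"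
    have [measurable]: "w R \<in> borel_measurable \<omega>" if "R \<in> \<R>" for R using w[OF that] nonneg_measD by auto
    have [measurable]: "R \<in> sets \<omega>" if "R \<in> \<R>" for R using \<R> Q_sets that by auto
    have "(\<integral>\<^sup>+x. ennreal (\<bar>\<Sum>R\<in>\<R>. indicator R x * w R x\<bar> powr q) \<partial>\<omega>) \<le>
      (\<integral>\<^sup>+x. (\<Sum>R\<in>\<R>. ennreal (\<bar>indicator R x * w R x\<bar> powr q)) \<partial>\<omega>)"
    proof (intro nn_integral_mono)
      fix x
      from disjoint_at_most_one[OF \<R>(3), of x]
      show "ennreal (\<bar>\<Sum>R\<in>\<R>. indicator R x * w R x\<bar> powr q) \<le> (\<Sum>R\<in>\<R>. ennreal (\<bar>indicator R x * w R x\<bar> powr q))"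
      proof cases
        case (2 R\<^sub>0)
        have "(\<Sum>R\<in>\<R>. indicator R x * w R x) = indicator R\<^sub>0 x * w R\<^sub>0 x"
          using \<R>(1) 2 by (intro sum_eq_single) auto
        moreover have "ennreal (\<bar>indicator R\<^sub>0 x * w R\<^sub>0 x\<bar> powr q) \<le> (\<Sum>R\<in>\<R>. ennreal (\<bar>indicator R x * w R x\<bar> powr q))"
          using \<R>(1) 2(1) by (intro member_le_sum) auto
        ultimately show ?thesis by (simp only:)
      qed simp
    qed
    also have "\<dots> = (\<Sum>R\<in>\<R>. \<integral>\<^sup>+x. ennreal (\<bar>indicator R x * w R x\<bar> powr q) \<partial>\<omega>)"
      by (intro nn_integral_sum) auto
    finally show "(\<integral>\<^sup>+x. ennreal (\<bar>\<Sum>R\<in>\<R>. indicator R x * w R x\<bar> powr q) \<partial>\<omega>) \<le> \<dots>" .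
  next
    fix u Q assume "u \<in> {g. nonneg_meas \<omega> g}" and Q: "Q \<in> dyadic n"
    then have u: "nonneg_meas \<omega> u" by auto
    note [measurable] = nonneg_measD(1)[OF u] Q_sets[OF Q]
    \<comment> \<open>The indicator equals each of its positive powers and can serve as the second
      factor in Hoelder's inequality.\<close>
    have "(\<integral>\<^sup>+x\<in>Q. ennreal (u x) \<partial>\<omega>) =
       (\<integral>\<^sup>+x. ennreal (\<bar>u x\<bar> powr q) epowr (1/q) * indicator Q x epowr (1 - 1/q) \<partial>\<omega>)"
    proof (intro nn_integral_cong)
      fix x assume "x \<in> space \<omega>"
      then have "0 \<le> u x" by (rule nonneg_measD(2)[OF u])
      moreover have "indicator Q x epowr (1 - 1/q) = (indicator Q x :: ennreal)"
        using epowr_ennreal[of 1 "1 - 1/q"] by (auto simp: indicator_def)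
      ultimately show "ennreal (u x) * indicator Q x = ennreal (\<bar>u x\<bar> powr q) epowr (1/q) * indicator Q x epowr (1 - 1/q)"
        using q by (simp add: powr_powr)
    qed
    also have "\<dots> \<le> (\<integral>\<^sup>+x. ennreal (\<bar>u x\<bar> powr q) \<partial>\<omega>) epowr (1/q) * (\<integral>\<^sup>+x. indicator Q x \<partial>\<omega>) epowr (1 - 1/q)"
      using q by (intro nn_integral_holder) auto
    finally show "(\<integral>\<^sup>+x\<in>Q. ennreal (u x) \<partial>\<omega>) \<le> (\<integral>\<^sup>+x. ennreal (\<bar>u x\<bar> powr q) \<partial>\<omega>) epowr (1/q)
        * (\<integral>\<^sup>+x\<in>Q. ennreal (indicator Q x) \<partial>\<omega>) epowr (1 - 1/q)"
      using test[OF Q] by simp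
  next
    fix Q assume Q: "Q \<in> dyadic n"
    show "indicator Q \<in> {g. nonneg_meas \<omega> g}" using nonneg_meas_indicator[OF Q_sets[OF Q]] by simp
    show "(\<integral>\<^sup>+x\<in>Q. ennreal (indicator Q x) \<partial>\<omega>) < top"
      using test[OF Q] emeasure_dyadic_finite[OF lf Q] by simp
    have "(\<integral>\<^sup>+x. ennreal (\<bar>indicator Q x\<bar> powr q) \<partial>\<omega>) = (\<integral>\<^sup>+x\<in>Q. ennreal (indicator Q x) \<partial>\<omega>)"
      by (intro nn_integral_cong) (auto simp: indicator_def)
    then show "(\<integral>\<^sup>+x. ennreal (\<bar>indicator Q x\<bar> powr q) \<partial>\<omega>) = (\<integral>\<^sup>+x\<in>Q. ennreal (indicator Q x) \<partial>\<omega>)" .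
    fix \<R> assume \<R>: "finite \<R>" "\<R> \<subseteq> {R \<in> dyadic n. R \<subseteq> Q}" "disjoint \<R>"
    have sum_eq: "(\<Sum>R\<in>\<R>. \<integral>\<^sup>+x\<in>R. ennreal (indicator (S R) x) \<partial>\<omega>) = (\<Sum>R\<in>\<R>. emeasure \<omega> R)"
      if "\<And>R. R \<in> \<R> \<Longrightarrow> R \<subseteq> S R" for S
      using \<R>(2) that by (intro sum.cong test) auto
    have "(\<Sum>R\<in>\<R>. emeasure \<omega> R) = emeasure \<omega> (\<Union>\<R>)"
      using \<R> Q_sets sum_emeasure[of "\<lambda>R. R" \<R> \<omega>]
      by (auto simp: disjoint_family_on_def disjoint_def subset_iff)
    also have "\<dots> \<le> emeasure \<omega> Q"
      using \<R> Q_sets[OF Q] by (intro emeasure_mono) auto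
    finally have le: "(\<Sum>R\<in>\<R>. emeasure \<omega> R) \<le> emeasure \<omega> Q" .
    \<comment> \<open>The total is split into two square roots, only one of which is enlarged to the
      measure of \<open>Q\<close>.\<close>
    have "(\<Sum>R\<in>\<R>. emeasure \<omega> R) = (\<Sum>R\<in>\<R>. emeasure \<omega> R) epowr (1/2) * (\<Sum>R\<in>\<R>. emeasure \<omega> R) epowr (1/2)"
      by (simp add: epowr_add)
    also have "\<dots> \<le> (\<Sum>R\<in>\<R>. emeasure \<omega> R) epowr (1/2) * emeasure \<omega> Q epowr (1/2)"
      using le by (intro mult_left_mono epowr_mono) auto
    finally show "(\<Sum>R\<in>\<R>. \<integral>\<^sup>+x\<in>R. ennreal (indicator R x) \<partial>\<omega>) \<le>
      (\<Sum>R\<in>\<R>. \<integral>\<^sup>+x\<in>R. ennreal (indicator Q x) \<partial>\<omega>) epowr (1/2) * (\<integral>\<^sup>+x\<in>Q. ennreal (indicator Q x) \<partial>\<omega>) epowr (1/2)"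
      using sum_eq[of "\<lambda>R. R"] sum_eq[of "\<lambda>_. Q"] \<R>(2) test[OF Q] by (simp add: subset_iff)
  next
    fix h Q z assume h: "h \<in> {g. nonneg_meas \<omega> g}" and Q: "Q \<in> dyadic n" "z \<in> Q"
    then show "0 \<le> h z" using nonneg_measD(2)[of \<omega> h z] Q_space by simp
  qed (use Q_sets in \<open>auto intro: nonneg_meas_mult nonneg_meas_indicator\<close>)
qed

section \<open>The side of the sequence of functions\<close>

text \<open>The inner product of two non-negative sequences at \<open>x\<close>;
  \<open>pairing f f\<close> is the square of the pointwise sequence norm.\<close>

definition pairing :: "(point \<times> real \<Rightarrow> real) \<Rightarrow> (point \<times> real \<Rightarrow> real) \<Rightarrow> point \<Rightarrow> ennreal" where
  "pairing u v x = (\<integral>\<^sup>+k. ennreal (u (x, 2 powi (- k)) * v (x, 2 powi (- k))) \<partial>count_space (UNIV :: int set))"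

lemma l2_eq_pairing: "l2 f x = pairing f f x epowr (1/2)"
  unfolding l2_def pairing_def infsum_int_eq_nn_integral by (simp add: power2_eq_square abs_mult_self_eq)

lemma pairing_scale:
  assumes "\<And>k. u (x, 2 powi (- k)) * v (x, 2 powi (- k)) = c * (u' (x, 2 powi (- k)) * v' (x, 2 powi (- k)))" "0 \<le> c"
  shows "pairing u v x = ennreal c * pairing u' v' x"
  unfolding pairing_def assms(1) using assms(2) by (simp add: ennreal_mult' nn_integral_cmult)

lemma pairing_mono:
  assumes "\<And>k. u (x, 2 powi (- k)) * v (x, 2 powi (- k)) \<le> u' (x, 2 powi (- k)) * v' (x, 2 powi (- k))"
  shows "pairing u v x \<le> pairing u' v' x"
  unfolding pairing_def by (intro nn_integral_mono ennreal_leI assms)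

lemma pairing_zero:
  assumes "\<And>k. u (x, 2 powi (- k)) * v (x, 2 powi (- k)) = 0"
  shows "pairing u v x = 0"
  unfolding pairing_def assms by simp

lemma pairing_cauchy_schwarz:
  assumes "\<And>k. 0 \<le> u (x, 2 powi (- k))" "\<And>k. 0 \<le> v (x, 2 powi (- k))"
  shows "pairing u v x \<le> pairing u u x epowr (1/2) * pairing v v x epowr (1/2)"
proof -
  let ?t = "\<lambda>k::int. (x, 2 powi (- k) :: real)"
  have "pairing u v x = (\<integral>\<^sup>+k. ennreal (u (?t k) * u (?t k)) epowr (1/2) * ennreal (v (?t k) * v (?t k)) epowr (1 - 1/2) \<partial>count_space UNIV)"
    unfolding pairing_def using assms
    by (intro nn_integral_cong) (simp add: ennreal_mult epowr_mult epowr_add del: epowr_ennreal)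
  also have "\<dots> \<le> pairing u u x epowr (1/2) * pairing v v x epowr (1 - 1/2)"
    unfolding pairing_def by (intro nn_integral_holder) auto
  finally show ?thesis by simp
qed

locale sequence_side =
  fixes n :: nat and p :: real and \<sigma> :: "point measure" and \<mu> :: "point \<times> real \<Rightarrow> real"
  assumes n: "n \<ge> 1" and p: "p \<ge> 2" and sets_\<sigma>: "sets \<sigma> = sets (Rn n)"
    and \<mu>: "nonneg_meas (\<sigma> \<Otimes>\<^sub>M eta) \<mu>"
    and \<mu>_finite: "\<And>Q. Q \<in> dyadic n \<Longrightarrow> Lq_l2_norm (conj_exp p) \<sigma> (on_box n Q \<mu>) < \<infinity>"
begin

definition r :: real where "r = conj_exp p / 2"

text \<open>The third item is the exponent identity in \<open>J_holder\<close>; the fourth makes the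
  norm power of the test function equal to its own integral in \<open>K_phi\<close>.\<close>

lemma r: "1/2 < r" "r \<le> 1" "r * (1 - 1/p) = 1/2" "(2 * r - 1) * (p/2) = r"
  using p unfolding r_def conj_exp_def by (auto simp: field_simps)

definition sq :: "point set \<Rightarrow> point \<Rightarrow> ennreal" where
  "sq Q x = pairing (on_box n Q \<mu>) (on_box n Q \<mu>) x"

lemma space_pair: "x \<in> space \<sigma> \<Longrightarrow> (x, 2 powi k) \<in> space (\<sigma> \<Otimes>\<^sub>M eta)"
  by (simp add: space_pair_measure space_eta)

lemma meas_section: "h \<in> borel_measurable (\<sigma> \<Otimes>\<^sub>M eta) \<Longrightarrow> (\<lambda>x. h (x, 2 powi k)) \<in> borel_measurable \<sigma>"
  by (rule measurable_compose[of "\<lambda>x. (x, 2 powi k)" \<sigma> "\<sigma> \<Otimes>\<^sub>M eta"]) (auto simp: space_eta)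

lemma nonneg_section: "nonneg_meas (\<sigma> \<Otimes>\<^sub>M eta) h \<Longrightarrow> x \<in> space \<sigma> \<Longrightarrow> 0 \<le> h (x, 2 powi k)"
  by (rule nonneg_measD(2)[OF _ space_pair])

lemma box_sets: "Q \<in> dyadic n \<Longrightarrow> carleson_box n Q \<in> sets (\<sigma> \<Otimes>\<^sub>M eta)"
  by (rule carleson_box_sets[OF sets_\<sigma>])

lemma on_box: "Q \<in> dyadic n \<Longrightarrow> nonneg_meas (\<sigma> \<Otimes>\<^sub>M eta) (on_box n Q \<mu>)"
  unfolding on_box_def using \<mu> box_sets by (intro nonneg_meas_mult nonneg_meas_indicator) auto

lemma measurable_pairing [measurable]:
  assumes "nonneg_meas (\<sigma> \<Otimes>\<^sub>M eta) u" "nonneg_meas (\<sigma> \<Otimes>\<^sub>M eta) v"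
  shows "pairing u v \<in> borel_measurable \<sigma>"
proof -
  note [measurable] = meas_section[OF nonneg_measD(1)[OF assms(1)]] meas_section[OF nonneg_measD(1)[OF assms(2)]]
  show ?thesis unfolding pairing_def by measurable
qed

lemma measurable_sq [measurable]: "Q \<in> dyadic n \<Longrightarrow> sq Q \<in> borel_measurable \<sigma>"
  unfolding sq_def[abs_def] by (intro measurable_pairing on_box)

text \<open>\<open>eta\<close> is the image of counting measure under powers of 2, so the integral
  in \<open>t\<close> is a sum over scales.\<close>

lemma box_integral:
  assumes "nonneg_meas (\<sigma> \<Otimes>\<^sub>M eta) f" "Q \<in> dyadic n" "x \<in> space \<sigma>"
  shows "(\<integral>\<^sup>+t. ennreal (f (x, t) * \<mu> (x, t)) * indicator (carleson_box n Q) (x, t) \<partial>eta) = pairing f (on_box n Q \<mu>) x"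
proof -
  let ?g = "\<lambda>t. ennreal (f (x, t) * \<mu> (x, t)) * indicator (carleson_box n Q) (x, t)"
  have Pair: "Pair x \<in> eta \<rightarrow>\<^sub>M \<sigma> \<Otimes>\<^sub>M eta" using assms(3) by (rule measurable_Pair1')
  note [measurable] = measurable_compose[OF Pair nonneg_measD(1)[OF assms(1)]]
    measurable_compose[OF Pair nonneg_measD(1)[OF \<mu>]]
  have [measurable]: "(\<lambda>t. indicator (carleson_box n Q) (x, t) :: ennreal) \<in> borel_measurable eta"
    by (rule measurable_compose[OF Pair borel_measurable_indicator[OF box_sets[OF assms(2)]]])
  have meas: "?g \<in> borel_measurable eta" by measurable
  have "(\<integral>\<^sup>+t. ?g t \<partial>eta) = (\<integral>\<^sup>+k. ?g (2 powi k) \<partial>count_space UNIV)"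
    unfolding eta_def using meas
    by (subst nn_integral_distr) (auto simp: eta_def space_restrict_space)
  \<comment> \<open>Reflection of the index, since the \<open>k\<close>-th function of a sequence
    sits at height \<open>2 powi (- k)\<close>.\<close>
  also have "\<dots> = (\<integral>\<^sup>+k. ?g (2 powi (- k)) \<partial>count_space UNIV)"
    by (rule nn_integral_bij_count_space[symmetric]) (auto simp: bij_uminus)
  also have "\<dots> = pairing f (on_box n Q \<mu>) x"
    unfolding pairing_def on_box_def by (intro nn_integral_cong) (auto simp: indicator_def)
  finally show ?thesis .
qed

definition J :: "(point \<times> real \<Rightarrow> real) \<Rightarrow> point set \<Rightarrow> ennreal" where
  "J f Q = (\<integral>\<^sup>+x. (\<integral>\<^sup>+t. ennreal (f (x, t) * \<mu> (x, t)) * indicator (carleson_box n Q) (x, t) \<partial>eta) \<partial>\<sigma>)"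

definition K :: "(point \<times> real \<Rightarrow> real) \<Rightarrow> ennreal" where
  "K f = (\<integral>\<^sup>+x. l2 f x epowr p \<partial>\<sigma>)"

lemma J_eq:
  assumes "nonneg_meas (\<sigma> \<Otimes>\<^sub>M eta) f" "Q \<in> dyadic n"
  shows "J f Q = (\<integral>\<^sup>+x. pairing f (on_box n Q \<mu>) x \<partial>\<sigma>)"
  unfolding J_def using assms by (intro nn_integral_cong box_integral)

lemma K_eq: "K f = (\<integral>\<^sup>+x. pairing f f x epowr (p/2) \<partial>\<sigma>)"
  unfolding K_def l2_eq_pairing using p by (simp add: epowr_epowr)

lemma on_box_eq: "x \<notin> Q \<Longrightarrow> on_box n Q \<mu> (x, t) = 0"
  unfolding on_box_def carleson_box_def by simp

lemma sq_outside: "x \<notin> Q \<Longrightarrow> sq Q x = 0"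
  unfolding sq_def by (rule pairing_zero) (simp add: on_box_eq)

lemma on_box_mult:
  assumes "Q \<in> dyadic n" "R \<in> dyadic n" "R \<subseteq> Q"
  shows "on_box n Q \<mu> z * on_box n R \<mu> z = on_box n R \<mu> z * on_box n R \<mu> z"
  using carleson_box_mono[OF n assms(2,1,3)] unfolding on_box_def by (auto simp: indicator_def)

lemma sq_mono:
  assumes "Q \<in> dyadic n" "R \<in> dyadic n" "R \<subseteq> Q"
  shows "sq R x \<le> sq Q x"
  unfolding sq_def using carleson_box_mono[OF n assms(2,1,3)]
  by (intro pairing_mono) (auto simp: on_box_def indicator_def)

lemma sq_powr_finite:
  assumes "Q \<in> dyadic n" shows "(\<integral>\<^sup>+x. sq Q x epowr r \<partial>\<sigma>) < top"
proof -
  have "0 < conj_exp p" using r unfolding r_def by simp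
  then show ?thesis
    using \<mu>_finite[OF assms] unfolding Lq_l2_norm_def l2_eq_pairing sq_def[symmetric] r_def
    by (simp add: epowr_epowr)
qed

lemma AE_sq_finite:
  assumes "Q \<in> dyadic n" shows "AE x in \<sigma>. sq Q x < top"
proof -
  have "AE x in \<sigma>. sq Q x epowr r \<noteq> \<infinity>"
    using sq_powr_finite[OF assms] assms by (intro nn_integral_PInf_AE) auto
  then show ?thesis by (auto simp: less_top)
qed

text \<open>The factor in \<open>\<phi>\<^sub>Q\<close>: since \<open>sq\<close> is the square of the norm, the exponent \<open>p' - 2\<close> is halved.\<close>

definition factor :: "point set \<Rightarrow> point \<Rightarrow> real" where
  "factor Q x = (if sq Q x \<in> {0, \<infinity>} then 0 else enn2real (sq Q x) powr (r - 1))"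

lemma phi_eq: "phi n p \<mu> Q (x, t) = factor Q x * on_box n Q \<mu> (x, t)"
proof -
  have "enn2real (sq Q x epowr (1/2)) powr (conj_exp p - 2) = enn2real (sq Q x) powr (r - 1)" if "sq Q x \<noteq> \<infinity>"
    using that by (simp add: enn2real_epowr less_top powr_powr r_def diff_divide_distrib)
  then show ?thesis
    unfolding phi_def l2_eq_pairing sq_def[symmetric] factor_def by auto
qed

lemma factor_nonneg: "0 \<le> factor Q x"
  unfolding factor_def by simp

lemma measurable_factor [measurable]: "Q \<in> dyadic n \<Longrightarrow> factor Q \<in> borel_measurable \<sigma>"
  unfolding factor_def[abs_def] by measurable

lemma phi_meas: "Q \<in> dyadic n \<Longrightarrow> nonneg_meas (\<sigma> \<Otimes>\<^sub>M eta) (phi n p \<mu> Q)"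
proof -
  assume Q: "Q \<in> dyadic n"
  have "phi n p \<mu> Q = (\<lambda>z. factor Q (fst z) * on_box n Q \<mu> z)" using phi_eq by auto
  moreover have "nonneg_meas (\<sigma> \<Otimes>\<^sub>M eta) (\<lambda>z. factor Q (fst z))"
    unfolding nonneg_meas_def using factor_nonneg measurable_factor[OF Q] by auto
  ultimately show ?thesis using nonneg_meas_mult on_box[OF Q] by simp
qed

section \<open>Integrals and norms of the test functions\<close>

lemma pairing_phi:
  assumes "Q \<in> dyadic n" "R \<in> dyadic n" "R \<subseteq> Q"
  shows "pairing (phi n p \<mu> Q) (on_box n R \<mu>) x = ennreal (factor Q x) * sq R x"
  unfolding sq_def using on_box_mult[OF assms]
  by (intro pairing_scale factor_nonneg) (simp add: phi_eq mult.assoc)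

lemma J_phi:
  assumes "Q \<in> dyadic n" "R \<in> dyadic n" "R \<subseteq> Q"
  shows "J (phi n p \<mu> Q) R = (\<integral>\<^sup>+x. ennreal (factor Q x) * sq R x \<partial>\<sigma>)"
  using J_eq[OF phi_meas assms(2)] assms by (simp add: pairing_phi)

lemma factor_sq:
  assumes "sq Q x < top" shows "ennreal (factor Q x) * sq Q x = sq Q x epowr r"
proof (cases "sq Q x = 0")
  case False
  then obtain a where a: "sq Q x = ennreal a" "0 < a"
    using assms by (cases "sq Q x") (auto simp: less_le)
  then have "factor Q x = a powr (r - 1)" unfolding factor_def by simp
  moreover have "a powr (r - 1) * a = a powr r" using a(2) by (simp add: powr_mult_base mult.commute)
  ultimately show ?thesis using a by (simp flip: ennreal_mult)
qed simp

text \<open>Where \<open>sq\<close> is finite this is \<open>factor_sq\<close>. The set where it is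
  infinite, on which \<open>factor\<close> is 0 by convention, is null.\<close>

lemma J_phi_self:
  assumes "Q \<in> dyadic n" shows "J (phi n p \<mu> Q) Q = (\<integral>\<^sup>+x. sq Q x epowr r \<partial>\<sigma>)"
  unfolding J_phi[OF assms assms subset_refl]
  using AE_sq_finite[OF assms] by (intro nn_integral_cong_AE) (auto simp: factor_sq)

text \<open>The squared sequence norm of the test function is \<open>factor\<close> squared times
  \<open>sq\<close>, that is \<open>sq\<close> to the power \<open>2 * r - 1\<close>, and the
  further power \<open>p/2\<close> turns the exponent into \<open>r\<close>.\<close>

lemma K_phi:
  assumes "Q \<in> dyadic n" shows "K (phi n p \<mu> Q) = (\<integral>\<^sup>+x. sq Q x epowr r \<partial>\<sigma>)"
  unfolding K_eq
proof (intro nn_integral_cong_AE)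
  have "pairing (phi n p \<mu> Q) (phi n p \<mu> Q) x epowr (p/2) = sq Q x epowr r" if fin: "sq Q x < top" for x
  proof (cases "sq Q x = 0")
    case True
    have "pairing (phi n p \<mu> Q) (phi n p \<mu> Q) x = 0"
      by (rule pairing_zero) (simp add: phi_eq factor_def True)
    then show ?thesis using True by simp
  next
    case False
    then obtain a where a: "sq Q x = ennreal a" "0 < a"
      using fin by (cases "sq Q x") (auto simp: less_le)
    then have "factor Q x = a powr (r - 1)" unfolding factor_def by simp
    then have "(factor Q x)\<^sup>2 * a = a powr (2 * r - 2) * a powr 1"
      using a(2) by (simp add: power2_eq_square powr_add[symmetric])
    also have "\<dots> = a powr (2 * r - 1)" by (simp only: powr_add[symmetric]) simp
    finally have c: "(factor Q x)\<^sup>2 * a = a powr (2 * r - 1)" .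
    have "pairing (phi n p \<mu> Q) (phi n p \<mu> Q) x = ennreal ((factor Q x)\<^sup>2) * sq Q x"
      unfolding sq_def by (intro pairing_scale) (auto simp: phi_eq power2_eq_square)
    also have "\<dots> = ennreal (a powr (2 * r - 1))" using a c by (simp flip: ennreal_mult)
    finally show ?thesis using a r(4) by (simp add: powr_powr)
  qed
  then show "AE x in \<sigma>. pairing (phi n p \<mu> Q) (phi n p \<mu> Q) x epowr (p/2) = sq Q x epowr r"
    using AE_sq_finite[OF assms] by auto
qed

text \<open>At each \<open>x\<close> at most one cube \<open>R\<close> matters, and there
  \<open>sq R\<close> to the power \<open>r\<close> is at most a geometric mean of the densities of
  the two masses on the right. The Cauchy-Schwarz inequality integrates this bound.\<close>

lemma J_phi_packing:
  assumes Q: "Q \<in> dyadic n" and \<R>: "finite \<R>" "\<R> \<subseteq> {R \<in> dyadic n. R \<subseteq> Q}" "disjoint \<R>"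
  shows "(\<Sum>R\<in>\<R>. J (phi n p \<mu> R) R) \<le> (\<Sum>R\<in>\<R>. J (phi n p \<mu> Q) R) epowr (1/2) * J (phi n p \<mu> Q) Q epowr (1/2)"
proof -
  have RD: "R \<in> dyadic n" "R \<subseteq> Q" if "R \<in> \<R>" for R using \<R>(2) that by auto
  note [measurable] = RD(1) Q
  have "(\<Sum>R\<in>\<R>. J (phi n p \<mu> R) R) = (\<integral>\<^sup>+x. (\<Sum>R\<in>\<R>. sq R x epowr r) \<partial>\<sigma>)"
    using RD by (subst nn_integral_sum) (auto simp: J_phi_self)
  also have "\<dots> \<le> (\<integral>\<^sup>+x. (\<Sum>R\<in>\<R>. ennreal (factor Q x) * sq R x) epowr (1/2) * (sq Q x epowr r) epowr (1 - 1/2) \<partial>\<sigma>)"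
  proof (intro nn_integral_mono_AE)
    have "(\<Sum>R\<in>\<R>. sq R x epowr r) \<le> (\<Sum>R\<in>\<R>. ennreal (factor Q x) * sq R x) epowr (1/2) * (sq Q x epowr r) epowr (1 - 1/2)"
      if fin: "sq Q x < top" for x
      using disjoint_at_most_one[OF \<R>(3), of x]
    proof cases
      case 1
      then show ?thesis by (simp add: sq_outside)
    next
      case (2 R)
      have eq: "(\<Sum>R\<in>\<R>. sq R x epowr r) = sq R x epowr r"
        "(\<Sum>R\<in>\<R>. ennreal (factor Q x) * sq R x) = ennreal (factor Q x) * sq R x"
        by (intro sum_eq_single; use \<R>(1) 2 in \<open>simp add: sq_outside\<close>)+
      have le: "sq R x \<le> sq Q x" using RD[OF 2(1)] Q by (intro sq_mono)
      have "sq R x epowr r \<le> (ennreal (factor Q x) * sq R x) epowr (1/2) * (sq Q x epowr r) epowr (1/2)"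
      proof (cases "sq R x = 0")
        case False
        then have "sq Q x \<noteq> 0" using le by auto
        then obtain b where b: "sq Q x = ennreal b" "0 < b"
          using fin by (cases "sq Q x") (auto simp: less_le)
        obtain a where a: "sq R x = ennreal a" "0 < a" "a \<le> b"
          using le \<open>sq R x \<noteq> 0\<close> b by (cases "sq R x") (auto simp: less_le top_unique)
        have factor: "factor Q x = b powr (r - 1)" unfolding factor_def using b by simp
        \<comment> \<open>As \<open>a\<close> is at most \<open>b\<close> and
          \<open>r > 1/2\<close>, the surplus power \<open>r - 1/2\<close> of \<open>a\<close> may
          be traded for the same power of \<open>b\<close>.\<close>
        have "a powr r = a powr (1/2) * a powr (r - 1/2)" by (simp add: powr_add[symmetric])
        also have "\<dots> \<le> a powr (1/2) * b powr (r - 1/2)"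
          using a r by (intro mult_left_mono powr_mono2) auto
        also have "b powr (r - 1/2) = b powr ((r - 1) * (1/2)) * b powr (r * (1/2))"
          by (simp only: powr_add[symmetric]) (simp add: field_simps)
        also have "a powr (1/2) * \<dots> = (b powr (r - 1) * a) powr (1/2) * (b powr r) powr (1/2)"
          using a b by (simp add: powr_mult powr_powr mult_ac)
        finally show ?thesis
          unfolding a(1) b(1) factor using a(2) b(2)
          by (simp flip: ennreal_mult)
      qed simp
      then show ?thesis unfolding eq by simp
    qed
    then show "AE x in \<sigma>. (\<Sum>R\<in>\<R>. sq R x epowr r) \<le>
        (\<Sum>R\<in>\<R>. ennreal (factor Q x) * sq R x) epowr (1/2) * (sq Q x epowr r) epowr (1 - 1/2)"
      using AE_sq_finite[OF Q] by auto
  qed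
  also have "\<dots> \<le> (\<integral>\<^sup>+x. (\<Sum>R\<in>\<R>. ennreal (factor Q x) * sq R x) \<partial>\<sigma>) epowr (1/2) * (\<integral>\<^sup>+x. sq Q x epowr r \<partial>\<sigma>) epowr (1 - 1/2)"
    by (intro nn_integral_holder) auto
  also have "(\<integral>\<^sup>+x. (\<Sum>R\<in>\<R>. ennreal (factor Q x) * sq R x) \<partial>\<sigma>) = (\<Sum>R\<in>\<R>. J (phi n p \<mu> Q) R)"
    using RD Q by (subst nn_integral_sum) (auto simp: J_phi)
  also have "(\<integral>\<^sup>+x. sq Q x epowr r \<partial>\<sigma>) = J (phi n p \<mu> Q) Q" using J_phi_self[OF Q] by simp
  finally show ?thesis by simp
qed

text \<open>The Cauchy-Schwarz inequality over the scales at fixed \<open>x\<close>, followed by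
  Hoelder's inequality in \<open>x\<close>.\<close>

lemma J_holder:
  assumes u: "nonneg_meas (\<sigma> \<Otimes>\<^sub>M eta) u" and Q: "Q \<in> dyadic n"
  shows "J u Q \<le> K u epowr (1/p) * J (phi n p \<mu> Q) Q epowr (1 - 1/p)"
proof -
  note [measurable] = Q measurable_pairing[OF u u]
  have "J u Q \<le> (\<integral>\<^sup>+x. (pairing u u x epowr (p/2)) epowr (1/p) * (sq Q x epowr r) epowr (1 - 1/p) \<partial>\<sigma>)"
    unfolding J_eq[OF u Q]
  proof (intro nn_integral_mono)
    fix x assume x: "x \<in> space \<sigma>"
    have "pairing u (on_box n Q \<mu>) x \<le> pairing u u x epowr (1/2) * sq Q x epowr (1/2)"
      unfolding sq_def using nonneg_section[OF u x] nonneg_section[OF on_box[OF Q] x]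
      by (intro pairing_cauchy_schwarz)
    then show "pairing u (on_box n Q \<mu>) x \<le> (pairing u u x epowr (p/2)) epowr (1/p) * (sq Q x epowr r) epowr (1 - 1/p)"
      using p r(1) by (simp add: epowr_epowr r(3))
  qed
  also have "\<dots> \<le> (\<integral>\<^sup>+x. pairing u u x epowr (p/2) \<partial>\<sigma>) epowr (1/p) * (\<integral>\<^sup>+x. sq Q x epowr r \<partial>\<sigma>) epowr (1 - 1/p)"
    using p by (intro nn_integral_holder) auto
  finally show ?thesis unfolding K_eq J_phi_self[OF Q] .
qed

section \<open>Additivity and splitting of the mixed norm\<close>

lemma box_in_space: "Q \<in> dyadic n \<Longrightarrow> z \<in> carleson_box n Q \<Longrightarrow> z \<in> space (\<sigma> \<Otimes>\<^sub>M eta)"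
  using sets.sets_into_space[OF box_sets] by blast

lemma pairing_add:
  assumes "nonneg_meas (\<sigma> \<Otimes>\<^sub>M eta) u" "nonneg_meas (\<sigma> \<Otimes>\<^sub>M eta) v" "nonneg_meas (\<sigma> \<Otimes>\<^sub>M eta) w" "x \<in> space \<sigma>"
  shows "pairing (\<lambda>z. u z + v z) w x = pairing u w x + pairing v w x"
  unfolding pairing_def using nonneg_section[OF assms(1,4)] nonneg_section[OF assms(2,4)] nonneg_section[OF assms(3,4)]
  by (subst nn_integral_add[symmetric]) (auto intro!: nn_integral_cong simp: distrib_right)

lemma K_add:
  assumes u: "nonneg_meas (\<sigma> \<Otimes>\<^sub>M eta) u" and v: "nonneg_meas (\<sigma> \<Otimes>\<^sub>M eta) v"
  shows "K (\<lambda>z. u z + v z) \<le> ennreal (2 powr p) * (K u + K v)"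
proof -
  note [measurable] = measurable_pairing[OF u u] measurable_pairing[OF v v]
  have "pairing (\<lambda>z. u z + v z) (\<lambda>z. u z + v z) x epowr (p/2) \<le>
      ennreal (2 powr p) * (pairing u u x epowr (p/2) + pairing v v x epowr (p/2))" for x
  proof -
    have sq_le: "(a + b) * (a + b) \<le> 2 * (a * a + b * b)" for a b :: real
      using sum_squares_bound[of a b] by (simp add: power2_eq_square algebra_simps)
    have "pairing (\<lambda>z. u z + v z) (\<lambda>z. u z + v z) x \<le>
      (\<integral>\<^sup>+k. ennreal (2 * (u (x, 2 powi (- k)) * u (x, 2 powi (- k)) + v (x, 2 powi (- k)) * v (x, 2 powi (- k)))) \<partial>count_space UNIV)"
      unfolding pairing_def by (intro nn_integral_mono ennreal_leI sq_le)
    also have "\<dots> = 2 * (pairing u u x + pairing v v x)"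
      unfolding pairing_def
      by (simp add: ennreal_mult ennreal_plus nn_integral_cmult nn_integral_add del: ennreal_plus_if)
    finally have "pairing (\<lambda>z. u z + v z) (\<lambda>z. u z + v z) x epowr (p/2) \<le> (2 * (pairing u u x + pairing v v x)) epowr (p/2)"
      using p by (intro epowr_mono) auto
    also have "\<dots> \<le> ennreal (4 powr (p/2)) * (pairing u u x epowr (p/2) + pairing v v x epowr (p/2))"
      using p by (intro epowr_quasi_triangle) auto
    also have "(4::real) powr (p/2) = (2 powr 2) powr (p/2)" by simp
    also have "\<dots> = 2 powr p" by (simp only: powr_powr) simp
    finally show ?thesis .
  qed
  then have "K (\<lambda>z. u z + v z) \<le>
      (\<integral>\<^sup>+x. ennreal (2 powr p) * (pairing u u x epowr (p/2) + pairing v v x epowr (p/2)) \<partial>\<sigma>)"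
    unfolding K_eq by (intro nn_integral_mono)
  also have "\<dots> = ennreal (2 powr p) * (K u + K v)"
    unfolding K_eq by (simp add: nn_integral_cmult nn_integral_add)
  finally show ?thesis .
qed

lemma K_scale:
  assumes u: "nonneg_meas (\<sigma> \<Otimes>\<^sub>M eta) u" and c: "0 \<le> c"
  shows "K (\<lambda>z. c * u z) = ennreal (c powr p) * K u"
proof -
  note [measurable] = measurable_pairing[OF u u]
  have "pairing (\<lambda>z. c * u z) (\<lambda>z. c * u z) x epowr (p/2) = ennreal (c powr p) * pairing u u x epowr (p/2)" for x
  proof -
    have "pairing (\<lambda>z. c * u z) (\<lambda>z. c * u z) x = ennreal (c powr 2) * pairing u u x"
      using c by (intro pairing_scale) (auto simp: power2_eq_square)
    then show ?thesis using p c by (simp add: epowr_mult powr_powr del: powr_numeral)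
  qed
  then show ?thesis unfolding K_eq by (simp add: nn_integral_cmult)
qed

text \<open>The sets may separate different heights over the same \<open>x\<close>, so the squared
  sequence norms of the pieces add up at \<open>x\<close>; since \<open>p/2\<close> is at least 1,
  superadditivity of that power completes the bound.\<close>

lemma K_split:
  assumes u: "nonneg_meas (\<sigma> \<Otimes>\<^sub>M eta) u" and fin: "finite A"
    and E: "\<And>i. i \<in> A \<Longrightarrow> E i \<in> sets (\<sigma> \<Otimes>\<^sub>M eta)" and disj: "disjoint_family_on E A"
  shows "(\<Sum>i\<in>A. K (\<lambda>z. indicator (E i) z * u z)) \<le> K u"
proof -
  let ?v = "\<lambda>i z. indicator (E i) z * u z"
  have v: "nonneg_meas (\<sigma> \<Otimes>\<^sub>M eta) (?v i)" if "i \<in> A" for i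
    using E[OF that] u by (intro nonneg_meas_mult nonneg_meas_indicator)
  note [measurable] = measurable_pairing[OF v v]
  have "(\<Sum>i\<in>A. K (?v i)) = (\<integral>\<^sup>+x. (\<Sum>i\<in>A. pairing (?v i) (?v i) x epowr (p/2)) \<partial>\<sigma>)"
    unfolding K_eq by (intro nn_integral_sum[symmetric]) auto
  also have "\<dots> \<le> K u"
    unfolding K_eq
  proof (intro nn_integral_mono)
    fix x
    have "(\<Sum>i\<in>A. pairing (?v i) (?v i) x epowr (p/2)) \<le> (\<Sum>i\<in>A. pairing (?v i) (?v i) x) epowr (p/2)"
      using p by (intro sum_epowr_le) auto
    also have "(\<Sum>i\<in>A. pairing (?v i) (?v i) x) =
       (\<integral>\<^sup>+k. (\<Sum>i\<in>A. ennreal (?v i (x, 2 powi (- k)) * ?v i (x, 2 powi (- k)))) \<partial>count_space UNIV)"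
      unfolding pairing_def by (intro nn_integral_sum[symmetric]) auto
    also have "\<dots> \<le> pairing u u x"
      unfolding pairing_def
    proof (intro nn_integral_mono)
      fix k :: int
      let ?z = "(x, 2 powi (- k) :: real)"
      have "(\<Sum>i\<in>A. ennreal (?v i ?z * ?v i ?z)) = (\<Sum>i\<in>A. indicator (E i) ?z * ennreal (u ?z * u ?z))"
        by (intro sum.cong) (auto simp: indicator_def)
      also have "\<dots> = indicator (\<Union>(E ` A)) ?z * ennreal (u ?z * u ?z)"
        using fin disj by (simp add: sum_distrib_right[symmetric] indicator_UN_disjoint)
      also have "\<dots> \<le> ennreal (u ?z * u ?z)" by (auto simp: indicator_def)
      finally show "(\<Sum>i\<in>A. ennreal (?v i ?z * ?v i ?z)) \<le> ennreal (u ?z * u ?z)" .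
    qed
    finally show "(\<Sum>i\<in>A. pairing (?v i) (?v i) x epowr (p/2)) \<le> pairing u u x epowr (p/2)"
      using p by (simp add: epowr_mono)
  qed
  finally show ?thesis .
qed

text \<open>Boxes over disjoint cubes do not share any \<open>x\<close>, so the whole sequence at
  \<open>x\<close> comes from a single term.\<close>

lemma K_disjoint:
  assumes \<R>: "finite \<R>" "\<R> \<subseteq> dyadic n" "disjoint \<R>" and w: "\<And>R. R \<in> \<R> \<Longrightarrow> nonneg_meas (\<sigma> \<Otimes>\<^sub>M eta) (w R)"
  shows "K (\<lambda>z. \<Sum>R\<in>\<R>. indicator (carleson_box n R) z * w R z) \<le>
    (\<Sum>R\<in>\<R>. K (\<lambda>z. indicator (carleson_box n R) z * w R z))"
proof -
  let ?v = "\<lambda>R z. indicator (carleson_box n R) z * w R z"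
  let ?s = "\<lambda>z. \<Sum>R\<in>\<R>. ?v R z"
  have v: "nonneg_meas (\<sigma> \<Otimes>\<^sub>M eta) (?v R)" if "R \<in> \<R>" for R
    using box_sets w that \<R>(2) by (intro nonneg_meas_mult nonneg_meas_indicator) auto
  note [measurable] = measurable_pairing[OF v v]
  have "K ?s \<le> (\<integral>\<^sup>+x. (\<Sum>R\<in>\<R>. pairing (?v R) (?v R) x epowr (p/2)) \<partial>\<sigma>)"
    unfolding K_eq
  proof (intro nn_integral_mono)
    fix x
    show "pairing ?s ?s x epowr (p/2) \<le> (\<Sum>R\<in>\<R>. pairing (?v R) (?v R) x epowr (p/2))"
      using disjoint_at_most_one[OF \<R>(3), of x]
    proof cases
      case 1
      then have "pairing ?s ?s x = 0"
        by (intro pairing_zero) (simp add: carleson_box_def)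
      then show ?thesis by simp
    next
      case (2 R)
      have "?s (x, t) = ?v R (x, t)" for t
        by (intro sum_eq_single; use \<R>(1) 2 in \<open>simp add: carleson_box_def\<close>)
      then have "pairing ?s ?s x = pairing (?v R) (?v R) x"
        unfolding pairing_def by simp
      moreover have "pairing (?v R) (?v R) x epowr (p/2) \<le> (\<Sum>R\<in>\<R>. pairing (?v R) (?v R) x epowr (p/2))"
        using \<R>(1) 2(1) by (intro member_le_sum) auto
      ultimately show ?thesis by (simp only:)
    qed
  qed
  also have "\<dots> = (\<Sum>R\<in>\<R>. K (?v R))"
    unfolding K_eq by (intro nn_integral_sum) auto
  finally show ?thesis .
qed

lemma ennreal_side: "ennreal_side p (dyadic n) (carleson_box n) (\<sigma> \<Otimes>\<^sub>M eta)
  {h. nonneg_meas (\<sigma> \<Otimes>\<^sub>M eta) h} J K (phi n p \<mu>)"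
proof
  show "1 < p" using p by simp
  show "laminar (dyadic n)" by (rule laminar_dyadic)
next
  fix u v Q assume "u \<in> {h. nonneg_meas (\<sigma> \<Otimes>\<^sub>M eta) h}" "v \<in> {h. nonneg_meas (\<sigma> \<Otimes>\<^sub>M eta) h}" and Q: "Q \<in> dyadic n"
  then have u: "nonneg_meas (\<sigma> \<Otimes>\<^sub>M eta) u" and v: "nonneg_meas (\<sigma> \<Otimes>\<^sub>M eta) v" by auto
  note [measurable] = measurable_pairing[OF u on_box[OF Q]] measurable_pairing[OF v on_box[OF Q]]
  have "J (\<lambda>z. u z + v z) Q = (\<integral>\<^sup>+x. pairing u (on_box n Q \<mu>) x + pairing v (on_box n Q \<mu>) x \<partial>\<sigma>)"
    unfolding J_eq[OF nonneg_meas_add[OF u v] Q] using pairing_add[OF u v on_box[OF Q]] by (intro nn_integral_cong)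
  then show "J (\<lambda>z. u z + v z) Q = J u Q + J v Q"
    unfolding J_eq[OF u Q] J_eq[OF v Q] by (simp add: nn_integral_add)
  show "J u Q \<le> J v Q" if le: "\<And>z. z \<in> carleson_box n Q \<Longrightarrow> u z \<le> v z"
    unfolding J_eq[OF u Q] J_eq[OF v Q]
  proof (intro nn_integral_mono pairing_mono)
    fix x k assume "x \<in> space \<sigma>"
    then have "0 \<le> \<mu> (x, 2 powi (- k))" by (rule nonneg_section[OF \<mu>])
    then show "u (x, 2 powi (- k)) * on_box n Q \<mu> (x, 2 powi (- k)) \<le> v (x, 2 powi (- k)) * on_box n Q \<mu> (x, 2 powi (- k))"
      using le[of "(x, 2 powi (- k))"] unfolding on_box_def by (auto simp: indicator_def intro: mult_right_mono)
  qed
next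
  fix u c Q assume "u \<in> {h. nonneg_meas (\<sigma> \<Otimes>\<^sub>M eta) h}" and c: "0 \<le> (c::real)" and Q: "Q \<in> dyadic n"
  then have u: "nonneg_meas (\<sigma> \<Otimes>\<^sub>M eta) u" by auto
  note [measurable] = measurable_pairing[OF u on_box[OF Q]]
  have "J (\<lambda>z. c * u z) Q = (\<integral>\<^sup>+x. ennreal c * pairing u (on_box n Q \<mu>) x \<partial>\<sigma>)"
    unfolding J_eq[OF nonneg_meas_scale[OF u c] Q] using c by (intro nn_integral_cong pairing_scale) auto
  then show "J (\<lambda>z. c * u z) Q = ennreal c * J u Q"
    unfolding J_eq[OF u Q] by (simp add: nn_integral_cmult)
next
  fix u Q R assume "u \<in> {h. nonneg_meas (\<sigma> \<Otimes>\<^sub>M eta) h}" and Q: "Q \<in> dyadic n" "R \<in> dyadic n" "R \<subseteq> Q"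
  then show "J (\<lambda>z. indicator (carleson_box n R) z * u z) Q = J u R"
    unfolding J_def using carleson_box_mono[OF n Q(2,1,3)]
    by (intro nn_integral_cong) (auto simp: indicator_def)
next
  fix h Q z assume "h \<in> {h. nonneg_meas (\<sigma> \<Otimes>\<^sub>M eta) h}" and Q: "Q \<in> dyadic n" "z \<in> carleson_box n Q"
  then show "0 \<le> h z" using nonneg_measD(2)[of _ h z] box_in_space by simp
next
  fix Q R assume "Q \<in> dyadic n" "R \<in> dyadic n" "Q \<inter> R = {}"
  then show "carleson_box n Q \<inter> carleson_box n R = {}" unfolding carleson_box_def by blast
next
  fix \<R> and w :: "point set \<Rightarrow> point \<times> real \<Rightarrow> real"
  assume "finite \<R>" "\<R> \<subseteq> dyadic n" "disjoint \<R>" "\<And>R. R \<in> \<R> \<Longrightarrow> w R \<in> {h. nonneg_meas (\<sigma> \<Otimes>\<^sub>M eta) h}"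
  then show "K (\<lambda>z. \<Sum>R\<in>\<R>. indicator (carleson_box n R) z * w R z) \<le> (\<Sum>R\<in>\<R>. K (\<lambda>z. indicator (carleson_box n R) z * w R z))"
    by (intro K_disjoint) auto
next
  fix Q assume Q: "Q \<in> dyadic n"
  show "J (phi n p \<mu> Q) Q < top" using J_phi_self[OF Q] sq_powr_finite[OF Q] by simp
  show "K (phi n p \<mu> Q) = J (phi n p \<mu> Q) Q" using J_phi_self[OF Q] K_phi[OF Q] by simp
qed (simp_all add: box_sets carleson_box_mono[OF n] nonneg_meas_add nonneg_meas_scale nonneg_meas_mult
  nonneg_meas_indicator K_add K_scale K_split J_holder phi_meas J_phi_packing)

end

section \<open>The two weight inequality\<close>

lemma half_const_pos: "1 < p \<Longrightarrow> 1 < q \<Longrightarrow> 0 < half_const p q"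
proof -
  have pos: "0 < carleson_const p" if "1 < p" for p
    unfolding carleson_const_def using that powr_less_mono2[of "p - 1" "3/4" 1] by simp
  assume "1 < p" "1 < q"
  then have c: "0 < carleson_const p" "0 < carleson_const q" using pos by auto
  then have "0 < 2 powr q * (1 + 2 * 4 powr q * carleson_const q)"
    by (intro mult_pos_pos add_pos_pos) auto
  then have "0 < (2 powr q * (1 + 2 * 4 powr q * carleson_const q)) powr (1/q)"
    unfolding powr_gt_zero by (rule less_imp_neq[symmetric])
  with c(1) show ?thesis
    unfolding half_const_def by simp
qed

text \<open>Supplies an admissible constant arbitrarily close to the infimum, so that attainment
  does not have to be established.\<close>

lemma Inf_ennreal_approx:
  assumes "Inf S < (\<infinity>::ennreal)" "0 < e"
  obtains C where "C \<in> S" "C \<le> ennreal (enn2real (Inf S) + e)"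
proof -
  have "Inf S < Inf S + ennreal e"
    using assms by (cases "Inf S") (auto simp flip: ennreal_plus intro!: ennreal_lessI)
  also have "Inf S + ennreal e = ennreal (enn2real (Inf S) + e)"
    using assms by (cases "Inf S") auto
  finally show thesis using that by (auto simp: Inf_less_iff intro: less_imp_le)
qed

locale two_weight = sequence_side +
  fixes \<omega> :: "point measure" and lam :: "point set \<Rightarrow> real"
  assumes \<omega>: "locally_finite_borel n \<omega>" and lam: "\<And>Q. Q \<in> dyadic n \<Longrightarrow> 0 \<le> lam Q"
begin

abbreviation "q \<equiv> conj_exp p"

lemma q: "1 < q" "1/p + 1/q = 1"
  using p unfolding conj_exp_def by (auto simp: field_simps)

abbreviation "J' g Q \<equiv> \<integral>\<^sup>+x\<in>Q. ennreal (g x) \<partial>\<omega>"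
abbreviation "K' g \<equiv> \<integral>\<^sup>+x. ennreal (\<bar>g x\<bar> powr q) \<partial>\<omega>"

sublocale f: ennreal_side p "dyadic n" "carleson_box n" "\<sigma> \<Otimes>\<^sub>M eta" "{h. nonneg_meas (\<sigma> \<Otimes>\<^sub>M eta) h}" J K "phi n p \<mu>"
  by (rule ennreal_side)

sublocale g: ennreal_side q "dyadic n" "\<lambda>Q. Q" \<omega> "{g. nonneg_meas \<omega> g}" J' K' indicator
  by (rule scalar_side[OF q(1) \<omega>])

sublocale two_sides p q "dyadic n" "carleson_box n" "\<sigma> \<Otimes>\<^sub>M eta" f.H "\<lambda>h Q. enn2real (J h Q)" "\<lambda>h. enn2real (K h)" "phi n p \<mu>"
  "\<lambda>Q. Q" \<omega> g.H "\<lambda>h Q. enn2real (J' h Q)" "\<lambda>h. enn2real (K' h)" indicator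
  using q by unfold_locales

lemma Lq_l2_norm_eq: "Lq_l2_norm p \<sigma> f = K f epowr (1/p)"
  unfolding Lq_l2_norm_def K_def ..

lemma Lq_norm_eq: "Lq_norm q \<omega> g = K' g epowr (1/q)"
  unfolding Lq_norm_def ..

text \<open>Reduces the form to finite families of cubes, on which stopping families can be
  constructed.\<close>

lemma Lambda_over_eq:
  "Lambda_over n S \<sigma> \<omega> \<mu> lam f g = (SUP \<R>\<in>{\<R>. finite \<R> \<and> \<R> \<subseteq> S}. \<Sum>Q\<in>\<R>. ennreal (lam Q) * J f Q * J' g Q)"
  unfolding Lambda_over_def J_def by (intro nonneg_infsum_complete) auto

lemma sum_le_Lambda_loc:
  assumes "finite \<R>" "\<R> \<subseteq> {Q \<in> dyadic n. Q \<subseteq> P}"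
  shows "(\<Sum>Q\<in>\<R>. ennreal (lam Q) * J f Q * J' g Q) \<le> Lambda_loc n P \<sigma> \<omega> \<mu> lam f g"
  unfolding Lambda_loc_def Lambda_over_eq using assms by (intro SUP_upper) auto

lemma Lambda_loc_le: "Lambda_loc n P \<sigma> \<omega> \<mu> lam f g \<le> Lambda n \<sigma> \<omega> \<mu> lam f g"
  unfolding Lambda_loc_def Lambda_def Lambda_over_eq by (intro SUP_subset_mono) auto

lemma sum_enn2real_eq:
  assumes "f \<in> f.H" "g \<in> g.H" "\<R> \<subseteq> dyadic n"
  shows "ennreal (\<Sum>Q\<in>\<R>. lam Q * enn2real (J f Q) * enn2real (J' g Q)) = (\<Sum>Q\<in>\<R>. ennreal (lam Q) * J f Q * J' g Q)"
proof -
  have "ennreal (\<Sum>Q\<in>\<R>. lam Q * enn2real (J f Q) * enn2real (J' g Q)) =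
      (\<Sum>Q\<in>\<R>. ennreal (lam Q * enn2real (J f Q) * enn2real (J' g Q)))"
    using lam assms(3) by (intro sum_ennreal[symmetric]) auto
  also have "\<dots> = (\<Sum>Q\<in>\<R>. ennreal (lam Q) * J f Q * J' g Q)"
  proof (intro sum.cong refl)
    fix Q assume "Q \<in> \<R>"
    then have Q: "Q \<in> dyadic n" using assms(3) by auto
    show "ennreal (lam Q * enn2real (J f Q) * enn2real (J' g Q)) = ennreal (lam Q) * J f Q * J' g Q"
      using lam[OF Q] f.J_finite[OF assms(1) Q] g.J_finite[OF assms(2) Q] by (simp add: ennreal_mult)
  qed
  finally show ?thesis .
qed

section \<open>Testing constants and the norm of the form\<close>

definition T_admissible :: "ennreal \<Rightarrow> bool" where
  "T_admissible C \<longleftrightarrow> (\<forall>Q\<in>dyadic n. \<forall>g. nonneg_meas \<omega> g \<longrightarrow>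
     Lambda_loc n Q \<sigma> \<omega> \<mu> lam (phi n p \<mu> Q) g \<le> C * Lq_l2_norm p \<sigma> (phi n p \<mu> Q) * Lq_norm q \<omega> g)"

definition T_star_admissible :: "ennreal \<Rightarrow> bool" where
  "T_star_admissible C \<longleftrightarrow> (\<forall>Q\<in>dyadic n. \<forall>f. nonneg_meas (\<sigma> \<Otimes>\<^sub>M eta) f \<longrightarrow>
     Lambda_loc n Q \<sigma> \<omega> \<mu> lam f (indicator Q) \<le> C * Lq_l2_norm p \<sigma> f * Lq_norm q \<omega> (indicator Q))"

lemma T_const_eq: "T_const n p \<sigma> \<omega> \<mu> lam = Inf (Collect T_admissible)"
  unfolding T_const_def T_admissible_def ..

lemma T_star_const_eq: "T_star_const n p \<sigma> \<omega> \<mu> lam = Inf (Collect T_star_admissible)"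
  unfolding T_star_const_def T_star_admissible_def ..

lemma T_admissible_mono: "T_admissible C \<Longrightarrow> C \<le> C' \<Longrightarrow> T_admissible C'"
  unfolding T_admissible_def by (meson mult_right_mono order_trans zero_le)

lemma T_star_admissible_mono: "T_star_admissible C \<Longrightarrow> C \<le> C' \<Longrightarrow> T_star_admissible C'"
  unfolding T_star_admissible_def by (meson mult_right_mono order_trans zero_le)

lemma Lambda_bound_admissible:
  assumes "Lambda_bound n p \<sigma> \<omega> \<mu> lam C"
  shows "T_admissible C" "T_star_admissible C"
  using assms f.test_closed g.test_closed order_trans[OF Lambda_loc_le]
  unfolding Lambda_bound_def T_admissible_def T_star_admissible_def by auto

text \<open>Each finite partial sum is covered by \<open>bilinear_bound\<close>: the cubes inside
  \<open>P\<close> form part of the local form at \<open>P\<close>, so the admissible constants give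
  its two testing hypotheses.\<close>

lemma Lambda_le_of_finite:
  assumes f: "f \<in> f.H" and g: "g \<in> g.H" and T: "0 \<le> T" "0 \<le> T'"
    and adm: "T_admissible (ennreal T)" "T_star_admissible (ennreal T')"
  shows "Lambda n \<sigma> \<omega> \<mu> lam f g \<le>
    ennreal (half_const p q * T + half_const q p * T') * Lq_l2_norm p \<sigma> f * Lq_norm q \<omega> g"
  unfolding Lambda_def Lambda_over_eq
proof (intro SUP_least)
  fix \<Q> assume "\<Q> \<in> {\<R>. finite \<R> \<and> \<R> \<subseteq> dyadic n}"
  then have \<Q>: "finite \<Q>" "\<Q> \<subseteq> dyadic n" by auto
  let ?C = "half_const p q * T + half_const q p * T'"
  have C: "0 \<le> ?C" using half_const_pos[of p q] half_const_pos[of q p] p q T by simp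
  have fin: "K f < top" "K' g < top" using f g unfolding f.H_def g.H_def by auto
  have "(\<Sum>Q\<in>\<Q>. lam Q * enn2real (J f Q) * enn2real (J' g Q)) \<le>
    ?C * enn2real (K f) powr (1/p) * enn2real (K' g) powr (1/q)"
  proof (intro bilinear_bound f g \<Q> T)
    show "0 \<le> lam Q" if "Q \<in> \<Q>" for Q using lam \<Q> that by auto
  next
    fix P \<R> h assume P: "P \<in> \<Q>" and \<R>: "\<R> \<subseteq> {R \<in> \<Q>. R \<subseteq> P}" and h: "h \<in> g.H"
    have PD: "P \<in> dyadic n" and \<R>D: "\<R> \<subseteq> dyadic n" and \<R>P: "\<R> \<subseteq> {R \<in> dyadic n. R \<subseteq> P}" and fin\<R>: "finite \<R>"
      using P \<R> \<Q> finite_subset[OF \<R>] by auto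
    have h0: "nonneg_meas \<omega> h" "K' h < top" using h unfolding g.H_def by auto
    have "ennreal (\<Sum>R\<in>\<R>. lam R * enn2real (J (phi n p \<mu> P) R) * enn2real (J' h R)) \<le>
        Lambda_loc n P \<sigma> \<omega> \<mu> lam (phi n p \<mu> P) h"
      unfolding sum_enn2real_eq[OF f.test_H[OF PD] h \<R>D] by (rule sum_le_Lambda_loc[OF fin\<R> \<R>P])
    also have "\<dots> \<le> ennreal T * Lq_l2_norm p \<sigma> (phi n p \<mu> P) * Lq_norm q \<omega> h"
      using adm(1) PD h0(1) unfolding T_admissible_def by auto
    \<comment> \<open>By \<open>K_test\<close> the norm of the test function is its own mass to the
      power \<open>1/p\<close>, the form in which \<open>bilinear_bound\<close> expects it.\<close>
    also have "\<dots> = ennreal (T * enn2real (J (phi n p \<mu> P) P) powr (1/p) * enn2real (K' h) powr (1/q))"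
    proof -
      obtain a where a: "0 \<le> a" "J (phi n p \<mu> P) P = ennreal a" using f.J_test_finite[OF PD] by (cases "J (phi n p \<mu> P) P") auto
      obtain b where b: "0 \<le> b" "K' h = ennreal b" using h0(2) by (cases "K' h") auto
      show ?thesis
        unfolding Lq_l2_norm_eq Lq_norm_eq f.K_test[OF PD] a(2) b(2) using a(1) b(1) T by (simp add: ennreal_mult)
    qed
    finally show "(\<Sum>R\<in>\<R>. lam R * enn2real (J (phi n p \<mu> P) R) * enn2real (J' h R)) \<le>
        T * enn2real (J (phi n p \<mu> P) P) powr (1/p) * enn2real (K' h) powr (1/q)"
      using T by (subst (asm) ennreal_le_iff) auto
  next
    fix P \<R> h assume P: "P \<in> \<Q>" and \<R>: "\<R> \<subseteq> {R \<in> \<Q>. R \<subseteq> P}" and h: "h \<in> f.H"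
    have PD: "P \<in> dyadic n" and \<R>D: "\<R> \<subseteq> dyadic n" and \<R>P: "\<R> \<subseteq> {R \<in> dyadic n. R \<subseteq> P}" and fin\<R>: "finite \<R>"
      using P \<R> \<Q> finite_subset[OF \<R>] by auto
    have h0: "nonneg_meas (\<sigma> \<Otimes>\<^sub>M eta) h" "K h < top" using h unfolding f.H_def by auto
    have "ennreal (\<Sum>R\<in>\<R>. lam R * enn2real (J h R) * enn2real (J' (indicator P) R)) \<le>
        Lambda_loc n P \<sigma> \<omega> \<mu> lam h (indicator P)"
      unfolding sum_enn2real_eq[OF h g.test_H[OF PD] \<R>D] by (rule sum_le_Lambda_loc[OF fin\<R> \<R>P])
    also have "\<dots> \<le> ennreal T' * Lq_l2_norm p \<sigma> h * Lq_norm q \<omega> (indicator P)"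
      using adm(2) PD h0(1) unfolding T_star_admissible_def by auto
    also have "\<dots> = ennreal (T' * enn2real (K h) powr (1/p) * enn2real (J' (indicator P) P) powr (1/q))"
    proof -
      obtain a where a: "0 \<le> a" "J' (indicator P) P = ennreal a" using g.J_test_finite[OF PD] by (cases "J' (indicator P) P") auto
      obtain b where b: "0 \<le> b" "K h = ennreal b" using h0(2) by (cases "K h") auto
      show ?thesis
        unfolding Lq_l2_norm_eq Lq_norm_eq g.K_test[OF PD] a(2) b(2) using a(1) b(1) T by (simp add: ennreal_mult)
    qed
    finally show "(\<Sum>R\<in>\<R>. lam R * enn2real (J h R) * enn2real (J' (indicator P) R)) \<le>
        T' * enn2real (K h) powr (1/p) * enn2real (J' (indicator P) P) powr (1/q)"
      using T by (subst (asm) ennreal_le_iff) auto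
  qed
  then have "(\<Sum>Q\<in>\<Q>. ennreal (lam Q) * J f Q * J' g Q) \<le>
      ennreal (?C * enn2real (K f) powr (1/p) * enn2real (K' g) powr (1/q))"
    unfolding sum_enn2real_eq[OF f g \<Q>(2), symmetric] by (rule ennreal_leI)
  also have "\<dots> = ennreal ?C * Lq_l2_norm p \<sigma> f * Lq_norm q \<omega> g"
  proof -
    obtain a where a: "0 \<le> a" "K f = ennreal a" using fin by (cases "K f") auto
    obtain b where b: "0 \<le> b" "K' g = ennreal b" using fin by (cases "K' g") auto
    show ?thesis
      unfolding Lq_l2_norm_eq Lq_norm_eq a(2) b(2) using a(1) b(1) C by (simp add: ennreal_mult)
  qed
  finally show "(\<Sum>Q\<in>\<Q>. ennreal (lam Q) * J f Q * J' g Q) \<le> \<dots>" .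
qed

lemma Lambda_zero:
  assumes "\<And>Q. Q \<in> dyadic n \<Longrightarrow> J f Q = 0 \<or> J' g Q = 0"
  shows "Lambda n \<sigma> \<omega> \<mu> lam f g = 0"
proof -
  have "(\<Sum>Q\<in>\<R>. ennreal (lam Q) * J f Q * J' g Q) = 0" if "\<R> \<subseteq> dyadic n" for \<R>
    using assms that by (intro sum.neutral) fastforce
  then have "Lambda n \<sigma> \<omega> \<mu> lam f g \<le> 0"
    unfolding Lambda_def Lambda_over_eq by (intro SUP_least) auto
  then show ?thesis by simp
qed

text \<open>Vanishing and infinite norms are treated apart. If one norm is zero, the right side is
  zero even when the other norm is infinite, and the form vanishes by Hoelder's inequality. If both
  are nonzero and one is infinite, the right side is infinite because the constant is
  positive.\<close>

lemma Lambda_bound_of_admissible: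
  assumes T: "0 < T" "0 < T'" and adm: "T_admissible (ennreal T)" "T_star_admissible (ennreal T')"
  shows "Lambda_bound n p \<sigma> \<omega> \<mu> lam (ennreal (half_const p q * T + half_const q p * T'))"
  unfolding Lambda_bound_def
proof (intro allI impI)
  fix f g assume f: "nonneg_meas (\<sigma> \<Otimes>\<^sub>M eta) f" and g: "nonneg_meas \<omega> g"
  let ?C = "half_const p q * T + half_const q p * T'"
  have C: "0 < ?C" using half_const_pos[of p q] half_const_pos[of q p] p q T by (simp add: add_pos_pos)
  consider "K f = 0 \<or> K' g = 0" | "K f \<noteq> 0" "K' g \<noteq> 0" "K f = top \<or> K' g = top" | "K f < top" "K' g < top"
    unfolding less_top[symmetric] by blast
  then show "Lambda n \<sigma> \<omega> \<mu> lam f g \<le> ennreal ?C * Lq_l2_norm p \<sigma> f * Lq_norm q \<omega> g"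
  proof cases
    case 1
    have "J f Q = 0 \<or> J' g Q = 0" if "Q \<in> dyadic n" for Q
      using 1 f.J_holder[of f Q] g.J_holder[of g Q] f g that by auto
    then have "Lambda n \<sigma> \<omega> \<mu> lam f g = 0" by (rule Lambda_zero)
    then show ?thesis by simp
  next
    case 2
    then have "ennreal ?C * Lq_l2_norm p \<sigma> f * Lq_norm q \<omega> g = top"
      unfolding Lq_l2_norm_eq Lq_norm_eq using C
      by (auto simp: ennreal_mult_top ennreal_top_mult ennreal_mult_eq_top_iff simp del: ennreal_plus)
    then show ?thesis by simp
  next
    case 3
    then show ?thesis
      using f g T by (intro Lambda_le_of_finite adm) (auto simp: f.H_def g.H_def)
  qed
qed

lemma test_norm_finite: "Q \<in> dyadic n \<Longrightarrow> Lq_l2_norm p \<sigma> (phi n p \<mu> Q) < \<infinity>"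
  unfolding Lq_l2_norm_eq using f.K_test f.J_test_finite by simp

lemma testing_le_Lambda_bound:
  assumes "Lambda_bound n p \<sigma> \<omega> \<mu> lam C"
  shows "T_const n p \<sigma> \<omega> \<mu> lam \<le> C" "T_star_const n p \<sigma> \<omega> \<mu> lam \<le> C"
  unfolding T_const_eq T_star_const_eq using Lambda_bound_admissible[OF assms] by (auto intro: Inf_lower)

text \<open>Each testing constant is a lower bound for all global constants, hence at most their
  infimum; adding the two gives the factor 2.\<close>

lemma testing_le_Lambda_norm:
  "T_const n p \<sigma> \<omega> \<mu> lam + T_star_const n p \<sigma> \<omega> \<mu> lam \<le> ennreal 2 * Lambda_norm n p \<sigma> \<omega> \<mu> lam"
proof -
  have "T_const n p \<sigma> \<omega> \<mu> lam \<le> Lambda_norm n p \<sigma> \<omega> \<mu> lam" "T_star_const n p \<sigma> \<omega> \<mu> lam \<le> Lambda_norm n p \<sigma> \<omega> \<mu> lam"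
    unfolding Lambda_norm_def using testing_le_Lambda_bound by (auto intro: Inf_greatest)
  then have "T_const n p \<sigma> \<omega> \<mu> lam + T_star_const n p \<sigma> \<omega> \<mu> lam \<le> Lambda_norm n p \<sigma> \<omega> \<mu> lam + Lambda_norm n p \<sigma> \<omega> \<mu> lam"
    by (rule add_mono)
  then show ?thesis by (simp add: mult_2)
qed

lemma Lambda_bound_approx:
  assumes fin: "T_const n p \<sigma> \<omega> \<mu> lam + T_star_const n p \<sigma> \<omega> \<mu> lam < \<infinity>" and e: "0 < e"
  shows "Lambda_bound n p \<sigma> \<omega> \<mu> lam (ennreal (half_const p q * (enn2real (T_const n p \<sigma> \<omega> \<mu> lam) + e)
      + half_const q p * (enn2real (T_star_const n p \<sigma> \<omega> \<mu> lam) + e)))"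
proof -
  have fin: "Inf (Collect T_admissible) < \<infinity>" "Inf (Collect T_star_admissible) < \<infinity>"
    using fin unfolding T_const_eq T_star_const_eq by auto
  obtain C where C: "C \<in> Collect T_admissible" "C \<le> ennreal (enn2real (Inf (Collect T_admissible)) + e)"
    using Inf_ennreal_approx[OF fin(1) e] .
  obtain C' where C': "C' \<in> Collect T_star_admissible" "C' \<le> ennreal (enn2real (Inf (Collect T_star_admissible)) + e)"
    using Inf_ennreal_approx[OF fin(2) e] .
  show ?thesis
    unfolding T_const_eq T_star_const_eq
    using C C' e T_admissible_mono T_star_admissible_mono
    by (intro Lambda_bound_of_admissible add_nonneg_pos) (auto simp del: ennreal_plus)
qed

lemma Lambda_norm_le:
  assumes fin: "T_const n p \<sigma> \<omega> \<mu> lam + T_star_const n p \<sigma> \<omega> \<mu> lam < \<infinity>"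
  shows "Lambda_norm n p \<sigma> \<omega> \<mu> lam \<le>
    ennreal (half_const p q + half_const q p) * (T_const n p \<sigma> \<omega> \<mu> lam + T_star_const n p \<sigma> \<omega> \<mu> lam)"
proof (rule ennreal_le_epsilon)
  fix e :: real assume e: "0 < e"
  let ?c = "half_const p q" and ?d = "half_const q p"
  have cd: "0 < ?c" "0 < ?d" using half_const_pos[of p q] half_const_pos[of q p] p q by auto
  obtain s where s: "0 \<le> s" "T_const n p \<sigma> \<omega> \<mu> lam = ennreal s"
    using fin by (cases "T_const n p \<sigma> \<omega> \<mu> lam") auto
  obtain t where t: "0 \<le> t" "T_star_const n p \<sigma> \<omega> \<mu> lam = ennreal t"
    using fin by (cases "T_star_const n p \<sigma> \<omega> \<mu> lam") auto
  \<comment> \<open>Enlarging both testing constants by \<open>d\<close> costs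
    \<open>(?c + ?d) * d\<close>, which this choice makes equal to \<open>e\<close>.\<close>
  define d where "d = e / (?c + ?d)"
  have d: "0 < d" "(?c + ?d) * d = e" unfolding d_def using e cd by auto
  have "Lambda_norm n p \<sigma> \<omega> \<mu> lam \<le> ennreal (?c * (s + d) + ?d * (t + d))"
    unfolding Lambda_norm_def using Lambda_bound_approx[OF fin d(1)] s t by (intro Inf_lower) simp
  also have "\<dots> \<le> ennreal ((?c + ?d) * (s + t) + e)"
  proof (intro ennreal_leI)
    have "?c * (s + d) + ?d * (t + d) = (?c * s + ?d * t) + (?c + ?d) * d" by (simp add: algebra_simps)
    also have "\<dots> \<le> (?c + ?d) * (s + t) + e"
      unfolding d(2) using cd s t by (simp add: algebra_simps)
    finally show "?c * (s + d) + ?d * (t + d) \<le> (?c + ?d) * (s + t) + e" .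
  qed
  also have "\<dots> = ennreal (?c + ?d) * (ennreal s + ennreal t) + ennreal e"
    using cd s t e by (simp only: ennreal_plus ennreal_mult add_nonneg_nonneg mult_nonneg_nonneg less_imp_le)
  finally show "Lambda_norm n p \<sigma> \<omega> \<mu> lam \<le> ennreal (?c + ?d) * (T_const n p \<sigma> \<omega> \<mu> lam + T_star_const n p \<sigma> \<omega> \<mu> lam) + ennreal e"
    unfolding s t .
qed

lemma Lambda_bound_iff:
  "(\<exists>C<\<infinity>. Lambda_bound n p \<sigma> \<omega> \<mu> lam C) \<longleftrightarrow> T_const n p \<sigma> \<omega> \<mu> lam + T_star_const n p \<sigma> \<omega> \<mu> lam < \<infinity>"
proof
  assume "\<exists>C<\<infinity>. Lambda_bound n p \<sigma> \<omega> \<mu> lam C"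
  then obtain C where C: "C < \<infinity>" "Lambda_bound n p \<sigma> \<omega> \<mu> lam C" by blast
  then show "T_const n p \<sigma> \<omega> \<mu> lam + T_star_const n p \<sigma> \<omega> \<mu> lam < \<infinity>"
    using testing_le_Lambda_bound[OF C(2)] by (auto intro: le_less_trans)
next
  assume "T_const n p \<sigma> \<omega> \<mu> lam + T_star_const n p \<sigma> \<omega> \<mu> lam < \<infinity>"
  \<comment> \<open>Any positive error gives a finite constant; 1 is a convenient choice.\<close>
  from Lambda_bound_approx[OF this, of 1] show "\<exists>C<\<infinity>. Lambda_bound n p \<sigma> \<omega> \<mu> lam C"
    by (metis ennreal_less_top infinity_ennreal_def zero_less_one)
qed

end

theorem theorem1p1:
  shows "\<exists>c::real. \<forall>p\<ge>2. \<exists>c\<^sub>p::real.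
    \<forall>(n::nat) (\<sigma>::point measure) (\<omega>::point measure)
     (\<mu>::point \<times> real \<Rightarrow> real) (lam::point set \<Rightarrow> real).
      n \<ge> 1 \<longrightarrow> locally_finite_borel n \<sigma> \<longrightarrow> locally_finite_borel n \<omega> \<longrightarrow>
      nonneg_meas (\<sigma> \<Otimes>\<^sub>M eta) \<mu> \<longrightarrow>
      (\<forall>Q\<in>dyadic n. Lq_l2_norm (conj_exp p) \<sigma> (on_box n Q \<mu>) < \<infinity>) \<longrightarrow>
      (\<forall>Q\<in>dyadic n. 0 \<le> lam Q) \<longrightarrow>
        (\<forall>Q\<in>dyadic n. Lq_l2_norm p \<sigma> (phi n p \<mu> Q) < \<infinity>)
      \<and> ((\<exists>C<\<infinity>. Lambda_bound n p \<sigma> \<omega> \<mu> lam C)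
           \<longleftrightarrow> T_const n p \<sigma> \<omega> \<mu> lam + T_star_const n p \<sigma> \<omega> \<mu> lam < \<infinity>)
      \<and> (T_const n p \<sigma> \<omega> \<mu> lam + T_star_const n p \<sigma> \<omega> \<mu> lam < \<infinity> \<longrightarrow>
           Lambda_norm n p \<sigma> \<omega> \<mu> lam
             \<le> ennreal c\<^sub>p * (T_const n p \<sigma> \<omega> \<mu> lam + T_star_const n p \<sigma> \<omega> \<mu> lam)
         \<and> T_const n p \<sigma> \<omega> \<mu> lam + T_star_const n p \<sigma> \<omega> \<mu> lam
             \<le> ennreal c * Lambda_norm n p \<sigma> \<omega> \<mu> lam)"
\<comment> \<open>The absolute constant 2 comes from \<open>testing_le_Lambda_norm\<close>.\<close>
proof (rule exI[of _ 2], intro allI impI)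
  fix p :: real assume p: "2 \<le> p"
  \<comment> \<open>This constant is built from the two exponents alone, so it may be chosen before
    the dimension, the measures and the coefficients.\<close>
  let ?c = "half_const p (conj_exp p) + half_const (conj_exp p) p"
  show "\<exists>c\<^sub>p::real.
    \<forall>(n::nat) (\<sigma>::point measure) (\<omega>::point measure)
     (\<mu>::point \<times> real \<Rightarrow> real) (lam::point set \<Rightarrow> real).
      n \<ge> 1 \<longrightarrow> locally_finite_borel n \<sigma> \<longrightarrow> locally_finite_borel n \<omega> \<longrightarrow>
      nonneg_meas (\<sigma> \<Otimes>\<^sub>M eta) \<mu> \<longrightarrow>
      (\<forall>Q\<in>dyadic n. Lq_l2_norm (conj_exp p) \<sigma> (on_box n Q \<mu>) < \<infinity>) \<longrightarrow>
      (\<forall>Q\<in>dyadic n. 0 \<le> lam Q) \<longrightarrow>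
        (\<forall>Q\<in>dyadic n. Lq_l2_norm p \<sigma> (phi n p \<mu> Q) < \<infinity>)
      \<and> ((\<exists>C<\<infinity>. Lambda_bound n p \<sigma> \<omega> \<mu> lam C)
           \<longleftrightarrow> T_const n p \<sigma> \<omega> \<mu> lam + T_star_const n p \<sigma> \<omega> \<mu> lam < \<infinity>)
      \<and> (T_const n p \<sigma> \<omega> \<mu> lam + T_star_const n p \<sigma> \<omega> \<mu> lam < \<infinity> \<longrightarrow>
           Lambda_norm n p \<sigma> \<omega> \<mu> lam
             \<le> ennreal c\<^sub>p * (T_const n p \<sigma> \<omega> \<mu> lam + T_star_const n p \<sigma> \<omega> \<mu> lam)
         \<and> T_const n p \<sigma> \<omega> \<mu> lam + T_star_const n p \<sigma> \<omega> \<mu> lam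
             \<le> ennreal 2 * Lambda_norm n p \<sigma> \<omega> \<mu> lam)"
  proof (rule exI[of _ ?c], intro allI impI)
    fix n :: nat and \<sigma> \<omega> :: "point measure" and \<mu> :: "point \<times> real \<Rightarrow> real" and lam :: "point set \<Rightarrow> real"
    assume *: "n \<ge> 1" "locally_finite_borel n \<sigma>" "locally_finite_borel n \<omega>" "nonneg_meas (\<sigma> \<Otimes>\<^sub>M eta) \<mu>"
      "\<forall>Q\<in>dyadic n. Lq_l2_norm (conj_exp p) \<sigma> (on_box n Q \<mu>) < \<infinity>" "\<forall>Q\<in>dyadic n. 0 \<le> lam Q"
    interpret two_weight n p \<sigma> \<mu> \<omega> lam
      using * p by unfold_locales (auto simp: locally_finite_borel_def)
    show "(\<forall>Q\<in>dyadic n. Lq_l2_norm p \<sigma> (phi n p \<mu> Q) < \<infinity>)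
      \<and> ((\<exists>C<\<infinity>. Lambda_bound n p \<sigma> \<omega> \<mu> lam C)
           \<longleftrightarrow> T_const n p \<sigma> \<omega> \<mu> lam + T_star_const n p \<sigma> \<omega> \<mu> lam < \<infinity>)
      \<and> (T_const n p \<sigma> \<omega> \<mu> lam + T_star_const n p \<sigma> \<omega> \<mu> lam < \<infinity> \<longrightarrow>
           Lambda_norm n p \<sigma> \<omega> \<mu> lam
             \<le> ennreal ?c * (T_const n p \<sigma> \<omega> \<mu> lam + T_star_const n p \<sigma> \<omega> \<mu> lam)
         \<and> T_const n p \<sigma> \<omega> \<mu> lam + T_star_const n p \<sigma> \<omega> \<mu> lam
             \<le> ennreal 2 * Lambda_norm n p \<sigma> \<omega> \<mu> lam)"
      using test_norm_finite Lambda_bound_iff Lambda_norm_le testing_le_Lambda_norm by (intro conjI ballI impI)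
  qed
qed

end
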